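(* Assume the continuum hypothesis (CH), or, instead of CH, assume only that the union of fewer than $2^{\aleph_0}$ sets of reals of the first category is not $\mathbb{R}$. Then: (A) The monadic theory of $(2^{\le\omega},\le,\prec)$ is undecidable. (B) For $n\ge 1$, the monadic theory of $$K_n=\{(2^{\le\omega},\le,\prec,Q_1,\ldots,Q_n): Q_1,\dots,Q_n\subseteq 2^{\le\omega}\},$$ where the set quantifiers range over subsets of $2^{\le\omega}$, is undecidable. Moreover, the same is true when the set quantifiers range only over subsets of $2^{<\omega}$.
   Context: $2^{\le\omega}$ is the set of sequences of zeros and ones of length $\le\omega$, and $2^{<\omega}$ is the set of those of finite length. $\le$ is the partial order "is an initial segment of" on $2^{\le\omega}$, and $\prec$ is the lexicographic order. Monadic logic is first-order logic augmented by set variables and quantification over them (ranging over all subsets of the universe unless restricted as indicated). The monadic theory of a class $K$ of structures is the set of all monadic sentences true in every member of $K$; the monadic theory of a structure $M$ is that of $\{M\}$. A set is of the first category if it is a countable union of nowhere dense sets. *)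

theory Defs
  imports "HOL-Analysis.Analysis" "HOL-Library.Equipollence" "HOL-Library.Nat_Bijection"
begin

section \<open>Set-theoretic hypotheses\<close>

definition continuum_hypothesis :: bool where
  "continuum_hypothesis \<longleftrightarrow> (\<forall>A :: real set. countable A \<or> A \<approx> (UNIV :: real set))"

definition nowhere_dense :: "'a::topological_space set \<Rightarrow> bool" where
  "nowhere_dense A \<longleftrightarrow> interior (closure A) = {}"

definition first_category :: "'a::topological_space set \<Rightarrow> bool" where
  "first_category A \<longleftrightarrow> (\<exists>\<N>. countable \<N> \<and> (\<forall>N\<in>\<N>. nowhere_dense N) \<and> A = \<Union>\<N>)"

definition small_category_unions_not_UNIV :: bool where
  "small_category_unions_not_UNIV \<longleftrightarrow>
     (\<forall>\<F> :: real set set. \<F> \<prec> (UNIV :: nat set set) \<longrightarrow> (\<forall>A\<in>\<F>. first_category A)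
        \<longrightarrow> \<Union>\<F> \<noteq> UNIV)"

section \<open>Monadic logic\<close>

text \<open>
  The language has two binary relation symbols (for \<open>\<le>\<close> and \<open>\<prec>\<close>) and unary predicate symbols.
  Element variables and set variables are separate sorts, each named by natural numbers.
  The predicate symbols are numbered from 0, so \<open>Pred i x\<close> stands for \<open>Q\<^bsub>i+1\<^esub>(x)\<close>.
\<close>

datatype mfm =
    Eq nat nat
  | Le nat nat
  | Lex nat nat
  | Pred nat nat
  | Mem nat nat  \<comment> \<open>element variable, set variable\<close>
  | Neg mfm
  | Conj mfm mfm
  | Ex nat mfm
  | ExSet nat mfm

primrec elem_vars :: "mfm \<Rightarrow> nat set" where
  "elem_vars (Eq x y) = {x, y}"
| "elem_vars (Le x y) = {x, y}"
| "elem_vars (Lex x y) = {x, y}"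
| "elem_vars (Pred i x) = {x}"
| "elem_vars (Mem x X) = {x}"
| "elem_vars (Neg p) = elem_vars p"
| "elem_vars (Conj p q) = elem_vars p \<union> elem_vars q"
| "elem_vars (Ex x p) = elem_vars p - {x}"
| "elem_vars (ExSet X p) = elem_vars p"

primrec set_vars :: "mfm \<Rightarrow> nat set" where
  "set_vars (Eq x y) = {}"
| "set_vars (Le x y) = {}"
| "set_vars (Lex x y) = {}"
| "set_vars (Pred i x) = {}"
| "set_vars (Mem x X) = {X}"
| "set_vars (Neg p) = set_vars p"
| "set_vars (Conj p q) = set_vars p \<union> set_vars q"
| "set_vars (Ex x p) = set_vars p"
| "set_vars (ExSet X p) = set_vars p - {X}"

primrec pred_symbols :: "mfm \<Rightarrow> nat set" where
  "pred_symbols (Eq x y) = {}"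
| "pred_symbols (Le x y) = {}"
| "pred_symbols (Lex x y) = {}"
| "pred_symbols (Pred i x) = {i}"
| "pred_symbols (Mem x X) = {}"
| "pred_symbols (Neg p) = pred_symbols p"
| "pred_symbols (Conj p q) = pred_symbols p \<union> pred_symbols q"
| "pred_symbols (Ex x p) = pred_symbols p"
| "pred_symbols (ExSet X p) = pred_symbols p"

definition sentence :: "nat \<Rightarrow> mfm \<Rightarrow> bool" where
  "sentence n p \<longleftrightarrow> elem_vars p = {} \<and> set_vars p = {} \<and> pred_symbols p \<subseteq> {..<n}"

record 'a mstructure =
  universe :: "'a set"
  le_rel :: "'a \<Rightarrow> 'a \<Rightarrow> bool"
  lex_rel :: "'a \<Rightarrow> 'a \<Rightarrow> bool"
  preds :: "'a set list"

text \<open>In \<open>sat S M e E p\<close> the set quantifiers range over the subsets of \<open>S\<close>, while the element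
  quantifiers always range over the whole universe of \<open>M\<close>.\<close>

primrec sat :: "'a set \<Rightarrow> 'a mstructure \<Rightarrow> (nat \<Rightarrow> 'a) \<Rightarrow> (nat \<Rightarrow> 'a set) \<Rightarrow> mfm \<Rightarrow> bool" where
  "sat S M e E (Eq x y) \<longleftrightarrow> e x = e y"
| "sat S M e E (Le x y) \<longleftrightarrow> le_rel M (e x) (e y)"
| "sat S M e E (Lex x y) \<longleftrightarrow> lex_rel M (e x) (e y)"
| "sat S M e E (Pred i x) \<longleftrightarrow> e x \<in> preds M ! i"
| "sat S M e E (Mem x X) \<longleftrightarrow> e x \<in> E X"
| "sat S M e E (Neg p) \<longleftrightarrow> \<not> sat S M e E p"
| "sat S M e E (Conj p q) \<longleftrightarrow> sat S M e E p \<and> sat S M e E q"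
| "sat S M e E (Ex x p) \<longleftrightarrow> (\<exists>a\<in>universe M. sat S M (e(x := a)) E p)"
| "sat S M e E (ExSet X p) \<longleftrightarrow> (\<exists>A. A \<subseteq> S \<and> sat S M e (E(X := A)) p)"

definition restricted_monadic_theory :: "nat \<Rightarrow> 'a set \<Rightarrow> 'a mstructure set \<Rightarrow> mfm set" where
  "restricted_monadic_theory n S K = {p. sentence n p \<and> (\<forall>M\<in>K. \<forall>e E. sat S M e E p)}"

definition monadic_theory :: "nat \<Rightarrow> 'a mstructure set \<Rightarrow> mfm set" where
  "monadic_theory n K = {p. sentence n p \<and> (\<forall>M\<in>K. \<forall>e E. sat (universe M) M e E p)}"

section \<open>Decidability\<close>

text \<open>
  \<open>recursive n f\<close>: the function \<open>f\<close>, of which only the values on lists of length \<open>n\<close> matter, is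
  a (total) general recursive function of \<open>n\<close> arguments. Minimization is restricted to regular
  functions, so no partial functions arise.
\<close>

inductive recursive :: "nat \<Rightarrow> (nat list \<Rightarrow> nat) \<Rightarrow> bool" where
  zero: "recursive n (\<lambda>xs. 0)"
| succ: "recursive 1 (\<lambda>xs. Suc (hd xs))"
| proj: "i < n \<Longrightarrow> recursive n (\<lambda>xs. xs ! i)"
| comp: "recursive (length gs) f \<Longrightarrow> (\<forall>g\<in>set gs. recursive n g)
    \<Longrightarrow> recursive n (\<lambda>xs. f (map (\<lambda>g. g xs) gs))"
| prec: "recursive n f \<Longrightarrow> recursive (Suc (Suc n)) g
    \<Longrightarrow> recursive (Suc n) (\<lambda>xs. rec_nat (f (tl xs)) (\<lambda>y r. g (y # r # tl xs)) (hd xs))"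
| minim: "recursive (Suc n) f \<Longrightarrow> (\<forall>xs. length xs = n \<longrightarrow> (\<exists>y. f (y # xs) = 0))
    \<Longrightarrow> recursive n (\<lambda>xs. LEAST y. f (y # xs) = 0)"

definition recursive_set :: "nat set \<Rightarrow> bool" where
  "recursive_set A \<longleftrightarrow> (\<exists>f. recursive 1 f \<and> (\<forall>k. f [k] = (if k \<in> A then 1 else 0)))"

primrec code :: "mfm \<Rightarrow> nat" where
  "code (Eq x y) = prod_encode (0, prod_encode (x, y))"
| "code (Le x y) = prod_encode (1, prod_encode (x, y))"
| "code (Lex x y) = prod_encode (2, prod_encode (x, y))"
| "code (Pred i x) = prod_encode (3, prod_encode (i, x))"
| "code (Mem x X) = prod_encode (4, prod_encode (x, X))"
| "code (Neg p) = prod_encode (5, code p)"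
| "code (Conj p q) = prod_encode (6, prod_encode (code p, code q))"
| "code (Ex x p) = prod_encode (7, prod_encode (x, code p))"
| "code (ExSet X p) = prod_encode (8, prod_encode (X, code p))"

lemma code_inject: "code p = code q \<Longrightarrow> p = q"
  by (induction p arbitrary: q; case_tac q; simp)

definition decidable :: "mfm set \<Rightarrow> bool" where
  "decidable T \<longleftrightarrow> recursive_set (code ` T)"

section \<open>The tree of binary sequences of length at most omega\<close>

text \<open>A sequence is a partial function on \<open>nat\<close> whose domain is an initial segment of \<open>nat\<close>.\<close>

definition seqs :: "(nat \<rightharpoonup> bool) set" where
  "seqs = {s. \<forall>i j. i < j \<longrightarrow> j \<in> dom s \<longrightarrow> i \<in> dom s}"

definition fin_seqs :: "(nat \<rightharpoonup> bool) set" where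
  "fin_seqs = {s \<in> seqs. finite (dom s)}"

text \<open>For sequences, being an initial segment is inclusion of graphs, i.e. \<open>map_le\<close>. The
  lexicographic order is strict, and a proper initial segment precedes its extensions.\<close>

definition lex_less :: "(nat \<rightharpoonup> bool) \<Rightarrow> (nat \<rightharpoonup> bool) \<Rightarrow> bool" where
  "lex_less s t \<longleftrightarrow> (s \<subseteq>\<^sub>m t \<and> s \<noteq> t) \<or>
     (\<exists>n. (\<forall>i<n. s i = t i) \<and> s n = Some False \<and> t n = Some True)"

definition tree_structure :: "(nat \<rightharpoonup> bool) set list \<Rightarrow> (nat \<rightharpoonup> bool) mstructure" where
  "tree_structure Qs =
     \<lparr>universe = seqs, le_rel = (\<lambda>s t. s \<subseteq>\<^sub>m t), lex_rel = lex_less, preds = Qs\<rparr>"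

definition tree_class :: "nat \<Rightarrow> (nat \<rightharpoonup> bool) mstructure set" where
  "tree_class n = {tree_structure Qs | Qs. length Qs = n \<and> (\<forall>Q\<in>set Qs. Q \<subseteq> seqs)}"

end

theory Submission
  imports Defs "HOL-Library.Sublist"
begin

text \<open>
  Work with the tree of finite binary sequences. Given a family of sets of nodes, call a tree thin
  if all its splitting nodes lie in one member of the family, and thick if this fails above each of
  its nodes. A thin tree is nowhere dense in a thick one, so by the category hypothesis one can
  select from each thick tree a branch avoiding fewer than continuum many thin trees. The set
  \<open>Q\<close> of the selected branches meets every thick tree, but has fewer than continuum many points in
  a thin tree and hence misses a perfect subtree of it. So the formula ``some tree with its
  splitting nodes in \<open>A \<union> B \<union> C\<close>, each of the three being dense among them, misses \<open>Q\<close>'' tells whether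
  \<open>A\<close>, \<open>B\<close>, \<open>C\<close> are, locally, compatible with one member of the family.

  Colour the nodes by natural numbers (in three copies, together with a marker) and take the
  family of sets \<open>{(n,0), (n,1), marker}\<close>, \<open>{(n,0), (n,2), marker}\<close> and \<open>{(x,0), (y,1), (\<langle>x,y\<rangle>,2)}\<close>. Then the
  sets of nodes which are locally monochromatic, and the pairing function on colours, become
  definable from \<open>Q\<close> with quantifiers over sets of nodes only. Every recursive function is then
  defined by a formula which is positive in the following sense: the true values are attained in
  every structure that satisfies the totality of pairing, and in the structure of the selector only
  the true values are attained. Diagonalizing over a supposed decision procedure gives a
  contradiction.
\<close>

text \<open>Without \<open>Q\<close>, quantification over sets of nodes of the binary tree gives a
  decidable theory (Rabin), so everything has to be read off from the trees that \<open>Q\<close>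
  misses. A selector exists for every nonempty family of sets of nodes, hence the family may be
  designed at will, as a list of permitted combinations of colours. A test takes three sets because
  pairing has three places, and a number has three copies so that these places stay distinguishable.
  The marker is there because any colours \<open>x\<close>, \<open>y\<close> of kinds 0 and 1 share
  some pairing face; only next to the marker does compatibility mean equality. What a set codes
  depends on the cone, so every relation carries a node, persists upwards, and existence is claimed
  only above an extension, as in forcing. In an arbitrary structure nothing bounds the values of a
  relation from above.\<close>

definition restr :: "(nat \<Rightarrow> bool) \<Rightarrow> nat \<Rightarrow> bool list" where
  "restr x n = map x [0..<n]"

definition tree :: "bool list set \<Rightarrow> bool" where
  "tree T \<longleftrightarrow> T \<noteq> {} \<and> (\<forall>u v. prefix u v \<longrightarrow> v \<in> T \<longrightarrow> u \<in> T)"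

definition splits :: "bool list set \<Rightarrow> bool list set" where
  "splits T = {u. u @ [False] \<in> T \<and> u @ [True] \<in> T}"

definition body :: "bool list set \<Rightarrow> (nat \<Rightarrow> bool) set" where
  "body T = {x. \<forall>n. restr x n \<in> T}"

definition dense_below :: "bool list \<Rightarrow> bool list set \<Rightarrow> bool" where
  "dense_below t A \<longleftrightarrow> (\<forall>u. prefix t u \<longrightarrow> (\<exists>v\<in>A. prefix u v))"

text \<open>Density above every node of \<open>T\<close>, rather than mere occurrence, lets the test
  survive restriction to a cone of \<open>T\<close>. As all splitting nodes extend \<open>t\<close>,
  the nodes of \<open>T\<close> not above \<open>t\<close> are just initial parts of
  \<open>t\<close>.\<close>

definition good :: "(nat \<Rightarrow> bool) set \<Rightarrow> bool list \<Rightarrow> bool list set \<Rightarrow> bool list set \<Rightarrow> bool list set \<Rightarrow> bool"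
  where "good Q t A B C \<longleftrightarrow> (\<exists>T. tree T \<and> (\<forall>u\<in>splits T. prefix t u \<and> u \<in> A \<union> B \<union> C) \<and>
     (\<forall>u\<in>T. (\<exists>v\<in>splits T \<inter> A. prefix u v) \<and> (\<exists>v\<in>splits T \<inter> B. prefix u v) \<and>
             (\<exists>v\<in>splits T \<inter> C. prefix u v)) \<and>
     Q \<inter> body T = {})"

lemma length_restr [simp]: "length (restr x n) = n"
  by (simp add: restr_def)

lemma restr_nth [simp]: "i < n \<Longrightarrow> restr x n ! i = x i"
  by (simp add: restr_def)

lemma restr_0 [simp]: "restr x 0 = []"
  by (simp add: restr_def)

lemma restr_Suc: "restr x (Suc n) = restr x n @ [x n]"
  by (simp add: restr_def)

lemma prefix_nth: "prefix u v \<longleftrightarrow> length u \<le> length v \<and> (\<forall>i<length u. u ! i = v ! i)"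
  by (metis (no_types, lifting) append_eq_conv_conj nth_equalityI nth_take prefix_def
      prefix_length_le take_is_prefix length_take min.absorb2)

lemma tree_prefix: "tree T \<Longrightarrow> v \<in> T \<Longrightarrow> prefix u v \<Longrightarrow> u \<in> T"
  by (auto simp: tree_def)

section \<open>Category\<close>

text \<open>Under CH a family smaller than the continuum is countable, and Baire's theorem applies
  to the complements of the closures. The other hypothesis applies because nowhere dense sets are of
  the first category.\<close>

lemma small_category_unions_nowhere_dense:
  assumes "continuum_hypothesis \<or> small_category_unions_not_UNIV"
    and small: "\<F> \<prec> (UNIV :: nat set set)" and nd: "\<And>A. A \<in> \<F> \<Longrightarrow> nowhere_dense (A :: real set)"
  shows "\<Union>\<F> \<noteq> UNIV"
  using assms(1)
proof
  assume "small_category_unions_not_UNIV"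
  moreover have "first_category A" if "A \<in> \<F>" for A
    unfolding first_category_def using nd[OF that] by (intro exI[of _ "{A}"]) auto
  ultimately show ?thesis using small by (auto simp: small_category_unions_not_UNIV_def)
next
  assume CH: continuum_hypothesis
  have less: "\<F> \<prec> (UNIV :: real set)"
    by (rule lesspoll_eq_trans[OF small nat_sets_eqpoll_reals])
  \<comment> \<open>CH is stated for sets of reals, so the family is replaced by an injective image
    of it in the reals.\<close>
  then obtain f :: "real set \<Rightarrow> real" where f: "inj_on f \<F>"
    using lesspoll_imp_lepoll[OF less] by (auto simp: lepoll_def)
  have "\<not> f ` \<F> \<approx> (UNIV :: real set)"
    using less f by (simp add: lesspoll_def)
  then have "countable (f ` \<F>)"
    using CH[unfolded continuum_hypothesis_def, THEN spec, of "f ` \<F>"] by argo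
  then have cF: "countable \<F>"
    using f by (simp add: countable_image_inj_eq)
  let ?G = "(\<lambda>A. - closure A) ` \<F>"
  have "UNIV \<subseteq> closure (\<Inter>?G)"
  proof (rule Baire)
    show "countable ?G" using cF by simp
    fix T assume "T \<in> ?G"
    then obtain A where A: "A \<in> \<F>" "T = - closure A" by auto
    then have "interior (closure A) = {}" using nd by (simp add: nowhere_dense_def)
    then show "openin (top_of_set UNIV) T \<and> UNIV \<subseteq> closure T"
      using A by (simp add: closure_complement open_Compl)
  qed simp
  then have "\<Inter>?G \<noteq> {}" by auto
  then obtain x where "\<And>A. A \<in> \<F> \<Longrightarrow> x \<notin> closure A" by auto
  then have "x \<notin> \<Union>\<F>" using closure_subset by blast
  then show ?thesis by blast
qed

section \<open>Transfer between the reals and Cantor space by binary digits\<close>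

definition bits :: "real \<Rightarrow> nat \<Rightarrow> bool" where
  "bits r n \<longleftrightarrow> odd \<lfloor>r * 2 ^ Suc n\<rfloor>"

lemma floor_half: "\<lfloor>y / 2\<rfloor> = \<lfloor>y\<rfloor> div 2" for y :: real
  using floor_divide_real_eq_div[of 2 y] by simp

lemma bits_restr:
  assumes "\<lfloor>r * 2 ^ n\<rfloor> = \<lfloor>r' * 2 ^ n\<rfloor>" 
  shows "restr (bits r) n = restr (bits r') n"
proof -
  have "\<lfloor>r * 2 ^ (n - k)\<rfloor> = \<lfloor>r' * 2 ^ (n - k)\<rfloor>" if "k \<le> n" for k
    using that
  proof (induction k)
    case (Suc k)
    then have *: "n - k = Suc (n - Suc k)" by simp
    have "\<lfloor>q * 2 ^ (n - Suc k)\<rfloor> = \<lfloor>q * 2 ^ (n - k)\<rfloor> div 2" for q :: real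
      unfolding * using floor_half[of "q * 2 ^ Suc (n - Suc k)"] by simp
    then show ?case using Suc by simp
  qed (use assms in simp)
  from this[of "n - Suc m" for m] have "\<lfloor>r * 2 ^ Suc m\<rfloor> = \<lfloor>r' * 2 ^ Suc m\<rfloor>" if "m < n" for m
    using that by (metis Suc_leI diff_diff_cancel diff_le_self)
  then show ?thesis
    by (intro nth_equalityI) (simp_all add: bits_def)
qed

text \<open>Digits can be prescribed one at a time: the next digit selects one of the two halves,
  numbered \<open>2 * k\<close> and \<open>2 * k + 1\<close>, of the dyadic interval numbered
  \<open>k\<close>.\<close>

lemma bits_dyadic:
  "\<exists>k::int. \<forall>r. \<lfloor>r * 2 ^ (n + length u)\<rfloor> = k \<longrightarrow> \<lfloor>r * 2 ^ n\<rfloor> = j \<and> (\<forall>i<length u. bits r (n + i) = u ! i)"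
proof (induction u rule: rev_induct)
  case Nil
  then show ?case by auto
next
  case (snoc b u)
  then obtain k where k: "\<And>r. \<lfloor>r * 2 ^ (n + length u)\<rfloor> = k \<Longrightarrow>
      \<lfloor>r * 2 ^ n\<rfloor> = j \<and> (\<forall>i<length u. bits r (n + i) = u ! i)" by blast
  show ?case
  proof (intro exI[of _ "2 * k + of_bool b"] allI impI)
    fix r :: real assume r: "\<lfloor>r * 2 ^ (n + length (u @ [b]))\<rfloor> = 2 * k + of_bool b"
    have "\<lfloor>r * 2 ^ (n + length u)\<rfloor> = \<lfloor>r * 2 ^ Suc (n + length u)\<rfloor> div 2"
      using floor_half[of "r * 2 ^ Suc (n + length u)"] by simp
    also have "\<dots> = k" using r by (cases b) simp_all
    finally have 1: "\<lfloor>r * 2 ^ n\<rfloor> = j" "\<And>i. i < length u \<Longrightarrow> bits r (n + i) = u ! i" using k by auto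
    have "bits r (n + length u) = b"
      using r by (simp add: bits_def)
    then show "\<lfloor>r * 2 ^ n\<rfloor> = j \<and> (\<forall>i<length (u @ [b]). bits r (n + i) = (u @ [b]) ! i)"
      using 1 by (auto simp: nth_append less_Suc_eq)
  qed
qed

text \<open>The digit map is discontinuous at dyadic points, so the argument uses interiors of
  dyadic intervals: every ball contains one on which the digits begin with an extension
  \<open>v\<close> that no member of \<open>S\<close> has.\<close>

lemma bits_nowhere_dense:
  assumes "\<And>u. \<exists>v. prefix u v \<and> (\<forall>x\<in>S. restr x (length v) \<noteq> v)"
  shows "nowhere_dense (bits -` S)"
proof -
  have "\<exists>r\<in>I. r \<notin> closure (bits -` S)" if I: "open I" "x \<in> I" for I x
  proof -
    obtain e where e: "e > 0" "ball x e \<subseteq> I" using I openE by blast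
    obtain n where n: "(1 / 2) ^ n < e / 2"
      using real_arch_pow_inv[of "e / 2" "1 / 2"] e by auto
    define j where "j = \<lfloor>x * 2 ^ n\<rfloor>"
    obtain v where v: "prefix (restr (bits x) n) v" "\<And>y. y \<in> S \<Longrightarrow> restr y (length v) \<noteq> v"
      using assms by blast
    then obtain w where w: "v = restr (bits x) n @ w" by (auto simp: prefix_def)
    obtain k where k: "\<And>r. \<lfloor>r * 2 ^ (n + length w)\<rfloor> = k \<Longrightarrow>
        \<lfloor>r * 2 ^ n\<rfloor> = j \<and> (\<forall>i<length w. bits r (n + i) = w ! i)"
      using bits_dyadic[of n w j] by blast
    define J :: "real set" where "J = {r. of_int k < r * 2 ^ (n + length w) \<and>
        r * 2 ^ (n + length w) < of_int k + 1}"
    have J: "\<lfloor>r * 2 ^ (n + length w)\<rfloor> = k" if "r \<in> J" for r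
      using that by (auto simp: J_def intro!: floor_unique)
    have "r \<in> ball x e \<and> bits r \<notin> S" if "r \<in> J" for r
    proof
      have 1: "\<lfloor>r * 2 ^ n\<rfloor> = j" "\<And>i. i < length w \<Longrightarrow> bits r (n + i) = w ! i" 
        using k[OF J[OF that]] by auto
      have "restr (bits r) n = restr (bits x) n" using 1(1) by (intro bits_restr) (simp add: j_def)
      then have "restr (bits r) (length v) ! i = v ! i" if "i < length v" for i
      proof (cases "i < n")
        case True
        then show ?thesis
          using arg_cong[OF \<open>restr (bits r) n = _\<close>, of "\<lambda>l. l ! i"] that by (simp add: w nth_append)
      next
        case False
        then show ?thesis
          using 1(2)[of "i - n"] that by (simp add: w nth_append)
      qed
      then have "restr (bits r) (length v) = v"
        by (intro nth_equalityI) auto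
      then show "bits r \<notin> S" using v(2) by auto
      have "\<bar>r * 2 ^ n - x * 2 ^ n\<bar> < 1"
        using 1(1) unfolding j_def by linarith
      then have "\<bar>r - x\<bar> * 2 ^ n < 1" by (simp add: abs_mult flip: left_diff_distrib)
      then have "\<bar>r - x\<bar> < (1/2) ^ n" by (simp add: field_simps power_divide)
      then show "r \<in> ball x e" using n e(1) by (simp add: dist_real_def)
    qed
    moreover have "open J" unfolding J_def
      by (intro open_Collect_conj open_Collect_less continuous_intros)
    moreover have "(of_int k + 1 / 2) / 2 ^ (n + length w) \<in> J"
      by (simp add: J_def)
    ultimately show ?thesis using e(2) open_Int_closure_eq_empty[of J "bits -` S"] by blast
  qed
  then show ?thesis
    unfolding nowhere_dense_def
    by (metis (no_types, lifting) equals0I interior_subset open_interior subsetD)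
qed

text \<open>The form in which the category hypothesis is applied: nowhere density is put
  combinatorially, and \<open>bits\<close> carries the sets to the reals.\<close>

lemma cantor_not_small_union:
  assumes H: "continuum_hypothesis \<or> small_category_unions_not_UNIV"
    and small: "I \<prec> (UNIV :: nat set set)"
    and nd: "\<And>i u. i \<in> I \<Longrightarrow> \<exists>v. prefix u v \<and> (\<forall>x\<in>S i. restr x (length v) \<noteq> v)"
  shows "\<exists>x. \<forall>i\<in>I. x \<notin> S i"
proof -
  have "\<Union>((\<lambda>i. bits -` S i) ` I) \<noteq> UNIV"
  proof (rule small_category_unions_nowhere_dense[OF H])
    show "(\<lambda>i. bits -` S i) ` I \<prec> (UNIV :: nat set set)"
      by (rule lesspoll_trans1[OF image_lepoll small])
    show "nowhere_dense A" if "A \<in> (\<lambda>i. bits -` S i) ` I" for A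
      using that nd bits_nowhere_dense by (metis (no_types, lifting) imageE)
  qed
  then show ?thesis by auto
qed

section \<open>Thick and thin trees\<close>

definition thick :: "bool list set set \<Rightarrow> bool list set \<Rightarrow> bool" where
  "thick \<B> T \<longleftrightarrow> tree T \<and> (\<forall>t\<in>T. \<forall>B\<in>\<B>. \<exists>u\<in>splits T. prefix t u \<and> u \<notin> B)"

definition thin :: "bool list set set \<Rightarrow> bool list set \<Rightarrow> bool" where
  "thin \<B> T \<longleftrightarrow> tree T \<and> (\<exists>B\<in>\<B>. splits T \<subseteq> B)"

lemma thick_not_thin: "thick \<B> T \<Longrightarrow> \<not> thin \<B> T"
  unfolding thick_def thin_def tree_def by blast

text \<open>Bit \<open>b n\<close> is obeyed only if the node reached at level \<open>n\<close>
  splits; elsewhere \<open>T\<close> dictates the step. Indexing \<open>b\<close> by levels and not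
  by splitting nodes keeps initial segments of \<open>b\<close> and of the branch equally
  long.\<close>

primrec walk :: "bool list set \<Rightarrow> (nat \<Rightarrow> bool) \<Rightarrow> nat \<Rightarrow> bool list" where
  "walk T b 0 = []"
| "walk T b (Suc n) = walk T b n @
    [if walk T b n \<in> splits T then b n else walk T b n @ [True] \<in> T]"

definition branch_along :: "bool list set \<Rightarrow> (nat \<Rightarrow> bool) \<Rightarrow> nat \<Rightarrow> bool" where
  "branch_along T b n = last (walk T b (Suc n))"

lemma restr_path: "restr (branch_along T b) n = walk T b n"
  by (induction n) (simp_all add: restr_Suc branch_along_def)

lemma length_walk [simp]: "length (walk T b n) = n"
  by (induction n) auto

lemma walk_cong: "(\<And>i. i < n \<Longrightarrow> b i = c i) \<Longrightarrow> walk T b n = walk T c n"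
  by (induction n) auto

text \<open>A nonempty family makes thickness exclude dead ends: above every node there is a
  splitting node, so some child stays in \<open>T\<close>.\<close>

lemma walk_in_tree:
  assumes "thick \<B> T" "\<B> \<noteq> {}"
  shows "walk T b n \<in> T"
proof (induction n)
  case 0
  then show ?case using assms by (auto simp: thick_def tree_def)
next
  case (Suc n)
  let ?w = "walk T b n"
  obtain u where u: "u \<in> splits T" "prefix ?w u"
    using Suc assms unfolding thick_def by blast
  have "\<exists>c. ?w @ [c] \<in> T"
  proof (cases "u = ?w")
    case True
    then show ?thesis using u by (auto simp: splits_def)
  next
    case False
    then obtain c z where "u = ?w @ c # z"
      using u by (metis append_Nil2 neq_Nil_conv prefixE)
    then have "prefix (?w @ [c]) (u @ [True])" by simp
    then show ?thesis
      using assms u tree_prefix unfolding thick_def splits_def by blast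
  qed
  then show ?case
    by (cases "b n"; auto simp: splits_def) (metis (full_types))+
qed

text \<open>At a splitting node \<open>b\<close> supplies the next entry of \<open>y\<close>;
  elsewhere only one child lies in \<open>T\<close>, and \<open>y\<close> passes through it.\<close>

lemma walk_follow:
  assumes T: "tree T" "y \<in> T" "prefix (walk T b n) y"
    and b: "\<And>i. n \<le> i \<Longrightarrow> i < length y \<Longrightarrow> b i = y ! i"
  shows "walk T b (length y) = y"
proof -
  have "walk T b k = take k y" if "n \<le> k" "k \<le> length y" for k
    using that
  proof (induction k rule: dec_induct)
    case base
    then show ?case using T(3) by (metis append_eq_conv_conj length_walk prefixE)
  next
    case (step k)
    then have eq: "walk T b k = take k y" and k: "k < length y" by auto
    have "take k y @ [y ! k] = take (Suc k) y" using k by (simp add: take_Suc_conv_app_nth)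
    then have inT: "take k y @ [y ! k] \<in> T" using T by (metis take_is_prefix tree_prefix)
    then have "(if take k y \<in> splits T then b k else take k y @ [True] \<in> T) = y ! k"
      using b[of k] k step.hyps by (cases "y ! k") (auto simp: splits_def)
    then show ?case using k by (simp only: walk.simps eq take_Suc_conv_app_nth)
  qed
  from this[of "length y"] show ?thesis using T(3) prefix_length_le by fastforce
qed

text \<open>A splitting node of \<open>T\<close> outside the set \<open>B\<close> that holds the
  splitting nodes of \<open>S\<close> has a child in \<open>T\<close> but not in \<open>S\<close>.
  Steering the walk to that child leaves \<open>S\<close>, so the parameters \<open>b\<close>
  leading into \<open>body S\<close> form a nowhere dense set.\<close>

lemma thick_not_covered:
  assumes H: "continuum_hypothesis \<or> small_category_unions_not_UNIV"
    and T: "thick \<B> T" "\<B> \<noteq> {}"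
    and small: "I \<prec> (UNIV :: nat set set)" and thin: "\<And>S. S \<in> I \<Longrightarrow> thin \<B> S"
  shows "\<exists>x\<in>body T. \<forall>S\<in>I. x \<notin> body S"
proof -
  have treeT: "tree T" using T by (simp add: thick_def)
  have "\<exists>b. \<forall>S\<in>I. b \<notin> {b. branch_along T b \<in> body S}"
  proof (rule cantor_not_small_union[OF H small])
    fix S and \<sigma> :: "bool list" assume "S \<in> I"
    then obtain B where B: "B \<in> \<B>" "splits S \<subseteq> B" using thin by (auto simp: thin_def)
    define b0 where "b0 i = (i < length \<sigma> \<and> \<sigma> ! i)" for i
    let ?w = "walk T b0 (length \<sigma>)"
    obtain u where u: "u \<in> splits T" "prefix ?w u" "u \<notin> B"
      using T walk_in_tree[OF T] B(1) unfolding thick_def by blast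
    then obtain c where c: "u @ [c] \<in> T" "u @ [c] \<notin> S"
      using B(2) unfolding splits_def by blast
    let ?y = "u @ [c]"
    \<comment> \<open>The first bits must be those of \<open>\<sigma>\<close>, which can differ from
      the entries of \<open>?y\<close> at levels where the walk is forced; only the later bits are
      copied from \<open>?y\<close>.\<close>
    let ?v = "\<sigma> @ drop (length \<sigma>) ?y"
    have len: "length \<sigma> \<le> length u" using u(2) prefix_length_le by fastforce
    then have lv: "length ?v = length ?y" by simp
    have "restr b (length ?v) \<noteq> ?v" if "branch_along T b \<in> body S" for b
    proof
      assume r: "restr b (length ?v) = ?v"
      have bv: "b i = ?v ! i" if "i < length ?v" for i
        using restr_nth[OF that, of b] unfolding r ..
      have "walk T b (length \<sigma>) = ?w"
        using bv lv len by (intro walk_cong) (simp add: b0_def nth_append)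
      then have "walk T b (length ?y) = ?y"
        using u(2) c(1) bv lv len
        by (intro walk_follow[OF treeT, where n = "length \<sigma>"]) (auto simp: nth_append)
      then have "restr (branch_along T b) (length ?y) = ?y" by (simp only: restr_path)
      then show False using that c(2) unfolding body_def by (metis mem_Collect_eq)
    qed
    then show "\<exists>v. prefix \<sigma> v \<and> (\<forall>b\<in>{b. branch_along T b \<in> body S}. restr b (length v) \<noteq> v)"
      by (intro exI[of _ ?v]) auto
  qed
  then obtain b where "\<And>S. S \<in> I \<Longrightarrow> branch_along T b \<notin> body S" by auto
  moreover have "branch_along T b \<in> body T"
    using walk_in_tree[OF T] by (simp add: body_def restr_path)
  ultimately show ?thesis by blast
qed

section \<open>Counting the trees and choosing the selector\<close>

lemma nat_sets_eqpoll_list_sets: "(UNIV :: nat set set) \<approx> (UNIV :: bool list set set)"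
proof -
  obtain f :: "bool list \<Rightarrow> nat" where "bij f"
    using countableE_infinite[of "UNIV :: bool list set"]
    by (metis countableI_type infinite_UNIV_listI)
  then have "bij ((`) (inv f))" by (simp add: bij_imp_bij_inv bij_image_Collect_eq bij_betw_Pow[of _
      UNIV UNIV, simplified])
  then show ?thesis by (auto simp: eqpoll_def)
qed

lemma card_of_underS_lesspoll: "underS (card_of (UNIV :: 'a set)) a \<prec> (UNIV :: 'a set)"
proof -
  have "(card_of (underS (card_of (UNIV :: 'a set)) a), card_of (UNIV :: 'a set)) \<in> ordLess"
    using card_of_underS[OF card_of_Card_order, of a UNIV] by (simp add: Field_card_of)
  then have "\<not> (\<exists>f. inj_on f (UNIV :: 'a set) \<and> f ` UNIV \<subseteq> underS (card_of (UNIV :: 'a set)) a)"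
    using card_of_ordLess by blast
  then have "\<not> (UNIV :: 'a set) \<lesssim> underS (card_of (UNIV :: 'a set)) a"
    by (simp add: lepoll_def)
  then show ?thesis
    unfolding lesspoll_def by (meson eqpoll_imp_lepoll eqpoll_sym subset_UNIV subset_imp_lepoll)
qed

text \<open>Along a well-order of the trees whose proper initial segments are smaller than the continuum, the
  branch chosen in a thick tree avoids only the preceding thin trees, so no recursion is needed.\<close>

lemma exists_selector:
  assumes H: "continuum_hypothesis \<or> small_category_unions_not_UNIV" and "\<B> \<noteq> {}"
  obtains Q where "\<forall>T. thick \<B> T \<longrightarrow> Q \<inter> body T \<noteq> {}"
    and "\<forall>T. thin \<B> T \<longrightarrow> Q \<inter> body T \<prec> (UNIV :: nat set set)"
proof -
  let ?r = "card_of (UNIV :: bool list set set)"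
  have small: "underS ?r T \<prec> (UNIV :: nat set set)" for T
    using card_of_underS_lesspoll nat_sets_eqpoll_list_sets eqpoll_sym lesspoll_eq_trans by meson
  have "\<exists>x. thick \<B> T \<longrightarrow> x \<in> body T \<and> (\<forall>S\<in>underS ?r T. thin \<B> S \<longrightarrow> x \<notin> body S)" for T
  proof (cases "thick \<B> T")
    case True
    have "{S \<in> underS ?r T. thin \<B> S} \<prec> (UNIV :: nat set set)"
      using small[of T] by (rule lesspoll_trans1[OF subset_imp_lepoll, rotated]) auto
    from thick_not_covered[OF H True \<open>\<B> \<noteq> {}\<close> this] show ?thesis by auto
  qed auto
  then obtain x where x: "\<And>T. thick \<B> T \<Longrightarrow> x T \<in> body T"
    "\<And>T S. thick \<B> T \<Longrightarrow> S \<in> underS ?r T \<Longrightarrow> thin \<B> S \<Longrightarrow> x T \<notin> body S"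
    by metis
  let ?Q = "x ` Collect (thick \<B>)"
  show ?thesis
  proof (rule that[of ?Q])
    show "\<forall>T. thick \<B> T \<longrightarrow> ?Q \<inter> body T \<noteq> {}"
      using x(1) by blast
    show "\<forall>T. thin \<B> T \<longrightarrow> ?Q \<inter> body T \<prec> (UNIV :: nat set set)"
    proof (intro allI impI)
      fix T assume "thin \<B> T"
      have "?Q \<inter> body T \<subseteq> x ` underS ?r T"
      proof clarify
        fix S assume S: "thick \<B> S" "x S \<in> body T"
        have "S \<noteq> T" using S(1) \<open>thin \<B> T\<close> thick_not_thin by blast
        \<comment> \<open>A tree after \<open>T\<close> contributes nothing: its branch was chosen
          off all earlier thin trees, \<open>T\<close> among them.\<close>
        moreover have "T \<notin> underS ?r S" using S \<open>thin \<B> T\<close> x(2) by blast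
        moreover have "Total ?r" using card_of_Well_order well_order_on_def linear_order_on_def by blast
        ultimately have "S \<in> underS ?r T"
          by (auto simp: underS_def total_on_def Field_card_of)
        then show "x S \<in> x ` underS ?r T" by blast
      qed
      then show "?Q \<inter> body T \<prec> (UNIV :: nat set set)"
        using small[of T] by (meson lesspoll_trans1 subset_image_lepoll)
    qed
  qed
qed

section \<open>Splitting trees with prescribed splitting nodes\<close>

lemma prefix_snoc_nth:
  "prefix (u @ [c]) v \<longleftrightarrow> prefix u v \<and> length u < length v \<and> v ! length u = c"
  by (auto simp: prefix_nth nth_append less_Suc_eq)

text \<open>Alternately appends a bit and extends by \<open>g\<close>, whose second argument is the
  stage. The bits come newest first, as the recursion needs; \<open>h\<close> restores the natural
  order.\<close>

primrec embed :: "(bool list \<Rightarrow> nat \<Rightarrow> bool list) \<Rightarrow> bool list \<Rightarrow> bool list \<Rightarrow> bool list" where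
  "embed g t [] = g t 0"
| "embed g t (c # \<sigma>) = g (embed g t \<sigma> @ [c]) (Suc (length \<sigma>))"

locale splitting_scheme =
  fixes g :: "bool list \<Rightarrow> nat \<Rightarrow> bool list" and t :: "bool list"
  assumes g: "prefix t u \<Longrightarrow> prefix u (g u i)"
begin

definition h :: "bool list \<Rightarrow> bool list" where
  "h \<sigma> = embed g t (rev \<sigma>)"

lemma h_Nil: "h [] = g t 0"
  by (simp add: h_def)

lemma h_snoc: "h (\<sigma> @ [c]) = g (h \<sigma> @ [c]) (Suc (length \<sigma>))"
  by (simp add: h_def)

lemma t_prefix_h: "prefix t (h \<sigma>)"
proof (induction \<sigma> rule: rev_induct)
  case (snoc c \<sigma>)
  then show ?case using g[of "h \<sigma> @ [c]"] unfolding h_snoc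
    by (meson prefix_order.trans prefixI)
qed (simp add: h_Nil g)

lemma h_child: "prefix (h \<sigma> @ [c]) (h (\<sigma> @ [c]))"
  using t_prefix_h unfolding h_snoc by (intro g) (meson prefix_order.trans prefixI)

lemma h_mono: "prefix (h (\<sigma> @ [c])) (h (\<sigma> @ c # \<tau>))"
proof (induction \<tau> rule: rev_induct)
  case (snoc d \<tau>)
  have "prefix (h (\<sigma> @ c # \<tau>)) (h ((\<sigma> @ c # \<tau>) @ [d]))"
    using h_child by (meson prefix_order.trans prefixI)
  then show ?case using snoc by (auto intro: prefix_order.trans)
qed simp

lemma h_extend: "prefix (h \<sigma> @ [c]) (h (\<sigma> @ c # \<tau>))"
  using h_child h_mono prefix_order.trans by blast

lemma h_prefix_mono:
  assumes "prefix \<sigma> \<tau>"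
  shows "prefix (h \<sigma>) (h \<tau>)"
proof -
  obtain \<rho> where "\<tau> = \<sigma> @ \<rho>" using assms by (rule prefixE)
  then show ?thesis
    using h_extend[THEN append_prefixD] by (cases \<rho>) auto
qed

definition span :: "bool list set \<Rightarrow> bool list set" where
  "span P = {u. \<exists>\<sigma>\<in>P. prefix u (h \<sigma>)}"

lemma tree_span: "P \<noteq> {} \<Longrightarrow> tree (span P)"
  unfolding tree_def span_def by (auto intro: prefix_order.trans)

text \<open>Branching at \<open>u\<close> means that the images of some \<open>\<sigma>\<close>,
  \<open>\<tau>\<close> in \<open>P\<close> separate at \<open>u\<close>. They also separate at
  \<open>h \<rho>\<close>, where \<open>\<rho>\<close> is the longest common part of
  \<open>\<sigma>\<close> and \<open>\<tau>\<close>, and two sequences separate at one place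
  only.\<close>

lemma splits_span: 
  assumes "u \<in> splits (span P)"
  obtains \<rho> where "u = h \<rho>"
proof -
  obtain \<sigma> \<tau> where \<sigma>: "prefix (u @ [False]) (h \<sigma>)" "prefix (u @ [True]) (h \<tau>)"
    using assms by (auto simp: splits_def span_def)
  have not_prefix: "\<not> prefix \<alpha> \<beta>"
    if "prefix (u @ [c]) (h \<alpha>)" "prefix (u @ [\<not> c]) (h \<beta>)" for \<alpha> \<beta> c
  proof
    assume "prefix \<alpha> \<beta>"
    then have "prefix (u @ [c]) (h \<beta>)" using h_prefix_mono that(1) prefix_order.trans by blast
    then show False using that(2) by (simp add: prefix_snoc_nth)
  qed
  have "\<not> prefix \<sigma> \<tau>" "\<not> prefix \<tau> \<sigma>"
    using not_prefix[of False \<sigma> \<tau>] not_prefix[of True \<tau> \<sigma>] \<sigma> by auto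
  then obtain \<rho> a b \<sigma>' \<tau>' where \<rho>: "a \<noteq> b" "\<sigma> = \<rho> @ a # \<sigma>'" "\<tau> = \<rho> @ b # \<tau>'"
    using parallel_decomp[of \<sigma> \<tau>] by blast
  have 1: "prefix (h \<rho> @ [a]) (h \<sigma>)" "prefix (h \<rho> @ [b]) (h \<tau>)"
    unfolding \<rho> by (rule h_extend)+
  consider "length u < length (h \<rho>)" | "length u = length (h \<rho>)" | "length (h \<rho>) < length u"
    by linarith
  then have "u = h \<rho>"
  proof cases
    case 2
    then show ?thesis
      using 1(1) \<sigma>(1) by (metis append_prefixD prefix_length_prefix prefix_order.antisym order_refl)
  qed (use 1[unfolded prefix_snoc_nth] \<sigma>[unfolded prefix_snoc_nth] \<rho>(1) in \<open>auto simp: prefix_nth\<close>)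
  then show ?thesis by (rule that)
qed

text \<open>On even levels the members of \<open>coherent z\<close> follow \<open>z\<close>, which makes the trees spanned for
  different \<open>z\<close> disjoint; the free odd levels keep these trees splitting.\<close>

definition coherent :: "(nat \<Rightarrow> bool) \<Rightarrow> bool list set" where
  "coherent z = {\<sigma>. \<forall>k. 2 * k < length \<sigma> \<longrightarrow> \<sigma> ! (2 * k) = z k}"

lemma coherent_extend:
  assumes "\<sigma> \<in> coherent z" "length \<sigma> \<le> n"
  obtains \<tau> where "prefix \<sigma> \<tau>" "\<tau> \<in> coherent z" "length \<tau> = n"
proof
  show "prefix \<sigma> (\<sigma> @ map (\<lambda>i. z (i div 2)) [length \<sigma>..<n])" by simp
  show "\<sigma> @ map (\<lambda>i. z (i div 2)) [length \<sigma>..<n] \<in> coherent z"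
    using assms by (auto simp: coherent_def nth_append)
qed (use assms in simp)

lemma coherent_snoc:
  "\<sigma> \<in> coherent z \<Longrightarrow> odd (length \<sigma>) \<Longrightarrow> \<sigma> @ [c] \<in> coherent z"
  by (auto simp: coherent_def nth_append less_Suc_eq) (metis dvd_triv_left)+

text \<open>A coherent sequence of odd length may be continued by either bit, so its image splits.
  Having every large odd length available leaves the residue modulo 3 free for
  \<open>good_if_dense\<close>.\<close>

lemma span_coherent_dense:
  assumes u: "u \<in> span (coherent z)"
  obtains m where "\<And>n. odd n \<Longrightarrow> m \<le> n \<Longrightarrow> \<exists>\<sigma>. length \<sigma> = n \<and> h \<sigma> \<in> splits (span (coherent z)) \<and>
      prefix u (h \<sigma>)"
proof -
  obtain \<sigma> where \<sigma>: "\<sigma> \<in> coherent z" "prefix u (h \<sigma>)" using u by (auto simp: span_def)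
  show ?thesis
  proof (rule that[of "length \<sigma>"])
    fix n :: nat assume n: "odd n" "length \<sigma> \<le> n"
    obtain \<tau> where \<tau>: "prefix \<sigma> \<tau>" "\<tau> \<in> coherent z" "length \<tau> = n"
      using coherent_extend[OF \<sigma>(1) n(2)] by blast
    have "h \<tau> @ [c] \<in> span (coherent z)" for c
      using coherent_snoc[OF \<tau>(2)] n(1) \<tau>(3) h_child[of \<tau> c] by (auto simp: span_def)
    then have "h \<tau> \<in> splits (span (coherent z))" by (simp add: splits_def)
    moreover have "prefix u (h \<tau>)"
      using h_prefix_mono[OF \<tau>(1)] \<sigma>(2) prefix_order.trans by blast
    ultimately show "\<exists>\<tau>. length \<tau> = n \<and> h \<tau> \<in> splits (span (coherent z)) \<and> prefix u (h \<tau>)"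
      using \<tau>(3) by blast
  qed
qed

text \<open>A common branch follows the images of two sequences that differ at position
  \<open>2 * k\<close>. These separate at some \<open>\<rho>\<close> of length at most
  \<open>2 * k\<close>, and the branch would have to leave \<open>h \<rho>\<close> in both
  directions.\<close>

lemma body_span_disjoint:
  assumes x: "x \<in> body (span (coherent z))" "x \<in> body (span (coherent z'))"
  shows "z = z'"
proof (rule ccontr)
  assume "z \<noteq> z'"
  then obtain k where k: "z k \<noteq> z' k" by blast
  \<comment> \<open>Large enough for \<open>restr x N\<close> to reach beyond every possible
    separation point \<open>h \<rho>\<close>.\<close>
  define N where "N = Suc (Max ((\<lambda>\<rho>. length (h \<rho>)) ` {\<rho>. length \<rho> \<le> 2 * k}))"
  have fin: "finite {\<rho> :: bool list. length \<rho> \<le> 2 * k}"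
    using finite_lists_length_le[of "UNIV :: bool set"] by simp
  have N: "length (h \<rho>) < N" if "length \<rho> \<le> 2 * k" for \<rho>
    using that fin by (auto simp: N_def less_Suc_eq_le intro!: Max_ge)
  obtain \<sigma> \<tau> where \<sigma>: "\<sigma> \<in> coherent z" "prefix (restr x N) (h \<sigma>)"
      and \<tau>: "\<tau> \<in> coherent z'" "prefix (restr x N) (h \<tau>)"
    using x unfolding body_def span_def by blast
  have "2 * k < length \<sigma>" "2 * k < length \<tau>"
    using N[of \<sigma>] N[of \<tau>] \<sigma>(2) \<tau>(2) prefix_length_le[of "restr x N"] by force+
  moreover from this have "\<sigma> ! (2 * k) \<noteq> \<tau> ! (2 * k)"
    using \<sigma>(1) \<tau>(1) k by (auto simp: coherent_def)
  ultimately have "\<not> prefix \<sigma> \<tau>" "\<not> prefix \<tau> \<sigma>"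
    by (auto simp: prefix_nth)
  then obtain \<rho> a b \<sigma>' \<tau>' where \<rho>: "a \<noteq> b" "\<sigma> = \<rho> @ a # \<sigma>'" "\<tau> = \<rho> @ b # \<tau>'"
    using parallel_decomp[of \<sigma> \<tau>] by blast
  have "length \<rho> \<le> 2 * k"
  proof (rule ccontr)
    assume "\<not> length \<rho> \<le> 2 * k"
    then have "\<sigma> ! (2 * k) = \<tau> ! (2 * k)" by (simp add: \<rho> nth_append)
    then show False using \<open>\<sigma> ! (2 * k) \<noteq> \<tau> ! (2 * k)\<close> by simp
  qed
  then have "length (h \<rho>) < N" by (rule N)
  moreover have "prefix (h \<rho> @ [a]) (h \<sigma>)" "prefix (h \<rho> @ [b]) (h \<tau>)"
    unfolding \<rho> by (rule h_extend)+
  ultimately have "x (length (h \<rho>)) = a" "x (length (h \<rho>)) = b"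
    using \<sigma>(2) \<tau>(2) by (auto simp: prefix_nth nth_append split: if_splits)
  then show False using \<rho>(1) by simp
qed

end

text \<open>The span of all sequences is thin, so \<open>Q\<close> has fewer than continuum many
  points in it. The spans for the continuum many \<open>z\<close> have pairwise disjoint bodies
  inside it, so one of them misses \<open>Q\<close>; that one witnesses \<open>good\<close>.\<close>

lemma good_if_dense:
  assumes Q: "\<forall>T. thin \<B> T \<longrightarrow> Q \<inter> body T \<prec> (UNIV :: nat set set)"
    and B: "B \<in> \<B>" "\<And>u. u \<in> A0 \<union> A1 \<union> A2 \<Longrightarrow> prefix t u \<Longrightarrow> u \<in> B"
    and dense: "dense_below t A0" "dense_below t A1" "dense_below t A2"
  shows "good Q t A0 A1 A2"
proof -
  \<comment> \<open>The stage modulo 3 decides which set is entered, so all three recur along every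
    branch.\<close>
  define A where "A i = (if i mod 3 = 0 then A0 else if i mod 3 = 1 then A1 else A2)" for i :: nat
  have "\<exists>v. prefix t u \<longrightarrow> v \<in> A i \<and> prefix u v" for u i
    using dense unfolding dense_below_def A_def by (cases "prefix t u") (simp_all, blast)
  then obtain g where g_in: "\<And>u i. prefix t u \<Longrightarrow> g u i \<in> A i \<and> prefix u (g u i)" by metis
  interpret splitting_scheme g t by unfold_locales (use g_in in blast)
  have hA: "h \<sigma> \<in> A (length \<sigma>)" for \<sigma>
    using t_prefix_h g_in by (cases \<sigma> rule: rev_cases) (auto simp: h_Nil h_snoc intro: prefix_order.trans)
  have sub: "u \<in> A0 \<union> A1 \<union> A2 \<and> prefix t u" if "u \<in> splits (span P)" for u P
  proof -
    obtain \<rho> where "u = h \<rho>" using splits_span \<open>u \<in> splits (span P)\<close> by blast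
    then show ?thesis using hA[of \<rho>] t_prefix_h[of \<rho>] by (auto simp: A_def split: if_splits)
  qed
  have "splits (span UNIV) \<subseteq> B" using sub B(2) by blast
  then have "thin \<B> (span UNIV)" using B(1) tree_span by (auto simp: thin_def)
  then have small: "Q \<inter> body (span UNIV) \<prec> (UNIV :: nat set set)" using Q by blast
  have "\<exists>z. Q \<inter> body (span (coherent z)) = {}"
  proof (rule ccontr)
    assume "\<not> ?thesis"
    then have "\<forall>z. \<exists>y. y \<in> Q \<inter> body (span (coherent z))" by blast
    then obtain y where y: "\<And>z. y z \<in> Q \<inter> body (span (coherent z))" by metis
    have "inj (\<lambda>X. y (\<lambda>n. n \<in> X))"
    proof (rule injI)
      fix X Y :: "nat set" assume "y (\<lambda>n. n \<in> X) = y (\<lambda>n. n \<in> Y)"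
      then have "(\<lambda>n. n \<in> X) = (\<lambda>n. n \<in> Y)"
        using y body_span_disjoint by (metis IntD2)
      then show "X = Y" by (auto simp: fun_eq_iff)
    qed
    moreover have "range (\<lambda>X. y (\<lambda>n. n \<in> X)) \<subseteq> Q \<inter> body (span UNIV)"
      using y by (fastforce simp: body_def span_def)
    ultimately have "(UNIV :: nat set set) \<lesssim> Q \<inter> body (span UNIV)"
      unfolding lepoll_def by blast
    then show False using small by (meson lesspoll_not_refl lesspoll_trans1)
  qed
  then obtain z where z: "Q \<inter> body (span (coherent z)) = {}" by blast
  have dens: "\<exists>v\<in>splits (span (coherent z)) \<inter> A i. prefix u v" if u: "u \<in> span (coherent z)" for u i
  proof -
    obtain m where m: "\<And>n. odd n \<Longrightarrow> m \<le> n \<Longrightarrow>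
        \<exists>\<sigma>. length \<sigma> = n \<and> h \<sigma> \<in> splits (span (coherent z)) \<and> prefix u (h \<sigma>)"
      using span_coherent_dense[OF u] by blast
    \<comment> \<open>Odd, at least \<open>m\<close>, and congruent to \<open>i\<close> modulo 3;
      the summand \<open>6 * m\<close> affects neither parity nor residue.\<close>
    define n where "n = 6 * m + (if odd i then i else i + 3)"
    have "odd n" "m \<le> n" by (auto simp: n_def)
    then obtain \<sigma> where "length \<sigma> = n" "h \<sigma> \<in> splits (span (coherent z))" "prefix u (h \<sigma>)"
      using m by blast
    moreover have "n mod 3 = i mod 3" unfolding n_def by presburger
    ultimately show ?thesis using hA[of \<sigma>] by (auto simp: A_def)
  qed
  have "[] \<in> coherent z" by (simp add: coherent_def)
  then have "tree (span (coherent z))" by (intro tree_span) blast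
  moreover have "\<forall>u\<in>splits (span (coherent z)). prefix t u \<and> u \<in> A0 \<union> A1 \<union> A2"
    using sub by blast
  moreover have "A 0 = A0" "A 1 = A1" "A 2 = A2" by (simp_all add: A_def)
  ultimately show ?thesis
    unfolding good_def using z dens[where i = 0] dens[where i = 1] dens[where i = 2] by metis
qed

text \<open>A tree missing \<open>Q\<close> is not thick, so in some cone all its splitting nodes
  lie in one member of the family, and density provides splitting nodes from each of the three sets
  in that cone.\<close>

lemma good_decode:
  assumes Q: "\<forall>T. thick \<B> T \<longrightarrow> Q \<inter> body T \<noteq> {}" and "good Q t A0 A1 A2"
  obtains B u0 u1 u2 where "B \<in> \<B>" "u0 \<in> A0 \<inter> B" "u1 \<in> A1 \<inter> B" "u2 \<in> A2 \<inter> B"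
    "prefix t u0" "prefix t u1" "prefix t u2"
proof -
  obtain T where T: "tree T" "\<And>u. u \<in> splits T \<Longrightarrow> prefix t u"
    "\<And>u. u \<in> T \<Longrightarrow> \<exists>v\<in>splits T \<inter> A0. prefix u v"
    "\<And>u. u \<in> T \<Longrightarrow> \<exists>v\<in>splits T \<inter> A1. prefix u v"
    "\<And>u. u \<in> T \<Longrightarrow> \<exists>v\<in>splits T \<inter> A2. prefix u v" "Q \<inter> body T = {}"
    using assms(2) unfolding good_def by blast
  then have "\<not> thick \<B> T" using Q by blast
  then obtain w B where w: "w \<in> T" "B \<in> \<B>" "\<And>u. u \<in> splits T \<Longrightarrow> prefix w u \<Longrightarrow> u \<in> B"
    using T(1) unfolding thick_def by blast
  show ?thesis
    using T(3-5)[OF w(1)] w T(2) that[of B] by blast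
qed

section \<open>Splitting a coloured set densely\<close>

text \<open>Along one strictly increasing sequence the entries \<open>2 * k\<close> and
  \<open>2 * k + 1\<close> are taken from \<open>I k\<close>; the entries with even number form
  \<open>J\<close>.\<close>

lemma splitting_set:
  fixes I :: "nat \<Rightarrow> nat set"
  assumes "\<And>k. infinite (I k)"
  obtains J where "\<And>k. I k \<inter> J \<noteq> {}" "\<And>k. I k - J \<noteq> {}"
proof -
  have "\<exists>a. \<forall>n. a n \<in> I (n div 2) \<and> a n < a (Suc n)"
  proof (intro dependent_nat_choice)
    show "\<exists>x. x \<in> I (0 div 2)" using infinite_imp_nonempty[OF assms[of 0]] by auto
    show "\<exists>y. y \<in> I (Suc n div 2) \<and> x < y" for x n
      using assms[of "Suc n div 2"] unfolding infinite_nat_iff_unbounded by blast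
  qed
  then obtain a where a: "\<And>n. a n \<in> I (n div 2)" "\<And>n. a n < a (Suc n)" by blast
  have "inj a" using strict_mono_imp_inj_on[of a] a(2) by (simp add: strict_mono_Suc_iff)
  show ?thesis
  proof (rule that[of "a ` {n. even n}"])
    fix k
    show "I k \<inter> a ` {n. even n} \<noteq> {}" using a(1)[of "2 * k"] by auto
    have "a (2 * k + 1) \<notin> a ` {n. even n}"
      using \<open>inj a\<close> by (simp add: inj_image_mem_iff)
    then show "I k - a ` {n. even n} \<noteq> {}" using a(1)[of "2 * k + 1"] by auto
  qed
qed

text \<open>If one colour is dense in some cone, it is split off from the rest. Otherwise each
  colour, hence each finite set of colours, can be avoided by going up, so infinitely many colours
  occur in every cone, and \<open>splitting_set\<close> handles the countably many cones at
  once.\<close>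

lemma dense_colour_split:
  fixes c :: "bool list \<Rightarrow> nat"
  assumes two: "\<And>t. prefix s t \<Longrightarrow> \<exists>u\<in>X. \<exists>v\<in>X. prefix t u \<and> prefix t v \<and> c u \<noteq> c v"
  shows "\<exists>t J. prefix s t \<and> dense_below t {u \<in> X. c u \<in> J} \<and> dense_below t {u \<in> X. c u \<notin> J}"
proof (cases "\<exists>i t. prefix s t \<and> dense_below t {u \<in> X. c u = i}")
  case True
  then obtain i t where t: "prefix s t" "dense_below t {u \<in> X. c u = i}" by blast
  have "dense_below t {u \<in> X. c u \<noteq> i}"
    unfolding dense_below_def
  proof (intro allI impI)
    fix u assume "prefix t u"
    then obtain v w where "v \<in> X" "w \<in> X" "prefix u v" "prefix u w" "c v \<noteq> c w"
      using two[OF prefix_order.trans[OF t(1)]] by blast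
    then show "\<exists>v\<in>{u \<in> X. c u \<noteq> i}. prefix u v" by (cases "c v = i") auto
  qed
  then have "dense_below t {u \<in> X. c u \<in> {i}} \<and> dense_below t {u \<in> X. c u \<notin> {i}}"
    using t(2) by simp
  then show ?thesis using t(1) by blast
next
  case False
  define I where "I w = c ` {v \<in> X. prefix w v}" for w
  have avoid: "\<exists>u. prefix w u \<and> I u \<inter> F = {}" if "prefix s w" "finite F" for w F
    using that(2,1)
  proof (induction F arbitrary: w)
    case (insert i F)
    then obtain u where u: "prefix w u" "I u \<inter> F = {}" by blast
    then have "\<not> dense_below u {v \<in> X. c v = i}"
      using False insert.prems prefix_order.trans by blast
    then obtain u' where "prefix u u'" "\<forall>v\<in>X. prefix u' v \<longrightarrow> c v \<noteq> i"
      unfolding dense_below_def by blast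
    then have "prefix w u' \<and> I u' \<inter> insert i F = {}"
      using u unfolding I_def by (auto intro: prefix_order.trans)
    then show ?case by blast
  qed auto
  have inf: "infinite (I w)" if w: "prefix s w" for w
  proof
    assume "finite (I w)"
    then obtain u where u: "prefix w u" "I u \<inter> I w = {}" using avoid[OF w] by blast
    then obtain v where "v \<in> X" "prefix u v"
      using two[OF prefix_order.trans[OF w u(1)]] by blast
    then have "c v \<in> I u \<inter> I w" using u(1) unfolding I_def by (auto intro: prefix_order.trans)
    then show False using u(2) by blast
  qed
  \<comment> \<open>Nodes are enumerated by \<open>from_nat\<close>; those outside the cone of
    \<open>s\<close> receive \<open>UNIV\<close> as an infinite dummy.\<close>
  define J' where "J' k = (if prefix s (from_nat k) then I (from_nat k) else UNIV)" for k
  have "infinite (J' k)" for k using inf by (simp add: J'_def)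
  then obtain J where J: "\<And>k. J' k \<inter> J \<noteq> {}" "\<And>k. J' k - J \<noteq> {}"
    using splitting_set[of J'] by blast
  have "I w \<inter> J \<noteq> {}" "I w - J \<noteq> {}" if "prefix s w" for w
    using J[of "to_nat w"] that by (simp_all add: J'_def)
  then have "dense_below s {u \<in> X. c u \<in> J}" "dense_below s {u \<in> X. c u \<notin> J}"
    unfolding dense_below_def I_def by blast+
  then show ?thesis by blast
qed

section \<open>Codes for natural numbers\<close>

type_synonym par = "(nat \<Rightarrow> bool) set \<times> bool list set list"

text \<open>In a parameter, the first component is the selector \<open>Q\<close>; the list holds the sets of
  nodes of the kinds 0 to 3 (kind 3 being the marker) and a code of the number 0. Above a node
  \<open>s\<close>, a number is coded by the sets whose intersections with the kinds 0 to 2 are dense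
      and of that colour.
  No two colours of one kind are compatible, so monochromatic means that any two dense pieces are.\<close>

definition indec :: "(nat \<Rightarrow> bool) set \<Rightarrow> bool list \<Rightarrow> bool list set \<Rightarrow> bool" where
  "indec Q t X \<longleftrightarrow> (\<forall>Y. dense_below t (X \<inter> Y) \<longrightarrow> dense_below t (X - Y) \<longrightarrow>
     good Q t (X \<inter> Y) (X - Y) (X - Y))"

abbreviation part :: "par \<Rightarrow> nat \<Rightarrow> bool list set" where
  "part P i \<equiv> snd P ! i"

text \<open>The last two conditions bind the copies together: a face with the marker has a single
  number, so the pieces of kinds 1 and 2 carry the colour of the piece of kind 0.\<close>

definition element :: "par \<Rightarrow> bool list \<Rightarrow> bool list set \<Rightarrow> bool" where
  "element P s X \<longleftrightarrow> (\<forall>t. prefix s t \<longrightarrow>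
     indec (fst P) t (X \<inter> part P 0) \<and> indec (fst P) t (X \<inter> part P 1) \<and> indec (fst P) t (X \<inter> part P 2) \<and>
     good (fst P) t (X \<inter> part P 0) (X \<inter> part P 1) (part P 3) \<and>
     good (fst P) t (X \<inter> part P 0) (X \<inter> part P 2) (part P 3))"

definition paired :: "par \<Rightarrow> bool list \<Rightarrow> bool list set \<Rightarrow> bool list set \<Rightarrow> bool list set \<Rightarrow> bool" where
  "paired P s X Y Z \<longleftrightarrow> (\<forall>t. prefix s t \<longrightarrow> good (fst P) t (X \<inter> part P 0) (Y \<inter> part P 1) (Z \<inter> part P 2))"

text \<open>A set of numbers is coded by any \<open>W\<close>; the copy of kind 0 is enough to test
  the colour of \<open>X\<close> against it.\<close>

definition member_of :: "par \<Rightarrow> bool list \<Rightarrow> bool list set \<Rightarrow> bool list set \<Rightarrow> bool" where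
  "member_of P s X W \<longleftrightarrow> (\<forall>u. prefix s u \<longrightarrow> u \<in> X \<longrightarrow> u \<in> part P 0 \<longrightarrow> u \<in> W)"

definition pairing_axioms :: "par \<Rightarrow> bool" where
  "pairing_axioms P \<longleftrightarrow> element P [] (part P 4) \<and> (\<forall>s X Y. element P s X \<longrightarrow> element P s Y \<longrightarrow>
     (\<exists>t Z. prefix s t \<and> element P t Z \<and> paired P t X Y Z))"

text \<open>The successor keeps 0 from being a pair, so that 0 can serve as the numeral zero and as
  the empty list.\<close>

definition pair_code :: "nat \<Rightarrow> nat \<Rightarrow> nat" where
  "pair_code x y = Suc (prod_encode (x, y))"

text \<open>Here \<open>d s X n\<close> is to be read as: above \<open>s\<close>, the set \<open>X\<close> codes \<open>n\<close>.\<close>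

definition standard_structure :: "par \<Rightarrow> (bool list \<Rightarrow> bool list set \<Rightarrow> nat \<Rightarrow> bool) \<Rightarrow> bool" where
  "standard_structure P d \<longleftrightarrow>
     (\<forall>s X. element P s X \<longrightarrow> (\<exists>t n. prefix s t \<and> d t X n)) \<and>
     (\<forall>s t X n. d s X n \<longrightarrow> prefix s t \<longrightarrow> d t X n) \<and>
     (\<forall>s X Y Z x y z. d s X x \<longrightarrow> d s Y y \<longrightarrow> d s Z z \<longrightarrow> paired P s X Y Z \<longrightarrow> z = pair_code x y) \<and>
     (\<forall>n. \<exists>X. \<forall>s. element P s X \<and> d s X n \<and>
        (\<forall>x y A B. n = pair_code x y \<longrightarrow> d s A x \<longrightarrow> d s B y \<longrightarrow> paired P s A B X)) \<and>
     (\<forall>I. \<exists>W. \<forall>s X n. d s X n \<longrightarrow> (member_of P s X W \<longleftrightarrow> n \<in> I)) \<and>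
     element P [] (part P 4) \<and> d [] (part P 4) 0"

section \<open>The colouring of nodes by level and the standard structure it yields\<close>

definition kind :: "bool list \<Rightarrow> nat" where
  "kind u = snd (prod_decode (fst (prod_decode (length u))))"

definition idx :: "bool list \<Rightarrow> nat" where
  "idx u = fst (prod_decode (fst (prod_decode (length u))))"

text \<open>The first two families tie the copies of one number together next to the marker. The
  third is the graph of \<open>pair_code\<close>; having no marker, it cannot pass for a tie between
  unequal numbers.\<close>

definition faces :: "bool list set set" where
  "faces = range (\<lambda>n. {u. kind u = 3 \<or> idx u = n \<and> kind u \<in> {0, 1}}) \<union>
     range (\<lambda>n. {u. kind u = 3 \<or> idx u = n \<and> kind u \<in> {0, 2}}) \<union>
     range (\<lambda>(x, y). {u. kind u = 0 \<and> idx u = x \<or> kind u = 1 \<and> idx u = y \<or> kind u = 2 \<and>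
         idx u = pair_code x y})"

text \<open>A level encodes index, kind and a spare coordinate; \<open>length u\<close> in the spare
  place makes the level at least \<open>length u\<close>.\<close>

lemma colour_dense: "\<exists>v. prefix u v \<and> idx v = n \<and> kind v = k"
proof -
  let ?m = "prod_encode (prod_encode (n, k), length u)"
  let ?v = "u @ replicate (?m - length u) False"
  have "length u \<le> ?m" by (rule le_prod_encode_2)
  then have "length ?v = ?m" by simp
  then have "idx ?v = n" "kind ?v = k" unfolding idx_def kind_def by simp_all
  moreover have "prefix u ?v" by simp
  ultimately show ?thesis by (intro exI[of _ ?v] conjI)
qed

lemma face_same_colour:
  assumes "B \<in> faces" "u \<in> B" "v \<in> B" "kind u = kind v" "kind u < 3"
  shows "idx u = idx v"
  using assms by (auto simp: faces_def)

text \<open>Each face with the marker lacks kind 1 or kind 2, so only pairing faces remain.\<close>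

lemma face_0_1_2:
  assumes "B \<in> faces" "u0 \<in> B" "u1 \<in> B" "u2 \<in> B" "kind u0 = 0" "kind u1 = 1" "kind u2 = 2"
  shows "idx u2 = pair_code (idx u0) (idx u1)"
  using assms by (auto simp: faces_def)

lemma face_with_marker:
  assumes "B \<in> faces" "u \<in> B" "v \<in> B" "w \<in> B" "kind u < 3" "kind v < 3" "kind w = 3"
  shows "idx u = idx v"
  using assms by (auto simp: faces_def)

text \<open>Soundness comes from \<open>good_decode\<close> (compatible sets meet a common face),
  existence from \<open>good_if_dense\<close> (sets dense inside one face are compatible).\<close>

lemma exists_std:
  assumes H: "continuum_hypothesis \<or> small_category_unions_not_UNIV"
  obtains P d where "standard_structure P d" "length (snd P) = 5"
proof -
  have "faces \<noteq> {}" by (auto simp: faces_def)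
  with H obtain Q where thick: "\<forall>T. thick faces T \<longrightarrow> Q \<inter> body T \<noteq> {}"
    and thin: "\<forall>T. thin faces T \<longrightarrow> Q \<inter> body T \<prec> (UNIV :: nat set set)"
    using exists_selector by blast
  note decode = good_decode[OF thick]
  \<comment> \<open>\<open>N n\<close> will be a code of \<open>n\<close> above every node
    simultaneously.\<close>
  define N where "N n = {u. idx u = n \<and> kind u < 3}" for n
  define V where "V k = {u. kind u = k}" for k
  define P :: par where "P = (Q, map V [0..<4] @ [N 0])"
  have P [simp]: "fst P = Q" "part P 0 = V 0" "part P (Suc 0) = V 1" "part P 2 = V 2" "part P 3 = V 3"
      "part P 4 = N 0"
    by (simp_all add: P_def numeral_eq_Suc)
  define d where "d s X n \<longleftrightarrow> element P s X \<and> (\<forall>u. prefix s u \<longrightarrow> u \<in> X \<longrightarrow> kind u < 3 \<longrightarrow> idx u = n)" for s X n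
  have element_dense: "dense_below s (X \<inter> V k)" if "element P s X" "k < 3" for s X k
    unfolding dense_below_def
  proof (intro allI impI)
    fix t assume "prefix s t"
    then have g: "good Q t (X \<inter> V 0) (X \<inter> V 1) (V 3)" "good Q t (X \<inter> V 0) (X \<inter> V 2) (V 3)"
      using that(1) by (simp_all add: element_def)
    have "k = 0 \<or> k = 1 \<or> k = 2" using that(2) by linarith
    moreover obtain u0 u1 where "u0 \<in> X \<inter> V 0" "prefix t u0" "u1 \<in> X \<inter> V 1" "prefix t u1"
      using g(1) by (rule decode) blast
    moreover obtain u2 where "u2 \<in> X \<inter> V 2" "prefix t u2"
      using g(2) by (rule decode) blast
    ultimately show "\<exists>v\<in>X \<inter> V k. prefix t v" by blast
  qed
  \<comment> \<open>An indecomposable set of one kind is monochromatic in some cone: otherwise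
    \<open>dense_colour_split\<close> gives two dense parts without common colours, and their
    compatibility puts two colours of one kind into one face.\<close>
  have local1: "\<exists>t n. prefix s t \<and> (\<forall>u\<in>X. prefix t u \<longrightarrow> idx u = n)"
    if X: "X \<subseteq> V k" "k < 3" and ind: "\<And>t. prefix s t \<Longrightarrow> indec Q t X" for s X k
  proof (rule ccontr)
    assume "\<not> ?thesis"
    then have two: "\<exists>u\<in>X. \<exists>v\<in>X. prefix t u \<and> prefix t v \<and> idx u \<noteq> idx v" if "prefix s t" for t
      using that by metis
    then obtain t J where t: "prefix s t" and J: "dense_below t {u \<in> X. idx u \<in> J}" "dense_below t {u
        \<in> X. idx u \<notin> J}"
      using dense_colour_split[of s X idx, OF two] by blast
    let ?Y = "{u. idx u \<in> J}"
    have "X \<inter> ?Y = {u \<in> X. idx u \<in> J}" "X - ?Y = {u \<in> X. idx u \<notin> J}" by auto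
    then have "good Q t (X \<inter> ?Y) (X - ?Y) (X - ?Y)"
      using ind[OF t] J unfolding indec_def by metis
    then obtain B u v where "B \<in> faces" "u \<in> X \<inter> ?Y \<inter> B" "v \<in> (X - ?Y) \<inter> B"
      by (rule decode) blast
    moreover from this have "kind u = k" "kind v = k" using X by (auto simp: V_def)
    ultimately show False using face_same_colour[of B u v] X(2) by auto
  qed
  have S1: "\<exists>t n. prefix s t \<and> d t X n" if X: "element P s X" for s X
  proof -
    have ind: "indec Q t (X \<inter> V k)" if "prefix s t" "k < 3" for t k
    proof -
      have "k = 0 \<or> k = 1 \<or> k = 2" using that(2) by linarith
      then show ?thesis using X that(1) by (auto simp: element_def)
    qed
    \<comment> \<open>Three successive moves upwards make the kinds 0, 1, 2 monochromatic; the
      marker conditions then identify the three colours.\<close>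
    obtain t0 n0 where t0: "prefix s t0" "\<And>u. u \<in> X \<inter> V 0 \<Longrightarrow> prefix t0 u \<Longrightarrow> idx u = n0"
      using local1[of "X \<inter> V 0" 0 s] ind by auto
    obtain t1 n1 where t1: "prefix t0 t1" "\<And>u. u \<in> X \<inter> V 1 \<Longrightarrow> prefix t1 u \<Longrightarrow> idx u = n1"
      using local1[of "X \<inter> V 1" 1 t0] ind t0(1) by (auto intro: prefix_order.trans)
    obtain t n2 where t: "prefix t1 t" "\<And>u. u \<in> X \<inter> V 2 \<Longrightarrow> prefix t u \<Longrightarrow> idx u = n2"
      using local1[of "X \<inter> V 2" 2 t1] ind t0(1) t1(1) by (auto intro: prefix_order.trans)
    have st: "prefix t0 t" "prefix s t"
      using prefix_order.trans[OF t1(1) t(1)] prefix_order.trans[OF t0(1)] by blast+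
    have g: "good Q t (X \<inter> V 0) (X \<inter> V 1) (V 3)" "good Q t (X \<inter> V 0) (X \<inter> V 2) (V 3)"
      using X st(2) by (simp_all add: element_def)
    have up: "prefix t0 u \<and> prefix t1 u" if "prefix t u" for u
      using prefix_order.trans[OF st(1) that] prefix_order.trans[OF t(1) that] by blast
    have "n0 = n1"
      using g(1)
    proof (rule decode)
      fix B u v w assume *: "B \<in> faces" "u \<in> X \<inter> V 0 \<inter> B" "v \<in> X \<inter> V 1 \<inter> B" "w \<in> V 3 \<inter> B"
        "prefix t u" "prefix t v"
      then have "idx u = idx v" by (intro face_with_marker[of B u v w]) (auto simp: V_def)
      then show ?thesis using * t0(2) t1(2) up by auto
    qed
    moreover have "n0 = n2"
      using g(2)
    proof (rule decode)
      fix B u v w assume *: "B \<in> faces" "u \<in> X \<inter> V 0 \<inter> B" "v \<in> X \<inter> V 2 \<inter> B" "w \<in> V 3 \<inter> B"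
        "prefix t u" "prefix t v"
      then have "idx u = idx v" by (intro face_with_marker[of B u v w]) (auto simp: V_def)
      then show ?thesis using * t0(2) t(2) up by auto
    qed
    moreover have "kind u < 3 \<Longrightarrow> u \<in> V 0 \<or> u \<in> V 1 \<or> u \<in> V 2" for u
      unfolding V_def by auto
    moreover have "element P t X" using X st(2) by (auto simp: element_def intro: prefix_order.trans)
    ultimately have "d t X n0" unfolding d_def using t0(2) t1(2) t(2) up by blast
    then show ?thesis using st(2) by blast
  qed
  have S2: "d t X n" if "d s X n" "prefix s t" for s t X n
    using that unfolding d_def element_def by (meson prefix_order.trans)
  have S3: "z = pair_code x y" if "d s X x" "d s Y y" "d s Z z" "paired P s X Y Z" for s X Y Z x y z
  proof -
    have "good Q s (X \<inter> V 0) (Y \<inter> V 1) (Z \<inter> V 2)" using that(4) by (simp add: paired_def)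
    then show ?thesis
    proof (rule decode)
      fix B u v w assume *: "B \<in> faces" "u \<in> X \<inter> V 0 \<inter> B" "v \<in> Y \<inter> V 1 \<inter> B" "w \<in> Z \<inter> V 2 \<inter> B"
        "prefix s u" "prefix s v" "prefix s w"
      then have "idx w = pair_code (idx u) (idx v)" by (intro face_0_1_2[of B]) (auto simp: V_def)
      moreover have "idx u = x" "idx v = y" "idx w = z"
        using * that(1-3) by (auto simp: d_def V_def)
      ultimately show ?thesis by simp
    qed
  qed
  have denseN: "dense_below t (N n \<inter> V k)" if "k < 3" for t n k
    using colour_dense[of _ n k] that by (auto simp: dense_below_def N_def V_def)
  have densem: "dense_below t (V 3)" for t
    using colour_dense[of _ 0 3] by (auto simp: dense_below_def V_def)
  have E1: "{u. kind u = 3 \<or> idx u = n \<and> kind u \<in> {0, 1}} \<in> faces" for n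
    unfolding faces_def by blast
  have E2: "{u. kind u = 3 \<or> idx u = n \<and> kind u \<in> {0, 2}} \<in> faces" for n
    unfolding faces_def by blast
  have E3: "{u. kind u = 0 \<and> idx u = x \<or> kind u = 1 \<and> idx u = y \<or> kind u = 2 \<and>
      idx u = pair_code x y} \<in> faces" for x y
    unfolding faces_def by (rule UnI2, rule range_eqI[of _ _ "(x, y)"]) simp
  have elN: "element P s (N n)" for s n
  proof -
    have "indec Q t (N n \<inter> V k)" if k: "k = 0 \<or> k = 1 \<or> k = 2" for t k
      unfolding indec_def
    proof (intro allI impI)
      fix Y assume Y: "dense_below t (N n \<inter> V k \<inter> Y)" "dense_below t (N n \<inter> V k - Y)"
      \<comment> \<open>The first family has a face for kinds 0 and 1, the second one for kind
        2.\<close>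
      obtain B where "B \<in> faces" "N n \<inter> V k \<subseteq> B"
        using k
      proof (elim disjE)
        assume "k = 2"
        then show thesis by (intro that[OF E2[of n]]) (auto simp: N_def V_def)
      qed (use that[OF E1[of n]] in \<open>auto simp: N_def V_def\<close>)
      then show "good Q t (N n \<inter> V k \<inter> Y) (N n \<inter> V k - Y) (N n \<inter> V k - Y)"
        using Y by (intro good_if_dense[OF thin, of B]) auto
    qed
    moreover have "good Q t (N n \<inter> V 0) (N n \<inter> V 1) (V 3)" for t
      by (rule good_if_dense[OF thin E1[of n]]) (use denseN densem in \<open>auto simp: N_def V_def\<close>)
    moreover have "good Q t (N n \<inter> V 0) (N n \<inter> V 2) (V 3)" for t
      by (rule good_if_dense[OF thin E2[of n]]) (use denseN densem in \<open>auto simp: N_def V_def\<close>)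
    ultimately show ?thesis by (simp add: element_def)
  qed
  have dN: "d s (N n) n" for s n
    using elN by (simp add: d_def N_def)
  have S4: "paired P s A B (N (pair_code x y))" if "d s A x" "d s B y" for s A B x y
    unfolding paired_def
  proof (intro allI impI)
    fix t assume t: "prefix s t"
    then have "d t A x" "d t B y" using S2 that by blast+
    then have "good Q t (A \<inter> V 0) (B \<inter> V 1) (N (pair_code x y) \<inter> V 2)"
      by (intro good_if_dense[OF thin E3[of x y]] element_dense denseN) (auto simp: d_def N_def V_def)
    then show "good (fst P) t (A \<inter> part P 0) (B \<inter> part P 1) (N (pair_code x y) \<inter> part P 2)" by simp
  qed
  \<comment> \<open>The nodes with index in \<open>I\<close> code \<open>I\<close>. Since
    \<open>X\<close> has a node of kind 0 in the cone, the inclusion tested is not vacuous.\<close>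
  have S5: "member_of P s X {u. idx u \<in> I} \<longleftrightarrow> n \<in> I" if dX: "d s X n" for s X n I
  proof -
    have "dense_below s (X \<inter> V 0)" using dX element_dense by (simp add: d_def)
    then obtain v where "v \<in> X \<inter> V 0" "prefix s v"
      unfolding dense_below_def by blast
    then show ?thesis using dX by (auto simp: d_def member_of_def V_def)
  qed
  have "standard_structure P d"
    unfolding standard_structure_def
  proof (intro conjI)
    show "\<forall>n. \<exists>X. \<forall>s. element P s X \<and> d s X n \<and>
        (\<forall>x y A B. n = pair_code x y \<longrightarrow> d s A x \<longrightarrow> d s B y \<longrightarrow> paired P s A B X)"
      using elN dN S4 by blast
    show "\<forall>I. \<exists>W. \<forall>s X n. d s X n \<longrightarrow> member_of P s X W = (n \<in> I)"
      using S5 by blast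
    show "\<forall>s X. element P s X \<longrightarrow> (\<exists>t n. prefix s t \<and> d t X n)"
      using S1 by blast
    show "\<forall>s t X n. d s X n \<longrightarrow> prefix s t \<longrightarrow> d t X n"
      using S2 by blast
    show "\<forall>s X Y Z x y z. d s X x \<longrightarrow> d s Y y \<longrightarrow> d s Z z \<longrightarrow> paired P s X Y Z \<longrightarrow> z = pair_code x y"
      by (intro allI impI) (rule S3)
    show "element P [] (part P 4)" "d [] (part P 4) 0"
      using elN dN by simp_all
  qed
  then show ?thesis by (rule that) (simp add: P_def)
qed

section \<open>Relations computing functions\<close>

lemma pair_code_eq [simp]: "pair_code a b = pair_code c d \<longleftrightarrow> a = c \<and>
    b = d" "pair_code a b \<noteq> 0" "0 \<noteq> pair_code a b"
  by (auto simp: pair_code_def)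

text \<open>The successor is pairing with 0, so the totality of pairing alone provides all numerals
  and all lists of them.\<close>

primrec num_code :: "nat \<Rightarrow> nat" where
  "num_code 0 = 0"
| "num_code (Suc n) = pair_code (num_code n) 0"

primrec list_code :: "nat list \<Rightarrow> nat" where
  "list_code [] = 0"
| "list_code (x # xs) = pair_code (num_code x) (list_code xs)"

lemma num_eq [simp]: "num_code m = num_code n \<longleftrightarrow> m = n"
proof
  show "num_code m = num_code n \<Longrightarrow> m = n"
  proof (induction m arbitrary: n)
    case 0
    then show ?case by (cases n) auto
  next
    case (Suc m)
    then show ?case by (cases n) auto
  qed
qed simp

type_synonym rel = "par \<Rightarrow> bool list \<Rightarrow> bool list set \<Rightarrow> bool list set \<Rightarrow> bool"

text \<open>In an arbitrary structure a number can be assigned to a set only through a construction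
  from the zero code by pairing; uniqueness of that number is established for standard structures
  only (\<open>represents_std\<close>).\<close>

inductive represents :: "par \<Rightarrow> bool list \<Rightarrow> bool list set \<Rightarrow> nat \<Rightarrow> bool" for P s where
  zero: "represents P s (part P 4) 0"
| pair: "element P s A \<Longrightarrow> element P s B \<Longrightarrow> element P s X \<Longrightarrow> paired P s A B X \<Longrightarrow> represents P s A a \<Longrightarrow>
    represents P s B b
    \<Longrightarrow> represents P s X (pair_code a b)"

definition mono_rel :: "rel \<Rightarrow> bool" where
  "mono_rel R \<longleftrightarrow> (\<forall>P s t X Y. R P s X Y \<longrightarrow> prefix s t \<longrightarrow> R P t X Y)"

text \<open>The correct value has to be attained in every structure satisfying the axioms, but other values
  are excluded only in the standard structures.\<close>

definition computes :: "rel \<Rightarrow> nat \<Rightarrow> (nat list \<Rightarrow> nat) \<Rightarrow> bool" where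
  "computes R n F \<longleftrightarrow> mono_rel R \<and>
     (\<forall>P s X xs. pairing_axioms P \<longrightarrow> length xs = n \<longrightarrow> represents P s X (list_code xs) \<longrightarrow>
        (\<exists>t Y. prefix s t \<and> represents P t Y (F xs) \<and> R P t X Y)) \<and>
     (\<forall>P d s X Y xs y. standard_structure P d \<longrightarrow> length xs = n \<longrightarrow> d s X (list_code xs) \<longrightarrow> d s Y y \<longrightarrow>
         R P s X Y \<longrightarrow> y = F xs)"

lemma element_mono: "element P s X \<Longrightarrow> prefix s t \<Longrightarrow> element P t X"
  unfolding element_def by (meson prefix_order.trans)

lemma paired_mono: "paired P s X Y Z \<Longrightarrow> prefix s t \<Longrightarrow> paired P t X Y Z"
  unfolding paired_def by (meson prefix_order.trans)

lemma member_of_mono: "member_of P s X W \<Longrightarrow> prefix s t \<Longrightarrow> member_of P t X W"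
  unfolding member_of_def by (meson prefix_order.trans)

lemma represents_mono: "represents P s X a \<Longrightarrow> prefix s t \<Longrightarrow> represents P t X a"
  by (induction rule: represents.induct) (auto intro: represents.intros element_mono paired_mono)

lemma mono_relD: "mono_rel R \<Longrightarrow> R P s X Y \<Longrightarrow> prefix s t \<Longrightarrow> R P t X Y"
  unfolding mono_rel_def by blast

lemma ax_el_zero: "pairing_axioms P \<Longrightarrow> element P s (part P 4)"
  using element_mono[of P "[]"] by (simp add: pairing_axioms_def)

lemma represents_el:
  assumes "pairing_axioms P" "represents P s X a"
  shows "element P s X"
  using assms(2) by cases (use ax_el_zero[OF assms(1)] in auto)

lemma represents_zeroD: "represents P s X 0 \<Longrightarrow> X = part P 4"
  by (cases rule: represents.cases) auto

lemma represents_pairE: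
  assumes "represents P s X (pair_code a b)"
  obtains A B where "element P s A" "element P s B" "paired P s A B X" "represents P s A a"
      "represents P s B b"
  using assms by (cases rule: represents.cases) auto

lemma represents_pair_exists:
  assumes "pairing_axioms P" "represents P s A a" "represents P s B b"
  obtains t X where "prefix s t" "represents P t X (pair_code a b)" "paired P t A B X"
proof -
  obtain t X where "prefix s t" "element P t X" "paired P t A B X"
    using assms represents_el unfolding pairing_axioms_def by blast
  then show ?thesis
    using that[of t X] assms represents_mono represents_el by (metis represents.pair)
qed

lemma computes_rep:
  assumes "computes R n F" "pairing_axioms P" "length xs = n" "represents P s X (list_code xs)"
  obtains t Y where "prefix s t" "represents P t Y (F xs)" "R P t X Y"
  using assms unfolding computes_def by blast

lemma computes_std:
  assumes "computes R n F" "standard_structure P d" "length xs = n" "d s X (list_code xs)" "d s Y y"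
      "R P s X Y"
  shows "y = F xs"
  using assms unfolding computes_def by blast

lemma computes_mono: "computes R n F \<Longrightarrow> mono_rel R"
  unfolding computes_def by blast

lemma computesI:
  assumes "mono_rel R"
    and "\<And>P s X xs. pairing_axioms P \<Longrightarrow> length xs = n \<Longrightarrow> represents P s X (list_code xs) \<Longrightarrow>
        \<exists>t Y. prefix s t \<and> represents P t Y (F xs) \<and> R P t X Y"
    and "\<And>P d s X Y xs y. standard_structure P d \<Longrightarrow> length xs = n \<Longrightarrow> d s X (list_code xs) \<Longrightarrow> d s Y y \<Longrightarrow>
        R P s X Y \<Longrightarrow>
        y = F xs"
  shows "computes R n F"
  unfolding computes_def
proof (intro conjI allI impI)
  show "y = F xs" if "standard_structure P d" "length xs = n" "d s X (list_code xs)" "d s Y y" "R P s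
      X Y" for P d s X Y xs y
    using that by (rule assms(3))
qed (use assms(1,2) in simp_all)

section \<open>Rules for standard structures\<close>

lemma standard_structure_clauses:
  assumes "standard_structure P d"
  shows "\<forall>s X. element P s X \<longrightarrow> (\<exists>t n. prefix s t \<and> d t X n)"
    and "\<forall>s t X n. d s X n \<longrightarrow> prefix s t \<longrightarrow> d t X n"
    and "\<forall>s X Y Z x y z. d s X x \<longrightarrow> d s Y y \<longrightarrow> d s Z z \<longrightarrow> paired P s X Y Z \<longrightarrow> z = pair_code x y"
    and "\<forall>n. \<exists>X. \<forall>s. element P s X \<and> d s X n \<and>
        (\<forall>x y A B. n = pair_code x y \<longrightarrow> d s A x \<longrightarrow> d s B y \<longrightarrow> paired P s A B X)"
    and "\<forall>I. \<exists>W. \<forall>s X n. d s X n \<longrightarrow> (member_of P s X W \<longleftrightarrow> n \<in> I)"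
    and "element P [] (part P 4)" and "d [] (part P 4) 0"
  using assms unfolding standard_structure_def by - (elim conjE, assumption)+

lemma standard_structure_mono: "standard_structure P d \<Longrightarrow> d s X n \<Longrightarrow> prefix s t \<Longrightarrow> d t X n"
  using standard_structure_clauses(2) by blast

lemma standard_structure_pair: "standard_structure P d \<Longrightarrow> paired P s X Y Z \<Longrightarrow> d s X x \<Longrightarrow> d s Y y \<Longrightarrow>
    d s Z z \<Longrightarrow> z = pair_code x y"
  by (rule standard_structure_clauses(3)[rule_format])

lemma standard_structure_set:
  assumes "standard_structure P d"
  obtains W where "\<And>s X n. d s X n \<Longrightarrow> member_of P s X W \<longleftrightarrow> n \<in> I"
  using standard_structure_clauses(5)[OF assms, rule_format, of I] that by blast

lemma standard_structure_zero: "standard_structure P d \<Longrightarrow> d s (part P 4) 0"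
  using standard_structure_mono[of P d "[]" "part P 4" 0 s] standard_structure_clauses(7)[of P d] by simp

text \<open>Some \<open>W\<close> tests for exactly \<open>n\<close>, and the test does not mention
  the number that \<open>X\<close> is said to code.\<close>

lemma standard_structure_unique:
  assumes "standard_structure P d" "d s X n" "d s X m"
  shows "n = m"
proof -
  obtain W where "\<And>s X k. d s X k \<Longrightarrow> member_of P s X W \<longleftrightarrow> k \<in> {n}"
    using standard_structure_set[OF assms(1), where I = "{n}"] by blast
  then show ?thesis using assms by blast
qed

lemma standard_structure_exists:
  assumes "standard_structure P d"
  obtains X where "element P s X" "d s X n" "\<And>x y A B. n = pair_code x y \<Longrightarrow> d s A x \<Longrightarrow> d s B y \<Longrightarrow>
      paired P s A B X"
  using standard_structure_clauses(4)[OF assms, rule_format, of n] that by blast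

text \<open>Each decoding may require moving up; the values found before persist, so finitely many
  elements are decoded at one node.\<close>

lemma standard_structure_decode:
  assumes "standard_structure P d" "\<forall>X\<in>set Xs. element P s X"
  shows "\<exists>t. prefix s t \<and> (\<forall>X\<in>set Xs. \<exists>n. d t X n)"
  using assms(2)
proof (induction Xs)
  case Nil
  then show ?case by auto
next
  case (Cons X Xs)
  then obtain t where t: "prefix s t" "\<forall>X\<in>set Xs. \<exists>n. d t X n" by auto
  then have "element P t X" using Cons.prems element_mono[OF _ t(1)] by simp
  then obtain u n where "prefix t u" "d u X n"
    using standard_structure_clauses(1)[OF assms(1)] by blast
  then have "prefix s u \<and> (\<forall>X\<in>set (X # Xs). \<exists>n. d u X n)"
    using t standard_structure_mono[OF assms(1)] prefix_order.trans by (metis set_ConsD)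
  then show ?case by blast
qed

lemma standard_structure_ax:
  assumes "standard_structure P d"
  shows "pairing_axioms P"
  unfolding pairing_axioms_def
proof (intro conjI allI impI)
  show "element P [] (part P 4)" using standard_structure_clauses(6)[OF assms] .
  fix s X Y assume "element P s X" "element P s Y"
  then obtain t x y where t: "prefix s t" "d t X x" "d t Y y"
    using standard_structure_decode[OF assms, of "[X, Y]" s] by auto
  obtain Z where "element P t Z" "\<And>x' y' A B. pair_code x y = pair_code x' y' \<Longrightarrow> d t A x' \<Longrightarrow> d t B y' \<Longrightarrow>
      paired P t A B Z"
    using standard_structure_exists[OF assms, of t "pair_code x y"] by metis
  then show "\<exists>t Z. prefix s t \<and> element P t Z \<and> paired P t X Y Z" using t by blast
qed

section \<open>The basic functions, access to lists, and composition\<close>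

definition zero_rel :: rel where
  "zero_rel P s X Y \<longleftrightarrow> Y = part P 4"

lemma computes_zero: "computes zero_rel n (\<lambda>_. 0)"
proof (rule computesI)
  show "mono_rel zero_rel" by (simp add: mono_rel_def zero_rel_def)
qed (auto simp: zero_rel_def intro: represents.zero standard_structure_unique standard_structure_zero)

text \<open>Since \<^term>\<open>list_code [x] = num_code (Suc x)\<close>, the successor relation is equality.\<close>

definition succ_rel :: rel where
  "succ_rel P s X Y \<longleftrightarrow> Y = X"

lemma computes_succ: "computes succ_rel 1 (\<lambda>xs. num_code (Suc (hd xs)))"
proof (rule computesI)
  show "mono_rel succ_rel" by (simp add: mono_rel_def succ_rel_def)
  have lst_1: "list_code xs = num_code (Suc (hd xs))" if "length xs = 1" for xs
    using that by (auto simp: length_Suc_conv)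
  show "\<exists>t Y. prefix s t \<and> represents P t Y (num_code (Suc (hd xs))) \<and> succ_rel P t X Y"
    if "length xs = 1" "represents P s X (list_code xs)" for P s X xs
    using that lst_1 unfolding succ_rel_def by (metis prefix_order.refl)
  show "y = num_code (Suc (hd xs))"
    if "standard_structure P d" "length xs = 1" "d s X (list_code xs)" "d s Y y" "succ_rel P s X Y"
        for P d s X Y xs y
    using that lst_1 standard_structure_unique unfolding succ_rel_def by metis
qed

definition hd_rel :: rel where
  "hd_rel P s X Y \<longleftrightarrow> (\<exists>B. element P s B \<and> paired P s Y B X)"

definition tl_rel :: "rel \<Rightarrow> rel" where
  "tl_rel R P s X Y \<longleftrightarrow> (\<exists>A B. element P s A \<and> element P s B \<and> paired P s A B X \<and> R P s B Y)"

lemma computes_hd: "computes hd_rel (Suc n) (\<lambda>xs. num_code (xs ! 0))"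
proof (rule computesI)
  show "mono_rel hd_rel"
    unfolding mono_rel_def hd_rel_def by (meson element_mono paired_mono)
next
  fix P s X and xs :: "nat list"
  assume P: "pairing_axioms P" and "length xs = Suc n" and X: "represents P s X (list_code xs)"
  then obtain x ys where x: "xs = x # ys" by (auto simp: length_Suc_conv)
  obtain A B where "element P s B" "paired P s A B X" "represents P s A (num_code x)"
    using X unfolding x by (auto elim: represents_pairE)
  then show "\<exists>t Y. prefix s t \<and> represents P t Y (num_code (xs ! 0)) \<and> hd_rel P t X Y"
    unfolding hd_rel_def x by auto
next
  fix P d s X Y y and xs :: "nat list"
  assume P: "standard_structure P d" and "length xs = Suc n" and d: "d s X (list_code xs)" "d s Y y"
      and R: "hd_rel P s X Y"
  then obtain x ys where x: "xs = x # ys" by (auto simp: length_Suc_conv)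
  obtain B where B: "element P s B" "paired P s Y B X"
    using R by (auto simp: hd_rel_def)
  obtain t b where t: "prefix s t" "d t B b" using standard_structure_decode[OF P, of "[B]" s] B by auto
  have dt: "d t X (list_code xs)" "d t Y y" using d t(1) standard_structure_mono[OF P] by blast+
  have "list_code xs = pair_code y b" using standard_structure_pair[OF P paired_mono[OF B(2) t(1)]
      dt(2) t(2) dt(1)] .
  then show "y = num_code (xs ! 0)" by (simp add: x)
qed

lemma computes_tl:
  assumes R: "computes R n F"
  shows "computes (tl_rel R) (Suc n) (\<lambda>xs. F (tl xs))"
proof (rule computesI)
  show "mono_rel (tl_rel R)"
    unfolding mono_rel_def tl_rel_def by (meson element_mono paired_mono mono_relD[OF computes_mono[OF
        R]])
next
  fix P s X and xs :: "nat list"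
  assume P: "pairing_axioms P" and len: "length xs = Suc n" and X: "represents P s X (list_code xs)"
  then obtain x ys where x: "xs = x # ys" by (auto simp: length_Suc_conv)
  obtain A B where AB: "element P s A" "element P s B" "paired P s A B X" "represents P s B (list_code
      ys)"
    using X unfolding x by (auto elim: represents_pairE)
  obtain t Y where t: "prefix s t" "represents P t Y (F ys)" "R P t B Y"
    using computes_rep[OF R P _ AB(4)] len x by auto
  have "tl_rel R P t X Y"
    unfolding tl_rel_def
    using element_mono[OF AB(1) t(1)] element_mono[OF AB(2) t(1)] paired_mono[OF AB(3) t(1)] t(3) by blast
  then show "\<exists>t Y. prefix s t \<and> represents P t Y (F (tl xs)) \<and> tl_rel R P t X Y"
    using t(1,2) x by auto
next
  fix P d s X Y y and xs :: "nat list"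
  assume P: "standard_structure P d" and len: "length xs = Suc n"
      and d: "d s X (list_code xs)" "d s Y y" and "tl_rel R P s X Y"
  then obtain x ys where x: "xs = x # ys" by (auto simp: length_Suc_conv)
  obtain A B where AB: "element P s A" "element P s B" "paired P s A B X" "R P s B Y"
    using \<open>tl_rel R P s X Y\<close> by (auto simp: tl_rel_def)
  obtain t a b where t: "prefix s t" "d t A a" "d t B b"
    using standard_structure_decode[OF P, of "[A, B]" s] AB by auto
  have dt: "d t X (list_code xs)" "d t Y y" using d t(1) standard_structure_mono[OF P] by blast+
  have "list_code xs = pair_code a b" using standard_structure_pair[OF P paired_mono[OF AB(3) t(1)]
      t(2,3) dt(1)] .
  then have "d t B (list_code ys)" using t(3) x by simp
  from computes_std[OF R P _ this dt(2) mono_relD[OF computes_mono[OF R] AB(4) t(1)]]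
  show "y = F (tl xs)" using len x by simp
qed

primrec nth_rel :: "nat \<Rightarrow> rel" where
  "nth_rel 0 = hd_rel"
| "nth_rel (Suc i) = tl_rel (nth_rel i)"

lemma computes_nth: "i < n \<Longrightarrow> computes (nth_rel i) n (\<lambda>xs. num_code (xs ! i))"
proof (induction i arbitrary: n)
  case 0
  then show ?case using computes_hd by (cases n) auto
next
  case (Suc i)
  then obtain m where m: "n = Suc m" "i < m" by (cases n) auto
  have "computes (tl_rel (nth_rel i)) (Suc m) (\<lambda>xs. num_code (tl xs ! i))"
    using computes_tl[OF Suc.IH[OF m(2)]] .
  moreover have "computes R k F \<Longrightarrow> (\<And>xs. length xs = k \<Longrightarrow> F xs = G xs) \<Longrightarrow> computes R k G" for R k F G
    by (simp add: computes_def)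
  ultimately show ?case using m by (auto simp: nth_tl)
qed

text \<open>Assembles the argument list of a composition, one entry at a time.\<close>

definition cons_rel :: "rel \<Rightarrow> rel \<Rightarrow> rel" where
  "cons_rel R S P s X Z \<longleftrightarrow>
     (\<exists>A B. element P s A \<and> element P s B \<and> R P s X A \<and> S P s X B \<and> paired P s A B Z)"

lemma computes_cons:
  assumes R: "computes R n F" and S: "computes S n G"
  shows "computes (cons_rel R S) n (\<lambda>xs. pair_code (F xs) (G xs))"
proof (rule computesI)
  note mono = mono_relD[OF computes_mono[OF R]] mono_relD[OF computes_mono[OF S]]
  show "mono_rel (cons_rel R S)"
    unfolding mono_rel_def cons_rel_def by (meson element_mono paired_mono mono)
  {
    fix P s X and xs :: "nat list"
    assume P: "pairing_axioms P" and len: "length xs = n" and X: "represents P s X (list_code xs)"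
    obtain t A where A: "prefix s t" "represents P t A (F xs)" "R P t X A"
      using computes_rep[OF R P len X] .
    obtain u B where B: "prefix t u" "represents P u B (G xs)" "S P u X B"
      using computes_rep[OF S P len represents_mono[OF X A(1)]] .
    obtain v Z where Z: "prefix u v" "represents P v Z (pair_code (F xs) (G xs))" "paired P v A B Z"
      using represents_pair_exists[OF P represents_mono[OF A(2) B(1)] B(2)] .
    have "prefix t v" using B(1) Z(1) by (rule prefix_order.trans)
    then have "cons_rel R S P v X Z"
      unfolding cons_rel_def
      using represents_el[OF P represents_mono[OF A(2)]] represents_el[OF P represents_mono[OF B(2) Z(1)]]
        mono(1)[OF A(3)] mono(2)[OF B(3) Z(1)] Z(3) by blast
    moreover have "prefix s v" using A(1) \<open>prefix t v\<close> by (rule prefix_order.trans)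
    ultimately show "\<exists>t Y. prefix s t \<and> represents P t Y (pair_code (F xs) (G xs)) \<and> cons_rel R S P t X Y"
      using Z(2) by blast
  }
  {
    fix P d s X Y y and xs :: "nat list"
    assume P: "standard_structure P d" and len: "length xs = n"
        and d: "d s X (list_code xs)" "d s Y y" and "cons_rel R S P s X Y"
    then obtain A B where AB: "element P s A" "element P s B" "R P s X A" "S P s X B" "paired P s A B Y"
      by (auto simp: cons_rel_def)
    obtain t a b where t: "prefix s t" "d t A a" "d t B b"
      using standard_structure_decode[OF P, of "[A, B]" s] AB by auto
    have dt: "d t X (list_code xs)" "d t Y y" using d t(1) standard_structure_mono[OF P] by blast+
    have "a = F xs" using computes_std[OF R P len dt(1) t(2) mono(1)[OF AB(3) t(1)]] .
    moreover have "b = G xs" using computes_std[OF S P len dt(1) t(3) mono(2)[OF AB(4) t(1)]] .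
    moreover have "y = pair_code a b" using standard_structure_pair[OF P paired_mono[OF AB(5) t(1)]
        t(2,3) dt(2)] .
    ultimately show "y = pair_code (F xs) (G xs)" by simp
  }
qed

definition comp_rel :: "rel \<Rightarrow> rel \<Rightarrow> rel" where
  "comp_rel R S P s X Y \<longleftrightarrow> (\<exists>Z. element P s Z \<and> S P s X Z \<and> R P s Z Y)"

lemma computes_comp:
  assumes R: "computes R m F" and S: "computes S n (\<lambda>xs. list_code (G xs))"
      and m: "\<And>xs. length (G xs) = m"
  shows "computes (comp_rel R S) n (\<lambda>xs. F (G xs))"
proof (rule computesI)
  note mono = mono_relD[OF computes_mono[OF R]] mono_relD[OF computes_mono[OF S]]
  show "mono_rel (comp_rel R S)"
    unfolding mono_rel_def comp_rel_def by (meson element_mono mono)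
  {
    fix P s X and xs :: "nat list"
    assume P: "pairing_axioms P" and len: "length xs = n" and X: "represents P s X (list_code xs)"
    obtain t Z where Z: "prefix s t" "represents P t Z (list_code (G xs))" "S P t X Z"
      using computes_rep[OF S P len X] .
    obtain u Y where Y: "prefix t u" "represents P u Y (F (G xs))" "R P u Z Y"
      using computes_rep[OF R P m Z(2)] .
    have "comp_rel R S P u X Y"
      unfolding comp_rel_def
      using represents_el[OF P represents_mono[OF Z(2) Y(1)]] mono(2)[OF Z(3) Y(1)] Y(3) by blast
    moreover have "prefix s u" using Z(1) Y(1) by (rule prefix_order.trans)
    ultimately show "\<exists>t Y. prefix s t \<and> represents P t Y (F (G xs)) \<and> comp_rel R S P t X Y"
      using Y(2) by blast
  }
  {
    fix P d s X Y y and xs :: "nat list"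
    assume P: "standard_structure P d" and len: "length xs = n"
        and d: "d s X (list_code xs)" "d s Y y" and "comp_rel R S P s X Y"
    then obtain Z where Z: "element P s Z" "S P s X Z" "R P s Z Y"
      by (auto simp: comp_rel_def)
    obtain t z where t: "prefix s t" "d t Z z"
      using standard_structure_decode[OF P, of "[Z]" s] Z by auto
    have dt: "d t X (list_code xs)" "d t Y y" using d t(1) standard_structure_mono[OF P] by blast+
    have "z = list_code (G xs)" using computes_std[OF S P len dt(1) t(2) mono(2)[OF Z(2) t(1)]] .
    then have "d t Z (list_code (G xs))" using t(2) by simp
    from computes_std[OF R P m this dt(2) mono(1)[OF Z(3) t(1)]] show "y = F (G xs)" .
  }
qed

section \<open>Primitive recursion\<close>

definition rec_closed :: "rel \<Rightarrow> rel \<Rightarrow> par \<Rightarrow> bool list \<Rightarrow> bool list set \<Rightarrow> bool list set \<Rightarrow> bool" where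
  "rec_closed R S P t L W \<longleftrightarrow>
     (\<forall>u K. prefix t u \<longrightarrow> element P u K \<longrightarrow> R P u L K \<longrightarrow>
        (\<exists>v V. prefix u v \<and> element P v V \<and> paired P v (part P 4) K V \<and> member_of P v V W)) \<and>
     (\<forall>u M K V M' K' G H. prefix t u \<longrightarrow>
        element P u M \<and> element P u K \<and> element P u V \<and> element P u M' \<and> element P u K' \<and>
            element P u G \<and> element P u H \<and>
        paired P u M K V \<and> member_of P u V W \<and> paired P u M (part P 4) M' \<and> paired P u K L G \<and>
            paired P u M G H \<and> S P u H K' \<longrightarrow>
        (\<exists>v V'. prefix u v \<and> element P v V' \<and> paired P v M' K' V' \<and> member_of P v V' W))"

text \<open>The graph is the intersection of all \<open>W\<close> closed under the recursion
  equations with parameter list \<open>L\<close>. In it \<open>R\<close> and \<open>S\<close> occur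
  in premises of a premise, hence positively.\<close>

definition rec_rel :: "rel \<Rightarrow> rel \<Rightarrow> rel" where
  "rec_rel R S P s X Y \<longleftrightarrow> (\<exists>M L. element P s M \<and> element P s L \<and> paired P s M L X \<and>
     (\<forall>t W. prefix s t \<longrightarrow> rec_closed R S P t L W \<longrightarrow>
        (\<exists>u V. prefix t u \<and> element P u V \<and> paired P u M Y V \<and> member_of P u V W)))"

lemma rec_closed_zero:
  assumes "rec_closed R S P t L W" "prefix t u" "element P u K" "R P u L K"
  obtains v V where "prefix u v" "element P v V" "paired P v (part P 4) K V" "member_of P v V W"
  using assms unfolding rec_closed_def by blast

lemma rec_closed_Suc:
  assumes "rec_closed R S P t L W" "prefix t u" "element P u M" "element P u K" "element P u V"
      "element P u M'" "element P u K'"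
    "element P u G" "element P u H" "paired P u M K V" "member_of P u V W" "paired P u M (part P 4)
        M'" "paired P u K L G" "paired P u M G H" "S P u H K'"
  obtains v V' where "prefix u v" "element P v V'" "paired P v M' K' V'" "member_of P v V' W"
  using assms(1)[unfolded rec_closed_def, THEN conjunct2, rule_format,
      of u M K V M' K' G H] assms(2-) that
  by blast

text \<open>That the true value is attained follows by induction on the recursion argument, a
  genuine natural number: every closed \<open>W\<close> contains the right pair. Other values are
  excluded in a standard structure by taking the true graph for \<open>W\<close>.\<close>

lemma computes_rec:
  assumes R: "computes R n (\<lambda>xs. num_code (f xs))" and S: "computes S (Suc (Suc n))
      (\<lambda>xs. num_code (g xs))"
  shows "computes (rec_rel R S) (Suc n)
    (\<lambda>xs. num_code (rec_nat (f (tl xs)) (\<lambda>y r. g (y # r # tl xs)) (hd xs)))"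
proof (rule computesI)
  note mono = mono_relD[OF computes_mono[OF R]] mono_relD[OF computes_mono[OF S]]
  show "mono_rel (rec_rel R S)"
    unfolding mono_rel_def
  proof (intro allI impI)
    fix P s t X Y assume "rec_rel R S P s X Y" and t: "prefix s t"
    then obtain M L where *: "element P s M" "element P s L" "paired P s M L X"
      "\<forall>t W. prefix s t \<longrightarrow> rec_closed R S P t L W \<longrightarrow> (\<exists>u V. prefix t u \<and> element P u V \<and>
          paired P u M Y V \<and> member_of P u V W)"
      unfolding rec_rel_def by blast
    then show "rec_rel R S P t X Y"
      unfolding rec_rel_def
      using element_mono[OF *(1) t] element_mono[OF *(2) t] paired_mono[OF *(3) t]
          prefix_order.trans[OF t] by blast
  qed
  {
    fix P s X and xs :: "nat list"
    assume P: "pairing_axioms P" and len: "length xs = Suc n" and X: "represents P s X (list_code xs)"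
    then obtain m ys where xs: "xs = m # ys" and ys: "length ys = n" by (auto simp: length_Suc_conv)
    define r where "r = rec_nat (f ys) (\<lambda>y r. g (y # r # ys))"
    obtain M L where dec: "element P s M" "element P s L" "paired P s M L X" "represents P s M
        (num_code m)" "represents P s L (list_code ys)"
      using X unfolding xs by (auto elim: represents_pairE)
    \<comment> \<open>This form of the induction hypothesis survives moving up; the extension at
      which the pair is found may depend on \<open>W\<close>.\<close>
    define \<Phi> where "\<Phi> t M Y \<longleftrightarrow> (\<forall>t' W. prefix t t' \<longrightarrow> rec_closed R S P t' L W \<longrightarrow>
        (\<exists>u V. prefix t' u \<and> element P u V \<and> paired P u M Y V \<and> member_of P u V W))" for t M Y
    have "\<exists>t Y. prefix s t \<and> represents P t Y (num_code (r m)) \<and>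
        \<Phi> t M Y" if "represents P s M (num_code m)" for M m
      using that
    proof (induction m arbitrary: M)
      case 0
      then have M: "M = part P 4" by (auto dest: represents_zeroD)
      obtain t Y where t: "prefix s t" "represents P t Y (num_code (f ys))" "R P t L Y"
        using computes_rep[OF R P ys dec(5)] .
      have "\<Phi> t M Y"
        unfolding \<Phi>_def
      proof (intro allI impI)
        fix t' W assume t': "prefix t t'" "rec_closed R S P t' L W"
        show "\<exists>u V. prefix t' u \<and> element P u V \<and> paired P u M Y V \<and> member_of P u V W"
          using rec_closed_zero[where u = t', OF t'(2) prefix_order.refl element_mono[OF
              represents_el[OF P t(2)] t'(1)] mono(1)[OF t(3) t'(1)]]
          unfolding M by blast
      qed
      then show ?case using t by (auto simp: r_def)
    next
      case (Suc m)
      obtain M1 where M1: "element P s M1" "paired P s M1 (part P 4) M" "represents P s M1 (num_code m)"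
        using Suc.prems by (auto elim!: represents_pairE dest!: represents_zeroD)
      obtain t1 K where K: "prefix s t1" "represents P t1 K (num_code (r m))" "\<Phi> t1 M1 K"
        using Suc.IH[OF M1(3)] by blast
      obtain t2 G where G: "prefix t1 t2" "represents P t2 G (pair_code (num_code (r m))
          (list_code ys))" "paired P t2 K L G"
        using represents_pair_exists[OF P K(2) represents_mono[OF dec(5) K(1)]] .
      have s2: "prefix s t2" using K(1) G(1) by (rule prefix_order.trans)
      obtain t3 H where H: "prefix t2 t3" "represents P t3 H (pair_code (num_code m) (pair_code
          (num_code (r m)) (list_code ys)))" "paired P t3 M1 G H"
        using represents_pair_exists[OF P represents_mono[OF M1(3) s2] G(2)] .
      have "represents P t3 H (list_code (m # r m # ys))" using H(2) by simp
      from computes_rep[OF S P _ this] obtain t4 K' where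
        K': "prefix t3 t4" "represents P t4 K' (num_code (g (m # r m # ys)))" "S P t4 H K'"
        using ys by auto
      have pre: "prefix t2 t4" "prefix t1 t4" "prefix s t4"
        using H(1) K'(1) G(1) K(1) by (meson prefix_order.trans)+
      have "\<Phi> t4 M K'"
        unfolding \<Phi>_def
      proof (intro allI impI)
        fix t' W assume t': "prefix t4 t'" "rec_closed R S P t' L W"
        obtain u V where u: "prefix t' u" "element P u V" "paired P u M1 K V" "member_of P u V W"
          using K(3) t' prefix_order.trans[OF pre(2) t'(1)] unfolding \<Phi>_def by blast
        have 4: "prefix t4 u" using t'(1) u(1) by (rule prefix_order.trans)
        then have 3: "prefix t3 u" using K'(1) prefix_order.trans by blast
        have 2: "prefix t2 u" "prefix t1 u" "prefix s u"
          using 4 pre prefix_order.trans by blast+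
        note e = element_mono[OF represents_el[OF P]]
        obtain v V' where "prefix u v" "element P v V'" "paired P v M K' V'" "member_of P v V' W"
        proof (rule rec_closed_Suc[OF t'(2) u(1)])
          show "element P u M1" using element_mono[OF M1(1) 2(3)] .
          show "element P u K" using e[OF K(2) 2(2)] .
          show "element P u V" using u(2) .
          show "element P u M" using e[OF Suc.prems 2(3)] .
          show "element P u K'" using e[OF K'(2) 4] .
          show "element P u G" using e[OF G(2) 2(1)] .
          show "element P u H" using e[OF H(2) 3] .
          show "paired P u M1 K V" "member_of P u V W" using u by auto
          show "paired P u M1 (part P 4) M" using paired_mono[OF M1(2) 2(3)] .
          show "paired P u K L G" using paired_mono[OF G(3) 2(1)] .
          show "paired P u M1 G H" using paired_mono[OF H(3) 3] .
          show "S P u H K'" using mono(2)[OF K'(3) 4] .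
        qed
        then show "\<exists>u V. prefix t' u \<and> element P u V \<and> paired P u M K' V \<and> member_of P u V W"
          using u(1) by (meson prefix_order.trans)
      qed
      then show ?case using pre(3) K'(2) by (auto simp: r_def)
    qed
    from this[OF dec(4)] obtain t Y where t: "prefix s t" "represents P t Y (num_code (r m))" "\<Phi> t M
        Y" by blast
    have "rec_rel R S P t X Y"
      unfolding rec_rel_def
      using element_mono[OF dec(1) t(1)] element_mono[OF dec(2) t(1)] paired_mono[OF dec(3) t(1)]
          t(3)[unfolded \<Phi>_def]
      by blast
    then show "\<exists>t Y. prefix s t \<and>
        represents P t Y (num_code (rec_nat (f (tl xs)) (\<lambda>y r. g (y # r # tl xs)) (hd xs))) \<and>
            rec_rel R S P t X Y"
      using t(1,2) by (auto simp: xs r_def)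
  }
  {
    fix P d s X Y y and xs :: "nat list"
    assume P: "standard_structure P d" and len: "length xs = Suc n"
        and d: "d s X (list_code xs)" "d s Y y" and "rec_rel R S P s X Y"
    then obtain m ys where xs: "xs = m # ys" and ys: "length ys = n" by (auto simp: length_Suc_conv)
    define r where "r = rec_nat (f ys) (\<lambda>y r. g (y # r # ys))"
    obtain M L where dec: "element P s M" "element P s L" "paired P s M L X"
      and Y: "\<And>t W. prefix s t \<Longrightarrow> rec_closed R S P t L W \<Longrightarrow>
        \<exists>u V. prefix t u \<and> element P u V \<and> paired P u M Y V \<and> member_of P u V W"
      using \<open>rec_rel R S P s X Y\<close> unfolding rec_rel_def by blast
    obtain t m' l where t: "prefix s t" "d t M m'" "d t L l"
      using standard_structure_decode[OF P, of "[M, L]" s] dec by auto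
    have dt: "d t X (list_code xs)" "d t Y y" using d t(1) standard_structure_mono[OF P] by blast+
    have "list_code xs = pair_code m' l" using standard_structure_pair[OF P paired_mono[OF dec(3)
        t(1)] t(2,3) dt(1)] .
    then have tL: "d t L (list_code ys)" and tM: "d t M (num_code m)" using t(2,3) by (auto simp: xs)
    \<comment> \<open>The true graph of the recursion, coded as a set of pairs; its closedness
      reduces to the two recursion equations.\<close>
    obtain W where W: "\<And>s X k. d s X k \<Longrightarrow> member_of P s X W \<longleftrightarrow> k \<in> {pair_code (num_code i) (num_code (r
        i)) | i. True}"
      using standard_structure_set[OF P, where I = "{pair_code (num_code i) (num_code (r i))
          | i. True}"] by blast
    have "rec_closed R S P t L W"
      unfolding rec_closed_def
    proof (intro conjI allI impI; (elim conjE)?)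
      fix u K assume u: "prefix t u" "element P u K" "R P u L K"
      obtain v k where v: "prefix u v" "d v K k" using standard_structure_decode[OF P, of "[K]" u] u
          by auto
      have "d v L (list_code ys)" using tL u(1) v(1) standard_structure_mono[OF P] by blast
      from computes_std[OF R P ys this v(2) mono(1)[OF u(3) v(1)]] have k: "k = num_code (r 0)" by
          (simp add: r_def)
      obtain V where V: "element P v V" "d v V (pair_code 0 k)"
        "\<And>x y A B. pair_code 0 k = pair_code x y \<Longrightarrow> d v A x \<Longrightarrow> d v B y \<Longrightarrow> paired P v A B V"
        using standard_structure_exists[OF P, of v "pair_code 0 k"] by blast
      have "paired P v (part P 4) K V" using V(3)[OF refl standard_structure_zero[OF P] v(2)] .
      moreover have "member_of P v V W" using W[OF V(2)] k by (auto intro: exI[of _ 0])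
      ultimately show "\<exists>v V. prefix u v \<and> element P v V \<and> paired P v (part P 4) K V \<and> member_of P v V W"
        using v(1) V(1) by blast
    next
      fix u M K V M' K' G H
      assume u: "prefix t u" and els: "element P u M" "element P u K" "element P u V" "element P u M'"
          "element P u K'" "element P u G" "element P u H"
        and paired: "paired P u M K V" "paired P u M (part P 4) M'" "paired P u K L G" "paired P u M G
            H" and member_of: "member_of P u V W" and "S P u H K'"
      obtain w m k v m' k' g' h where w: "prefix u w" and dw: "d w M m" "d w K k" "d w V v" "d w M' m'"
        "d w K' k'" "d w G g'" "d w H h"
        using standard_structure_decode[OF P, of "[M, K, V, M', K', G, H]" u] els by auto
      note pw = paired[THEN paired_mono, OF w]
      have L: "d w L (list_code ys)" using tL u w standard_structure_mono[OF P] by blast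
      have "v \<in> {pair_code (num_code i) (num_code (r i)) | i. True}"
          using W[OF dw(3)] member_of_mono[OF member_of w] by simp
      then obtain i where i: "v = pair_code (num_code i) (num_code (r i))" by blast
      have "v = pair_code m k" using standard_structure_pair[OF P pw(1) dw(1,2,3)] .
      then have m: "m = num_code i" and k: "k = num_code (r i)" using i by auto
      have m': "m' = pair_code m 0" using standard_structure_pair[OF P pw(2) dw(1)
          standard_structure_zero[OF P] dw(4)] .
      have "g' = pair_code k (list_code ys)" using standard_structure_pair[OF P pw(3) dw(2) L dw(6)] .
      moreover have "h = pair_code m g'" using standard_structure_pair[OF P pw(4) dw(1,6,7)] .
      ultimately have "d w H (list_code (i # r i # ys))" using dw(7) m k by simp
      from computes_std[OF S P _ this dw(5) mono(2)[OF \<open>S P u H K'\<close> w]]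
      have k': "k' = num_code (r (Suc i))" using ys by (simp add: r_def)
      obtain V' where V': "element P w V'" "d w V' (pair_code m' k')"
        "\<And>x y A B. pair_code m' k' = pair_code x y \<Longrightarrow> d w A x \<Longrightarrow> d w B y \<Longrightarrow> paired P w A B V'"
        using standard_structure_exists[OF P, of w "pair_code m' k'"] by blast
      have "paired P w M' K' V'" using V'(3)[OF refl dw(4,5)] .
      moreover have "member_of P w V' W" using W[OF V'(2)] m m' k' by (auto intro: exI[of _ "Suc i"])
      ultimately show "\<exists>v V'. prefix u v \<and> element P v V' \<and> paired P v M' K' V' \<and> member_of P v V' W"
        using w V'(1) by blast
    qed
    from Y[OF t(1) this] obtain u V where u: "prefix t u" "element P u V" "paired P u M Y V"
        "member_of P u V W" by blast
    obtain w v where w: "prefix u w" "d w V v" using standard_structure_decode[OF P, of "[V]" u] u by auto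
    have "prefix t w" using u(1) w(1) by (rule prefix_order.trans)
    then have "v = pair_code (num_code m) y"
      using standard_structure_pair[OF P paired_mono[OF u(3) w(1)] _ _ w(2)]
          standard_structure_mono[OF P] tM dt(2) by blast
    moreover obtain i where "v = pair_code (num_code i) (num_code (r i))"
        using W[OF w(2)] member_of_mono[OF u(4) w(1)] by blast
    ultimately have "y = num_code (r m)" by auto
    then show "y = num_code (rec_nat (f (tl xs)) (\<lambda>y r. g (y # r # tl xs)) (hd xs))"
      by (simp add: xs r_def)
  }
qed

section \<open>Minimization\<close>

definition min_closed :: "rel \<Rightarrow> par \<Rightarrow> bool list \<Rightarrow> bool list set \<Rightarrow> bool list set \<Rightarrow> bool" where
  "min_closed R P t X W \<longleftrightarrow> member_of P t (part P 4) W \<and>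
     (\<forall>u M G K K' M'. prefix t u \<longrightarrow>
        element P u M \<and> element P u G \<and> element P u K \<and> element P u K' \<and> element P u M' \<and>
            member_of P u M W \<and>
        paired P u M X G \<and> R P u G K' \<and> paired P u K (part P 4) K' \<and> paired P u M (part P 4) M' \<longrightarrow>
        (\<exists>v. prefix u v \<and> member_of P v M' W))"

text \<open>Belonging to every closed \<open>W\<close> says that \<open>Y\<close> is reached from 0
  through arguments with nonzero values only; together with value 0 at \<open>Y\<close> this
  determines the least zero. A value is shown to be nonzero by exhibiting a predecessor
  \<open>K\<close>, which keeps the condition positive.\<close>

definition min_rel :: "rel \<Rightarrow> rel" where
  "min_rel R P s X Y \<longleftrightarrow> (\<exists>G. element P s G \<and> paired P s Y X G \<and> R P s G (part P 4)) \<and>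
     (\<forall>t W. prefix s t \<longrightarrow> min_closed R P t X W \<longrightarrow> (\<exists>u. prefix t u \<and> member_of P u Y W))"

lemma min_closed_Suc:
  assumes "min_closed R P t X W" "prefix t u" "element P u M" "element P u G" "element P u K" "element
      P u K'" "element P u M'"
    "member_of P u M W" "paired P u M X G" "R P u G K'" "paired P u K (part P 4) K'" "paired P u M
        (part P 4) M'"
  obtains v where "prefix u v" "member_of P v M' W"
  using assms(1)[unfolded min_closed_def, THEN conjunct2, rule_format, of u M G K K' M'] assms(2-) that
  by blast

lemma computes_min:
  assumes R: "computes R (Suc n) (\<lambda>xs. num_code (f xs))" and reg: "\<And>xs. length xs = n \<Longrightarrow>
      \<exists>y. f (y # xs) = 0"
  shows "computes (min_rel R) n (\<lambda>xs. num_code (LEAST y. f (y # xs) = 0))"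
proof (rule computesI)
  note mono = mono_relD[OF computes_mono[OF R]]
  show "mono_rel (min_rel R)"
    unfolding mono_rel_def
  proof (intro allI impI)
    fix P s t X Y assume R: "min_rel R P s X Y" and t: "prefix s t"
    then obtain G where *: "element P s G" "paired P s Y X G" "R P s G (part P 4)"
      unfolding min_rel_def by blast
    have "\<forall>t W. prefix s t \<longrightarrow> min_closed R P t X W \<longrightarrow> (\<exists>u. prefix t u \<and> member_of P u Y W)"
      using R unfolding min_rel_def by blast
    then show "min_rel R P t X Y"
      unfolding min_rel_def
      using element_mono[OF *(1) t] paired_mono[OF *(2) t] mono[OF *(3) t] prefix_order.trans[OF t]
          by blast
  qed
  {
    fix P s X and xs :: "nat list"
    assume P: "pairing_axioms P" and len: "length xs = n" and X: "represents P s X (list_code xs)"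
    define n0 where "n0 = (LEAST y. f (y # xs) = 0)"
    have n0: "f (n0 # xs) = 0" "\<And>j. j < n0 \<Longrightarrow> f (j # xs) \<noteq> 0"
      using reg[OF len] not_less_Least unfolding n0_def by (auto intro: LeastI_ex)
    note e = element_mono[OF represents_el[OF P]]
    define \<Phi> where "\<Phi> t M \<longleftrightarrow> (\<forall>t' W. prefix t t' \<longrightarrow> min_closed R P t' X W \<longrightarrow>
        (\<exists>u. prefix t' u \<and> member_of P u M W))" for t M
    have "\<exists>t M. prefix s t \<and> represents P t M (num_code j) \<and> \<Phi> t M" if "j \<le> n0" for j
      using that
    proof (induction j)
      case 0
      have "\<Phi> s (part P 4)"
        unfolding \<Phi>_def min_closed_def by blast
      then show ?case using represents.zero[of P s] by auto
    next
      case (Suc j)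
      then obtain t1 M where M: "prefix s t1" "represents P t1 M (num_code j)" "\<Phi> t1 M" by auto
      obtain t2 G where G: "prefix t1 t2" "represents P t2 G (pair_code (num_code j) (list_code xs))"
          "paired P t2 M X G"
        using represents_pair_exists[OF P M(2) represents_mono[OF X M(1)]] .
      have "represents P t2 G (list_code (j # xs))" using G(2) by simp
      from computes_rep[OF R P _ this] obtain t3 K' where
        K': "prefix t2 t3" "represents P t3 K' (num_code (f (j # xs)))" "R P t3 G K'"
        using len by auto
      obtain k where "f (j # xs) = Suc k" using n0(2)[of j] Suc.prems not0_implies_Suc by auto
      then obtain K where K: "element P t3 K" "paired P t3 K (part P 4) K'"
        using K'(2) by (auto elim!: represents_pairE dest!: represents_zeroD)
      have 13: "prefix t1 t3" using G(1) K'(1) by (rule prefix_order.trans)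
      obtain t4 M' where M': "prefix t3 t4" "represents P t4 M' (pair_code (num_code j) 0)" "paired P
          t4 M (part P 4) M'"
        using represents_pair_exists[OF P represents_mono[OF M(2) 13] represents.zero] .
      have pre: "prefix t2 t4" "prefix t1 t4" "prefix s t4"
        using prefix_order.trans[OF K'(1) M'(1)] prefix_order.trans[OF 13 M'(1)]
          prefix_order.trans[OF M(1) prefix_order.trans[OF 13 M'(1)]] by blast+
      have "\<Phi> t4 M'"
        unfolding \<Phi>_def
      proof (intro allI impI)
        fix t' W assume t': "prefix t4 t'" "min_closed R P t' X W"
        obtain u where u: "prefix t' u" "member_of P u M W"
          using M(3) t' prefix_order.trans[OF pre(2) t'(1)] unfolding \<Phi>_def by blast
        have 4: "prefix t4 u" using t'(1) u(1) by (rule prefix_order.trans)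
        note up = prefix_order.trans[OF _ 4]
        obtain v where "prefix u v" "member_of P v M' W"
        proof (rule min_closed_Suc[OF t'(2) u(1)])
          show "element P u M" using e[OF M(2) up[OF pre(2)]] .
          show "element P u G" using e[OF G(2) up[OF pre(1)]] .
          show "element P u K" using element_mono[OF K(1) up[OF M'(1)]] .
          show "element P u K'" using e[OF K'(2) up[OF M'(1)]] .
          show "element P u M'" using e[OF M'(2) 4] .
          show "member_of P u M W" using u(2) .
          show "paired P u M X G" using paired_mono[OF G(3) up[OF pre(1)]] .
          show "R P u G K'" using mono[OF K'(3) up[OF M'(1)]] .
          show "paired P u K (part P 4) K'" using paired_mono[OF K(2) up[OF M'(1)]] .
          show "paired P u M (part P 4) M'" using paired_mono[OF M'(3) 4] .
        qed
        then show "\<exists>u. prefix t' u \<and> member_of P u M' W" using prefix_order.trans[OF u(1)] by blast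
      qed
      then show ?case using pre(3) M'(2) by auto
    qed
    from this[of n0] obtain t M where M: "prefix s t" "represents P t M (num_code n0)" "\<Phi> t M" by blast
    obtain u G where G: "prefix t u" "represents P u G (pair_code (num_code n0) (list_code xs))"
        "paired P u M X G"
      using represents_pair_exists[OF P M(2) represents_mono[OF X M(1)]] .
    have "represents P u G (list_code (n0 # xs))" using G(2) by simp
    from computes_rep[OF R P _ this] obtain v K where
      K: "prefix u v" "represents P v K (num_code (f (n0 # xs)))" "R P v G K"
      using len by auto
    then have "K = part P 4" using n0(1) by (auto dest: represents_zeroD)
    have tv: "prefix t v" using G(1) K(1) by (rule prefix_order.trans)
    have "min_rel R P v X M"
      unfolding min_rel_def
    proof (intro conjI allI impI)
      show "\<exists>G. element P v G \<and> paired P v M X G \<and> R P v G (part P 4)"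
        using e[OF G(2) K(1)] paired_mono[OF G(3) K(1)] K(3) \<open>K = part P 4\<close> by blast
      show "\<exists>u. prefix t' u \<and> member_of P u M W" if "prefix v t'" "min_closed R P t' X W" for t' W
        using M(3) prefix_order.trans[OF tv that(1)] that(2) unfolding \<Phi>_def by blast
    qed
    then show "\<exists>t Y. prefix s t \<and> represents P t Y (num_code (LEAST y. f (y # xs) = 0)) \<and>
        min_rel R P t X Y"
      using prefix_order.trans[OF M(1) tv] represents_mono[OF M(2) tv] unfolding n0_def by blast
  }
  {
    fix P d s X Y y and xs :: "nat list"
    assume P: "standard_structure P d" and len: "length xs = n"
        and d: "d s X (list_code xs)" "d s Y y" and "min_rel R P s X Y"
    then obtain G where G: "element P s G" "paired P s Y X G" "R P s G (part P 4)"
      and Y: "\<And>t W. prefix s t \<Longrightarrow> min_closed R P t X W \<Longrightarrow> \<exists>u. prefix t u \<and> member_of P u Y W"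
      unfolding min_rel_def by blast
    \<comment> \<open>The arguments up to the first zero: a closed set in which only the least zero
      has value 0.\<close>
    define I where "I = {num_code j | j. \<forall>i<j. f (i # xs) \<noteq> 0}"
    obtain W where W: "\<And>s X k. d s X k \<Longrightarrow> member_of P s X W \<longleftrightarrow> k \<in> I"
      using standard_structure_set[OF P, where I = I] by blast
    have "min_closed R P s X W"
      unfolding min_closed_def
    proof (intro conjI allI impI; (elim conjE)?)
      show "member_of P s (part P 4) W" using W[OF standard_structure_zero[OF P]] by
          (auto simp: I_def intro!: exI[of _ 0])
    next
      fix u M G K K' M'
      assume u: "prefix s u" and els: "element P u M" "element P u G" "element P u K" "element P u K'"
          "element P u M'"
        and member_of: "member_of P u M W" and paired: "paired P u M X G" "paired P u K (part P 4) K'"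
            "paired P u M (part P 4) M'"
        and "R P u G K'"
      obtain w m g k k' m' where w: "prefix u w" and dw: "d w M m" "d w G g" "d w K k" "d w K' k'" "d
          w M' m'"
        using standard_structure_decode[OF P, of "[M, G, K, K', M']" u] els by auto
      note pw = paired[THEN paired_mono, OF w]
      have X: "d w X (list_code xs)" using d(1) u w standard_structure_mono[OF P] by blast
      obtain j where j: "m = num_code j" "\<forall>i<j. f (i # xs) \<noteq> 0"
        using W[OF dw(1)] member_of_mono[OF member_of w] by (auto simp: I_def)
      have "g = pair_code m (list_code xs)" using standard_structure_pair[OF P pw(1) dw(1) X dw(2)] .
      then have "d w G (list_code (j # xs))" using dw(2) j by simp
      from computes_std[OF R P _ this dw(4) mono[OF \<open>R P u G K'\<close> w]]
      have "k' = num_code (f (j # xs))" using len by simp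
      moreover have "k' = pair_code k 0" using standard_structure_pair[OF P pw(2) dw(3)
          standard_structure_zero[OF P] dw(4)] .
      ultimately have "f (j # xs) \<noteq> 0" by (cases "f (j # xs)") auto
      moreover have "m' = pair_code m 0" using standard_structure_pair[OF P pw(3) dw(1)
          standard_structure_zero[OF P] dw(5)] .
      ultimately have "m' \<in> I" using j by (auto simp: I_def less_Suc_eq intro!: exI[of _ "Suc j"])
      then show "\<exists>v. prefix u v \<and> member_of P v M' W" using W[OF dw(5)] w by blast
    qed
    from Y[OF prefix_order.refl this] obtain u where u: "prefix s u" "member_of P u Y W" by blast
    then have "y \<in> I" using W standard_structure_mono[OF P d(2)] by blast
    then obtain j where j: "y = num_code j" "\<forall>i<j. f (i # xs) \<noteq> 0" by (auto simp: I_def)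
    obtain w g where w: "prefix s w" "d w G g" using standard_structure_decode[OF P, of "[G]" s] G by auto
    have dw: "d w X (list_code xs)" "d w Y y" using d w(1) standard_structure_mono[OF P] by blast+
    have "g = pair_code y (list_code xs)" using standard_structure_pair[OF P paired_mono[OF G(2) w(1)]
        dw(2,1) w(2)] .
    then have "d w G (list_code (j # xs))" using w(2) j by simp
    from computes_std[OF R P _ this standard_structure_zero[OF P] mono[OF G(3) w(1)]] len
    have "f (j # xs) = 0" by (cases "f (j # xs)") auto
    then have "(LEAST y. f (y # xs) = 0) = j"
      using j(2) by (intro Least_equality) (auto simp: not_less[symmetric])
    then show "y = num_code (LEAST y. f (y # xs) = 0)" using j(1) by simp
  }
qed

section \<open>Sequences as lists\<close>

definition emb :: "bool list \<Rightarrow> nat \<rightharpoonup> bool" where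
  "emb l i = (if i < length l then Some (l ! i) else None)"

lemma dom_emb [simp]: "dom (emb l) = {..<length l}"
  by (auto simp: emb_def dom_def)

lemma emb_le_iff [simp]: "emb l \<subseteq>\<^sub>m emb l' \<longleftrightarrow> prefix l l'"
  unfolding map_le_def prefix_nth
  by (auto simp: emb_def split: if_splits)

lemma emb_inject [simp]: "emb l = emb l' \<longleftrightarrow> l = l'"
  by (metis emb_le_iff map_le_refl prefix_order.antisym)

lemma emb_in_image_iff [simp]: "emb l \<in> emb ` A \<longleftrightarrow> l \<in> A"
  by auto

lemma emb_in_fin_seqs [simp]: "emb l \<in> fin_seqs"
  by (auto simp: fin_seqs_def seqs_def)

lemma fin_seqs_subset: "fin_seqs \<subseteq> seqs"
  by (auto simp: fin_seqs_def)

lemma emb_in_seqs [simp]: "emb l \<in> seqs"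
  using emb_in_fin_seqs fin_seqs_subset by blast

lemma seqs_cases:
  assumes "a \<in> seqs"
  obtains (fin) l where "a = emb l" | (inf) x where "a = Some \<circ> x"
proof (cases "dom a = UNIV")
  case True
  then have "a = Some \<circ> (\<lambda>i. the (a i))"
    by (intro ext) (metis UNIV_I comp_apply domIff option.collapse)
  then show ?thesis by (rule inf)
next
  case False
  then obtain m where "m \<notin> dom a" by blast
  define n where "n = (LEAST m. m \<notin> dom a)"
  have n: "n \<notin> dom a" "\<And>i. i < n \<Longrightarrow> i \<in> dom a"
    using \<open>m \<notin> dom a\<close> not_less_Least unfolding n_def by (metis LeastI, metis)
  have "i \<notin> dom a" if "\<not> i < n" for i
    using that n(1) assms unfolding seqs_def by (metis (mono_tags,
        lifting) linorder_neqE_nat mem_Collect_eq)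
  then have "a = emb (map (\<lambda>i. the (a i)) [0..<n])"
    using n(2) by (intro ext) (auto simp: emb_def domIff)
  then show ?thesis by (rule fin)
qed

lemma emb_le_branch_iff: "emb l \<subseteq>\<^sub>m Some \<circ> x \<longleftrightarrow> l = restr x (length l)"
  by (auto simp: map_le_def emb_def list_eq_iff_nth_eq)

lemma branch_in_seqs [simp]: "Some \<circ> x \<in> seqs"
  by (auto simp: seqs_def dom_def)

lemma branch_le_iff: "Some \<circ> x \<subseteq>\<^sub>m b \<longleftrightarrow> b = Some \<circ> x"
  by (auto simp: map_le_def fun_eq_iff dom_def)

text \<open>Infinite sequences are maximal, so finiteness is definable from the order; the formula
  \<open>fin\<close> expresses this.\<close>

lemma proper_extension_iff:
  assumes "a \<in> seqs"
  shows "(\<exists>b\<in>seqs. a \<subseteq>\<^sub>m b \<and> \<not> b \<subseteq>\<^sub>m a) \<longleftrightarrow> a \<in> range emb"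
  using assms
proof (cases rule: seqs_cases)
  case (fin l)
  then have "emb (l @ [True]) \<in> seqs \<and> a \<subseteq>\<^sub>m emb (l @ [True]) \<and> \<not> emb (l @ [True]) \<subseteq>\<^sub>m a"
    by (auto dest: prefix_length_le)
  then show ?thesis using fin by blast
next
  case (inf x)
  have "a \<notin> range emb"
  proof
    assume "a \<in> range emb"
    then obtain l where "a = emb l" by blast
    then have "emb l (length l) = Some (x (length l))" using inf by (metis comp_apply)
    then show False by (simp add: emb_def)
  qed
  moreover have "b \<subseteq>\<^sub>m a" if "a \<subseteq>\<^sub>m b" for b
    using that branch_le_iff[of x b] map_le_refl[of a] inf by metis
  ultimately show ?thesis by blast
qed

lemma fin_seqs_eq: "fin_seqs = range emb"
proof -
  have "a \<in> range emb" if "a \<in> fin_seqs" for a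
  proof -
    have "a \<in> seqs" "finite (dom a)" using that by (auto simp: fin_seqs_def)
    then show ?thesis
    proof (cases rule: seqs_cases)
      case (inf x)
      then have "dom a = UNIV" by (auto simp: dom_def)
      then show ?thesis using \<open>finite (dom a)\<close> by simp
    qed simp
  qed
  then show ?thesis by auto
qed

section \<open>Formulas\<close>

definition Imp :: "mfm \<Rightarrow> mfm \<Rightarrow> mfm" where
  "Imp f g = Neg (Conj f (Neg g))"

definition Disj :: "mfm \<Rightarrow> mfm \<Rightarrow> mfm" where
  "Disj f g = Neg (Conj (Neg f) (Neg g))"

definition fin :: "nat \<Rightarrow> mfm" where
  "fin x = Ex (Suc x) (Conj (Le x (Suc x)) (Neg (Le (Suc x) x)))"

definition ExN :: "nat \<Rightarrow> mfm \<Rightarrow> mfm" where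
  "ExN x f = Ex x (Conj (fin x) f)"

definition AllN :: "nat \<Rightarrow> mfm \<Rightarrow> mfm" where
  "AllN x f = Neg (ExN x (Neg f))"

text \<open>Relativizing the set quantifiers to sets of finite sequences makes the formulas independent of
  the range of the set quantifiers.\<close>

definition ExS :: "nat \<Rightarrow> mfm \<Rightarrow> mfm" where
  "ExS X f = ExSet X (Conj (Neg (Ex 0 (Conj (Mem 0 X) (Neg (fin 0))))) f)"

definition AllS :: "nat \<Rightarrow> mfm \<Rightarrow> mfm" where
  "AllS X f = Neg (ExS X (Neg f))"

lemmas formula_defs = Imp_def Disj_def fin_def ExN_def AllN_def ExS_def AllS_def

text \<open>Set terms allow the formulas below to be applied to intersections and differences
  without a quantifier naming these sets.\<close>

datatype sx = V nat | In sx sx | Df sx sx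

primrec val :: "(nat \<Rightarrow> bool list set) \<Rightarrow> sx \<Rightarrow> bool list set" where
  "val E (V i) = E i"
| "val E (In a b) = val E a \<inter> val E b"
| "val E (Df a b) = val E a - val E b"

primrec fmem :: "nat \<Rightarrow> sx \<Rightarrow> mfm" where
  "fmem v (V i) = Mem v i"
| "fmem v (In a b) = Conj (fmem v a) (fmem v b)"
| "fmem v (Df a b) = Conj (fmem v a) (Neg (fmem v b))"

text \<open>Variable 0 is excluded because it may hold the selector, a set of infinite sequences,
  while \<open>val\<close> deals with sets of nodes.\<close>

primrec below :: "nat \<Rightarrow> sx \<Rightarrow> bool" where
  "below k (V i) \<longleftrightarrow> 0 < i \<and> i < k"
| "below k (In a b) \<longleftrightarrow> below k a \<and> below k b"
| "below k (Df a b) \<longleftrightarrow> below k a \<and> below k b"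

lemma below_mono: "below k a \<Longrightarrow> k \<le> m \<Longrightarrow> below m a"
  by (induction a) auto

lemma val_upd [simp]: "below k a \<Longrightarrow> k \<le> m \<Longrightarrow> val (E(m := A)) a = val E a"
  by (induction a) auto

text \<open>The arguments \<^term>\<open>k\<close> of the following formulas are lower bounds for the names of their bound
  variables; the flag \<^term>\<open>md\<close> tells whether the selector \<^term>\<open>Q\<close> is the predicate 0 or the set
  variable 0. The set variables 1 to 5 hold the remaining parameters.\<close>

definition fQ :: "bool \<Rightarrow> nat \<Rightarrow> mfm" where
  "fQ md x = (if md then Pred 0 x else Mem x 0)"

definition fdense :: "nat \<Rightarrow> nat \<Rightarrow> sx \<Rightarrow> mfm" where
  "fdense k t a = AllN k (Imp (Le t k) (ExN (Suc k) (Conj (fmem (Suc k) a) (Le k (Suc k)))))"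

definition fchild :: "nat \<Rightarrow> nat \<Rightarrow> nat \<Rightarrow> mfm" where
  "fchild k u v = Conj (Conj (Le u v) (Neg (Eq u v)))
     (AllN k (Imp (Conj (Le u k) (Le k v)) (Disj (Eq k u) (Eq k v))))"

definition fsplit :: "nat \<Rightarrow> nat \<Rightarrow> nat \<Rightarrow> mfm" where
  "fsplit k T u = ExN k (ExN (Suc k) (Conj (Conj (Mem k T) (Mem (Suc k) T))
     (Conj (Neg (Eq k (Suc k))) (Conj (fchild (k + 2) u k) (fchild (k + 2) u (Suc k))))))"

definition ftree :: "nat \<Rightarrow> nat \<Rightarrow> mfm" where
  "ftree k T = Conj (ExN k (Mem k T))
     (AllN k (AllN (Suc k) (Imp (Le k (Suc k)) (Imp (Mem (Suc k) T) (Mem k T)))))"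

text \<open>The bound element is an infinite sequence, standing for the branch of its finite initial
  segments; hence \<open>Ex\<close> and not \<open>ExN\<close>.\<close>

definition fhit :: "bool \<Rightarrow> nat \<Rightarrow> nat \<Rightarrow> mfm" where
  "fhit md k T = Ex k (Conj (Conj (fQ md k) (Neg (fin k))) (AllN (Suc k) (Imp (Le (Suc k) k) (Mem (Suc
      k) T))))"

definition fgood :: "bool \<Rightarrow> nat \<Rightarrow> nat \<Rightarrow> sx \<Rightarrow> sx \<Rightarrow> sx \<Rightarrow> mfm" where
  "fgood md k t a b c = (let D = (\<lambda>d. ExN (Suc k) (Conj (fsplit (k + 2) k (Suc k))
      (Conj (fmem (Suc k) d) (Le k (Suc k))))) in
     ExS k (Conj (ftree k k) (Conj
       (AllN k (Imp (fsplit (Suc k) k k) (Conj (Le t k) (Disj (fmem k a) (Disj (fmem k b) (fmem k c))))))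
       (Conj (AllN k (Imp (Mem k k) (Conj (D a) (Conj (D b) (D c))))) (Neg (fhit md k k))))))"

definition findec :: "bool \<Rightarrow> nat \<Rightarrow> nat \<Rightarrow> sx \<Rightarrow> mfm" where
  "findec md k t a = AllS k (Imp (fdense k t (In a (V k))) (Imp (fdense k t (Df a (V k)))
     (fgood md (Suc k) t (In a (V k)) (Df a (V k)) (Df a (V k)))))"

definition fel :: "bool \<Rightarrow> nat \<Rightarrow> nat \<Rightarrow> nat \<Rightarrow> mfm" where
  "fel md k s x = AllN k (Imp (Le s k) (Conj (findec md (Suc k) k (In (V x) (V 1)))
     (Conj (findec md (Suc k) k (In (V x) (V 2))) (Conj (findec md (Suc k) k (In (V x) (V 3)))
     (Conj (fgood md (Suc k) k (In (V x) (V 1)) (In (V x) (V 2)) (V 4))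
           (fgood md (Suc k) k (In (V x) (V 1)) (In (V x) (V 3)) (V 4)))))))"

definition fpr :: "bool \<Rightarrow> nat \<Rightarrow> nat \<Rightarrow> nat \<Rightarrow> nat \<Rightarrow> nat \<Rightarrow> mfm" where
  "fpr md k s x y z = AllN k (Imp (Le s k)
     (fgood md (Suc k) k (In (V x) (V 1)) (In (V y) (V 2)) (In (V z) (V 3))))"

definition fme :: "nat \<Rightarrow> nat \<Rightarrow> nat \<Rightarrow> nat \<Rightarrow> mfm" where
  "fme k s x w = AllN k (Imp (Le s k) (Imp (Mem k x) (Imp (Mem k 1) (Mem k w))))"

text \<open>Both ranges of set quantifiers, \<open>seqs\<close> and \<open>fin_seqs\<close>, satisfy
  the assumption. \<open>Z\<close> is the value of set variable 0, which unlike the other variables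
  need not hold a set of finite sequences.\<close>

locale interpretation_of_formulas =
  fixes md :: bool and S :: "(nat \<rightharpoonup> bool) set" and Qs :: "(nat \<rightharpoonup> bool) set list"
    and Z :: "(nat \<rightharpoonup> bool) set"
  assumes S: "fin_seqs \<subseteq> S" "S \<subseteq> seqs"
begin

abbreviation "rsat \<equiv> sat S (tree_structure Qs)"

definition ev :: "(nat \<Rightarrow> bool list) \<Rightarrow> (nat \<Rightarrow> bool list set) \<Rightarrow> mfm \<Rightarrow> bool" where
  "ev e E f \<longleftrightarrow> rsat (\<lambda>i. emb (e i)) ((\<lambda>i. emb ` E i)(0 := Z)) f"

definition branches :: "(nat \<Rightarrow> bool) set" where
  "branches = {x. Some \<circ> x \<in> (if md then Qs ! 0 else Z)}"

definition par :: "(nat \<Rightarrow> bool list set) \<Rightarrow> par" where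
  "par E = (branches, [E 1, E 2, E 3, E 4, E 5])"

lemma par_simps [simp]: "fst (par E) = branches" "part (par E) 0 = E 1" "part (par E) (Suc 0) = E 2"
  "part (par E) 1 = E 2" "part (par E) 2 = E 3" "part (par E) 3 = E 4" "part (par E) 4 = E 5"
  by (simp_all add: par_def numeral_eq_Suc)

lemma par_upd [simp]: "6 \<le> k \<Longrightarrow> par (E(k := A)) = par E"
  by (simp add: par_def)

lemma tree_structure_simps [simp]:
  "universe (tree_structure Qs) = seqs" "preds (tree_structure Qs) = Qs"
  "le_rel (tree_structure Qs) a b \<longleftrightarrow> a \<subseteq>\<^sub>m b"
  by (simp_all add: tree_structure_def)

lemma rsat_simps [simp]:
  "rsat e E (Imp f g) \<longleftrightarrow> (rsat e E f \<longrightarrow> rsat e E g)"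
  "rsat e E (Disj f g) \<longleftrightarrow> (rsat e E f \<or> rsat e E g)"
  by (auto simp: formula_defs)

lemma rsat_fin: "e x \<in> seqs \<Longrightarrow> rsat e E (fin x) \<longleftrightarrow> e x \<in> range emb"
  using proper_extension_iff[of "e x"] by (simp add: fin_def)

lemma rsat_ExN [simp]: "rsat e E (ExN x f) \<longleftrightarrow> (\<exists>l. rsat (e(x := emb l)) E f)"
proof -
  have "rsat e E (ExN x f) \<longleftrightarrow> (\<exists>a\<in>seqs. rsat (e(x := a)) E (fin x) \<and> rsat (e(x := a)) E f)"
    by (simp add: ExN_def)
  also have "\<dots> \<longleftrightarrow> (\<exists>a\<in>seqs. a \<in> range emb \<and> rsat (e(x := a)) E f)"
    using rsat_fin by (metis fun_upd_same)
  also have "\<dots> \<longleftrightarrow> (\<exists>l. rsat (e(x := emb l)) E f)"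
    by (metis emb_in_seqs imageE rangeI)
  finally show ?thesis .
qed

lemma rsat_AllN [simp]: "rsat e E (AllN x f) \<longleftrightarrow> (\<forall>l. rsat (e(x := emb l)) E f)"
  by (simp add: AllN_def)

lemma ev_simps [simp]:
  "ev e E (Imp f g) \<longleftrightarrow> (ev e E f \<longrightarrow> ev e E g)"
  "ev e E (Disj f g) \<longleftrightarrow> (ev e E f \<or> ev e E g)"
  "ev e E (Conj f g) \<longleftrightarrow> (ev e E f \<and> ev e E g)"
  "ev e E (Neg f) \<longleftrightarrow> \<not> ev e E f"
  "ev e E (Le x y) \<longleftrightarrow> prefix (e x) (e y)"
  "ev e E (Eq x y) \<longleftrightarrow> e x = e y"
  "X \<noteq> 0 \<Longrightarrow> ev e E (Mem x X) \<longleftrightarrow> e x \<in> E X"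
  by (simp_all add: ev_def)

lemma emb_upd: "(\<lambda>i. emb ((e(x := l)) i)) = (\<lambda>i. emb (e i))(x := emb l)"
  by (auto simp: fun_eq_iff)

lemma ev_ExN [simp]: "ev e E (ExN x f) \<longleftrightarrow> (\<exists>l. ev (e(x := l)) E f)"
  by (simp add: ev_def emb_upd del: fun_upd_apply)

lemma ev_AllN [simp]: "ev e E (AllN x f) \<longleftrightarrow> (\<forall>l. ev (e(x := l)) E f)"
  by (simp add: AllN_def)

lemma ev_ExS [simp]:
  assumes "X \<noteq> 0"
  shows "ev e E (ExS X f) \<longleftrightarrow> (\<exists>A. ev e (E(X := A)) f)"
proof -
  let ?E = "\<lambda>A. (((\<lambda>i. emb ` E i)(0 := Z))(X := A))"
  let ?e = "\<lambda>i. emb (e i)"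
  have *: "rsat ?e (?E A) (Neg (Ex 0 (Conj (Mem 0 X) (Neg (fin 0))))) \<longleftrightarrow> A \<subseteq> range emb" if "A \<subseteq> seqs" for A
  proof -
    have "rsat ?e (?E A) (Neg (Ex 0 (Conj (Mem 0 X) (Neg (fin 0))))) \<longleftrightarrow>
        (\<forall>a\<in>seqs. a \<in> A \<longrightarrow> rsat (?e(0 := a)) (?E A) (fin 0))"
      by simp
    also have "\<dots> \<longleftrightarrow> (\<forall>a\<in>seqs. a \<in> A \<longrightarrow> a \<in> range emb)"
      using rsat_fin by (metis fun_upd_same)
    finally show ?thesis using that by blast
  qed
  have "ev e E (ExS X f) \<longleftrightarrow> (\<exists>A\<subseteq>S. A \<subseteq> range emb \<and> rsat ?e (?E A) f)"
    unfolding ev_def ExS_def sat.simps(9) sat.simps(7)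
    using * S(2) by (meson subset_trans)
  also have "\<dots> \<longleftrightarrow> (\<exists>A\<subseteq>range emb. rsat ?e (?E A) f)"
    using S(1) fin_seqs_eq by (metis subset_trans)
  also have "\<dots> \<longleftrightarrow> (\<exists>A. rsat ?e (?E (emb ` A)) f)"
    by (metis subset_imageE image_mono subset_UNIV)
  also have "\<dots> \<longleftrightarrow> (\<exists>A. ev e (E(X := A)) f)"
  proof -
    have "?E (emb ` A) = (\<lambda>i. emb ` (E(X := A)) i)(0 := Z)" for A
      using assms by (auto simp: fun_eq_iff)
    then show ?thesis by (simp add: ev_def)
  qed
  finally show ?thesis .
qed

lemma ev_AllS [simp]: "X \<noteq> 0 \<Longrightarrow> ev e E (AllS X f) \<longleftrightarrow> (\<forall>A. ev e (E(X := A)) f)"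
  by (simp add: AllS_def)

lemma ev_fmem [simp]: "below k a \<Longrightarrow> ev e E (fmem v a) \<longleftrightarrow> e v \<in> val E a"
  by (induction a) auto

lemma ev_fdense [simp]:
  assumes "t < k" "below m a"
  shows "ev e E (fdense k t a) \<longleftrightarrow> dense_below (e t) (val E a)"
  using assms by (auto simp: fdense_def dense_below_def)

lemma child_iff: 
  "prefix u v \<and> u \<noteq> v \<and> (\<forall>w. prefix u w \<and> prefix w v \<longrightarrow> w = u \<or> w = v) \<longleftrightarrow> (\<exists>c. v = u @ [c])"
proof
  assume *: "prefix u v \<and> u \<noteq> v \<and> (\<forall>w. prefix u w \<and> prefix w v \<longrightarrow> w = u \<or> w = v)"
  then obtain c z where v: "v = u @ c # z" by (metis append_Nil2 neq_Nil_conv prefixE)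
  then have "prefix u (u @ [c])" "prefix (u @ [c]) v" by simp_all
  then have "u @ [c] = v" using * by (metis append_self_conv not_Cons_self2)
  then show "\<exists>c. v = u @ [c]" by blast
qed (auto simp: prefix_snoc)

lemma ev_fchild [simp]:
  assumes "u < k" "v < k"
  shows "ev e E (fchild k u v) \<longleftrightarrow> (\<exists>c. e v = e u @ [c])"
  using assms unfolding child_iff[symmetric] by (simp add: fchild_def)

lemma ev_fsplit [simp]:
  assumes "u < k" "T \<noteq> 0"
  shows "ev e E (fsplit k T u) \<longleftrightarrow> e u \<in> splits (E T)"
proof -
  have "ev e E (fsplit k T u) \<longleftrightarrow> (\<exists>v w. v \<in> E T \<and> w \<in> E T \<and> v \<noteq> w \<and> (\<exists>c. v = e u @ [c]) \<and>
      (\<exists>c. w = e u @ [c]))"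
    using assms by (simp add: fsplit_def)
  also have "\<dots> \<longleftrightarrow> e u \<in> splits (E T)"
    unfolding splits_def by (auto, (metis (full_types))+)
  finally show ?thesis .
qed

lemma ev_ftree [simp]: "T \<noteq> 0 \<Longrightarrow> ev e E (ftree k T) \<longleftrightarrow> tree (E T)"
  by (auto simp: ftree_def tree_def)

lemma ev_fhit [simp]:
  assumes "T \<noteq> 0"
  shows "ev e E (fhit md k T) \<longleftrightarrow> branches \<inter> body (E T) \<noteq> {}"
proof -
  let ?e = "\<lambda>i. emb (e i)" and ?E = "(\<lambda>i. emb ` E i)(0 := Z)"
  let ?Q = "if md then Qs ! 0 else Z"
  have "ev e E (fhit md k T) \<longleftrightarrow>
      (\<exists>a\<in>seqs. a \<in> ?Q \<and> \<not> rsat (?e(k := a)) ?E (fin k) \<and> (\<forall>l. emb l \<subseteq>\<^sub>m a \<longrightarrow> l \<in> E T))"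
    using assms by (auto simp: ev_def fhit_def fQ_def)
  also have "\<dots> \<longleftrightarrow> (\<exists>a\<in>seqs. a \<in> ?Q \<and> a \<notin> range emb \<and> (\<forall>l. emb l \<subseteq>\<^sub>m a \<longrightarrow> l \<in> E T))"
    using rsat_fin[of "?e(k := a)" k ?E for a] by (intro bex_cong refl) simp
  also have "\<dots> \<longleftrightarrow> (\<exists>x. Some \<circ> x \<in> ?Q \<and> (\<forall>l. emb l \<subseteq>\<^sub>m Some \<circ> x \<longrightarrow> l \<in> E T))"
  proof
    assume "\<exists>a\<in>seqs. a \<in> ?Q \<and> a \<notin> range emb \<and> (\<forall>l. emb l \<subseteq>\<^sub>m a \<longrightarrow> l \<in> E T)"
    then obtain a where a: "a \<in> seqs" "a \<in> ?Q" "a \<notin> range emb" "\<forall>l. emb l \<subseteq>\<^sub>m a \<longrightarrow> l \<in> E T" by blast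
    from a(1) show "\<exists>x. Some \<circ> x \<in> ?Q \<and> (\<forall>l. emb l \<subseteq>\<^sub>m Some \<circ> x \<longrightarrow> l \<in> E T)"
      by (cases rule: seqs_cases) (use a in auto)
  next
    assume "\<exists>x. Some \<circ> x \<in> ?Q \<and> (\<forall>l. emb l \<subseteq>\<^sub>m Some \<circ> x \<longrightarrow> l \<in> E T)"
    then obtain x where x: "Some \<circ> x \<in> ?Q" "\<forall>l. emb l \<subseteq>\<^sub>m Some \<circ> x \<longrightarrow> l \<in> E T" by blast
    have "Some \<circ> x \<notin> range emb"
      using proper_extension_iff[OF branch_in_seqs, of x] branch_le_iff[of x] map_le_refl by metis
    then show "\<exists>a\<in>seqs. a \<in> ?Q \<and> a \<notin> range emb \<and> (\<forall>l. emb l \<subseteq>\<^sub>m a \<longrightarrow> l \<in> E T)"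
      using x branch_in_seqs by blast
  qed
  also have "\<dots> \<longleftrightarrow> branches \<inter> body (E T) \<noteq> {}"
    unfolding branches_def body_def emb_le_branch_iff
    by (auto simp del: comp_apply) (metis length_restr)+
  finally show ?thesis .
qed

lemma ev_fgood [simp]:
  assumes "t < k" "below k a" "below k b" "below k c"
  shows "ev e E (fgood md k t a b c) \<longleftrightarrow> good branches (e t) (val E a) (val E b) (val E c)"
proof -
  have [simp]: "k \<noteq> 0" "t \<noteq> k" "t \<noteq> Suc k" using assms by auto
  note [simp] = ev_fmem[OF assms(2)] ev_fmem[OF assms(3)] ev_fmem[OF assms(4)]
    val_upd[OF assms(2)] val_upd[OF assms(3)] val_upd[OF assms(4)]
  show ?thesis
    unfolding good_def fgood_def Let_def
    by (simp add: Ball_def Bex_def conj_ac)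
qed

lemma ev_findec [simp]:
  assumes "t < k" "below k a"
  shows "ev e E (findec md k t a) \<longleftrightarrow> indec branches (e t) (val E a)"
proof -
  have *: "k \<noteq> 0" "t < Suc k" "below (Suc k) a" using assms by (auto intro: below_mono)
  then show ?thesis
    using assms by (simp add: findec_def indec_def ev_fdense[where m = "Suc k"])
qed

lemma ev_fel [simp]:
  assumes "s < k" "0 < x" "x < k" "6 \<le> k"
  shows "ev e E (fel md k s x) \<longleftrightarrow> element (par E) (e s) (E x)"
  using assms by (simp add: fel_def element_def)

lemma ev_fpr [simp]:
  assumes "s < k" "0 < x" "x < k" "0 < y" "y < k" "0 < z" "z < k" "6 \<le> k"
  shows "ev e E (fpr md k s x y z) \<longleftrightarrow> paired (par E) (e s) (E x) (E y) (E z)"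
  using assms by (simp add: fpr_def paired_def)

lemma ev_fme [simp]:
  assumes "s < k" "0 < x" "0 < w"
  shows "ev e E (fme k s x w) \<longleftrightarrow> member_of (par E) (e s) (E x) (E w)"
  using assms by (simp add: fme_def member_of_def)

end

section \<open>Scopes\<close>

definition scoped :: "bool \<Rightarrow> nat set \<Rightarrow> nat set \<Rightarrow> mfm \<Rightarrow> bool" where
  "scoped md A B f \<longleftrightarrow>
     elem_vars f \<subseteq> A \<and> set_vars f \<subseteq> B \<and> pred_symbols f \<subseteq> (if md then {0} else {})"

primrec svars :: "sx \<Rightarrow> nat set" where
  "svars (V i) = {i}"
| "svars (In a b) = svars a \<union> svars b"
| "svars (Df a b) = svars a \<union> svars b"

lemma scoped_simps [simp]:
  "scoped md A B (Eq x y) \<longleftrightarrow> x \<in> A \<and> y \<in> A"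
  "scoped md A B (Le x y) \<longleftrightarrow> x \<in> A \<and> y \<in> A"
  "scoped md A B (Mem x X) \<longleftrightarrow> x \<in> A \<and> X \<in> B"
  "scoped md A B (Neg f) \<longleftrightarrow> scoped md A B f"
  "scoped md A B (Conj f g) \<longleftrightarrow> scoped md A B f \<and> scoped md A B g"
  "scoped md A B (Ex x f) \<longleftrightarrow> scoped md (insert x A) B f"
  "scoped md A B (ExSet X f) \<longleftrightarrow> scoped md A (insert X B) f"
  by (simp_all only: scoped_def elem_vars.simps set_vars.simps pred_symbols.simps Un_subset_iff
      Diff_subset_conv insert_subset empty_subsetI insert_is_Un[symmetric] simp_thms conj_ac)

lemma scoped_connectives [simp]:
  "scoped md A B (Imp f g) \<longleftrightarrow> scoped md A B f \<and> scoped md A B g"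
  "scoped md A B (Disj f g) \<longleftrightarrow> scoped md A B f \<and> scoped md A B g"
  "scoped md A B (fin x) \<longleftrightarrow> x \<in> A"
  by (simp_all add: Imp_def Disj_def fin_def)

lemma scoped_quantifiers [simp]:
  "scoped md A B (ExN x f) \<longleftrightarrow> scoped md (insert x A) B f"
  "scoped md A B (AllN x f) \<longleftrightarrow> scoped md (insert x A) B f"
  "scoped md A B (ExS X f) \<longleftrightarrow> scoped md A (insert X B) f"
  "scoped md A B (AllS X f) \<longleftrightarrow> scoped md A (insert X B) f"
  by (simp_all add: ExN_def AllN_def ExS_def AllS_def)

lemma scoped_fQ [simp]: "x \<in> A \<Longrightarrow> 0 \<in> B \<Longrightarrow> scoped md A B (fQ md x)"
  by (simp add: scoped_def fQ_def)

lemma scoped_fmem [simp]: "scoped md A B (fmem v a) \<longleftrightarrow> v \<in> A \<and> svars a \<subseteq> B"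
  by (induction a) auto

lemma scoped_fdense [simp]: "t \<in> A \<Longrightarrow> svars a \<subseteq> B \<Longrightarrow> scoped md A B (fdense k t a)"
  by (simp add: fdense_def)

lemma scoped_fchild [simp]: "u \<in> A \<Longrightarrow> v \<in> A \<Longrightarrow> scoped md A B (fchild k u v)"
  by (simp add: fchild_def)

lemma scoped_fsplit [simp]: "u \<in> A \<Longrightarrow> T \<in> B \<Longrightarrow> scoped md A B (fsplit k T u)"
  by (simp add: fsplit_def)

lemma scoped_ftree [simp]: "T \<in> B \<Longrightarrow> scoped md A B (ftree k T)"
  by (simp add: ftree_def)

lemma scoped_fhit [simp]: "0 \<in> B \<Longrightarrow> T \<in> B \<Longrightarrow> scoped md A B (fhit md k T)"
  by (simp add: fhit_def)

lemma scoped_fgood [simp]: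
  "t \<in> A \<Longrightarrow> 0 \<in> B \<Longrightarrow> svars a \<subseteq> B \<Longrightarrow> svars b \<subseteq> B \<Longrightarrow> svars c \<subseteq> B \<Longrightarrow>
   scoped md A B (fgood md k t a b c)"
  by (simp add: fgood_def Let_def subset_insertI2)

lemma scoped_findec [simp]:
  "t \<in> A \<Longrightarrow> 0 \<in> B \<Longrightarrow> svars a \<subseteq> B \<Longrightarrow> scoped md A B (findec md k t a)"
  by (simp add: findec_def subset_insertI2)

lemma scoped_fel [simp]:
  "s \<in> A \<Longrightarrow> {..5} \<subseteq> B \<Longrightarrow> x \<in> B \<Longrightarrow> scoped md A B (fel md k s x)"
  by (simp add: fel_def subset_iff)

lemma scoped_fpr [simp]:
  "s \<in> A \<Longrightarrow> {..5} \<subseteq> B \<Longrightarrow> x \<in> B \<Longrightarrow> y \<in> B \<Longrightarrow> z \<in> B \<Longrightarrow> scoped md A B (fpr md k s x y z)"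
  by (simp add: fpr_def subset_iff)

lemma scoped_fme [simp]:
  "s \<in> A \<Longrightarrow> {..5} \<subseteq> B \<Longrightarrow> x \<in> B \<Longrightarrow> w \<in> B \<Longrightarrow> scoped md A B (fme k s x w)"
  by (simp add: fme_def subset_iff)

definition feq :: "nat \<Rightarrow> nat \<Rightarrow> nat \<Rightarrow> mfm" where
  "feq k x y = AllN k (Conj (Imp (Mem k x) (Mem k y)) (Imp (Mem k y) (Mem k x)))"

lemma scoped_feq [simp]: "x \<in> B \<Longrightarrow> y \<in> B \<Longrightarrow> scoped md A B (feq k x y)"
  by (simp add: feq_def)

lemma (in interpretation_of_formulas) ev_feq [simp]:
  "0 < x \<Longrightarrow> 0 < y \<Longrightarrow> ev e E (feq k x y) \<longleftrightarrow> E x = E y"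
  by (auto simp: feq_def)

section \<open>Definable relations\<close>

abbreviation "eval \<equiv> interpretation_of_formulas.ev"
abbreviation "pars \<equiv> interpretation_of_formulas.par"

text \<open>Uniformity in \<open>md\<close>, \<open>S\<close> and the variable names is built in:
  formulas get nested inside one another, and one recursive function is to serve all the
  theories.\<close>

definition defines_rel :: "(bool \<Rightarrow> nat \<Rightarrow> nat \<Rightarrow> nat \<Rightarrow> nat \<Rightarrow> mfm) \<Rightarrow> rel \<Rightarrow> bool" where
  "defines_rel F R \<longleftrightarrow> (\<forall>md k s x y. 6 \<le> k \<longrightarrow> s < k \<longrightarrow> 0 < x \<longrightarrow> x < k \<longrightarrow> 0 < y \<longrightarrow> y < k \<longrightarrow>
     (\<forall>A B. s \<in> A \<longrightarrow> {..5} \<subseteq> B \<longrightarrow> x \<in> B \<longrightarrow> y \<in> B \<longrightarrow> scoped md A B (F md k s x y)) \<and>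
     (\<forall>S Qs Z e E. interpretation_of_formulas S \<longrightarrow>
        (eval S Qs Z e E (F md k s x y) \<longleftrightarrow> R (pars md Qs Z E) (e s) (E x) (E y))))"

lemma defines_relI:
  assumes "\<And>md k s x y A B. 6 \<le> k \<Longrightarrow> s < k \<Longrightarrow> 0 < x \<Longrightarrow> x < k \<Longrightarrow> 0 < y \<Longrightarrow> y < k \<Longrightarrow>
      s \<in> A \<Longrightarrow> {..5} \<subseteq> B \<Longrightarrow> x \<in> B \<Longrightarrow> y \<in> B \<Longrightarrow> scoped md A B (F md k s x y)"
    and "\<And>md k s x y S Qs Z e E. interpretation_of_formulas S \<Longrightarrow>
      6 \<le> k \<Longrightarrow> s < k \<Longrightarrow> 0 < x \<Longrightarrow> x < k \<Longrightarrow> 0 < y \<Longrightarrow> y < k \<Longrightarrow>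
      eval S Qs Z e E (F md k s x y) \<longleftrightarrow> R (pars md Qs Z E) (e s) (E x) (E y)"
  shows "defines_rel F R"
  unfolding defines_rel_def using assms by simp

lemma defines_rel_scoped:
  assumes "defines_rel F R" "6 \<le> k" "s < k" "0 < x" "x < k" "0 < y" "y < k"
    "s \<in> A" "{..5} \<subseteq> B" "x \<in> B" "y \<in> B"
  shows "scoped md A B (F md k s x y)"
  using assms unfolding defines_rel_def by simp

lemma defines_rel_eval:
  assumes "defines_rel F R" "interpretation_of_formulas S" "6 \<le> k" "s < k" "0 < x" "x < k" "0 < y" "y < k"
  shows "eval S Qs Z e E (F md k s x y) \<longleftrightarrow> R (pars md Qs Z E) (e s) (E x) (E y)"
  using assms unfolding defines_rel_def by simp

lemma subset_insert_atMost: "{..5 :: nat} \<subseteq> B \<Longrightarrow> {..5} \<subseteq> insert x B" "{..5 :: nat} \<subseteq> B \<Longrightarrow> 5 \<in> B"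
  by auto

lemma neq_add: "(s :: nat) < k \<Longrightarrow> s \<noteq> k + i" "(s :: nat) < k \<Longrightarrow> k + i \<noteq> s"
  "(s :: nat) < k \<Longrightarrow> s \<noteq> Suc k" "(s :: nat) < k \<Longrightarrow> Suc k \<noteq> s"
  "(s :: nat) < k \<Longrightarrow> s \<noteq> k" "(s :: nat) < k \<Longrightarrow> k \<noteq> s"
  by auto

lemma defines_zero: "defines_rel (\<lambda>md k s x y. feq k y 5) zero_rel"
proof (rule defines_relI)
  fix md k s x y S Qs Z e E
  assume "interpretation_of_formulas S" and b: "6 \<le> k" "s < k" "0 < x" "x < k" "0 < y" "y < (k :: nat)"
  then interpret interpretation_of_formulas md S Qs Z by simp
  show "ev e E (feq k y 5) \<longleftrightarrow> zero_rel (par E) (e s) (E x) (E y)"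
    using b by (simp add: zero_rel_def)
qed auto

lemma defines_succ: "defines_rel (\<lambda>md k s x y. feq k y x) succ_rel"
proof (rule defines_relI)
  fix md k s x y S Qs Z e E
  assume "interpretation_of_formulas S" and b: "6 \<le> k" "s < k" "0 < x" "x < k" "0 < y" "y < (k :: nat)"
  then interpret interpretation_of_formulas md S Qs Z by simp
  show "ev e E (feq k y x) \<longleftrightarrow> succ_rel (par E) (e s) (E x) (E y)"
    using b by (simp add: succ_rel_def)
qed auto

lemma defines_hd:
  "defines_rel (\<lambda>md k s x y. ExS k (Conj (fel md (k + 1) s k) (fpr md (k + 1) s y k x))) hd_rel"
proof (rule defines_relI)
  fix md k s x y S Qs Z e E
  assume "interpretation_of_formulas S" and b: "6 \<le> k" "s < k" "0 < x" "x < k" "0 < y" "y < (k :: nat)"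
  then interpret interpretation_of_formulas md S Qs Z by simp
  show "ev e E (ExS k (Conj (fel md (k + 1) s k) (fpr md (k + 1) s y k x))) \<longleftrightarrow>
      hd_rel (par E) (e s) (E x) (E y)"
    using b by (simp add: hd_rel_def neq_add)
qed (auto simp: subset_insert_atMost)

lemma defines_tl:
  assumes R: "defines_rel F R"
  shows "defines_rel (\<lambda>md k s x y. ExS k (ExS (k + 1) (Conj (fel md (k + 2) s k)
      (Conj (fel md (k + 2) s (k + 1))
    (Conj (fpr md (k + 2) s k (k + 1) x) (F md (k + 2) s (k + 1) y)))))) (tl_rel R)"
proof (rule defines_relI)
  fix md k s x y S Qs Z e E
  assume i: "interpretation_of_formulas S" and b: "6 \<le> k" "s < k" "0 < x" "x < k" "0 < y" "y < (k :: nat)"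
  then interpret interpretation_of_formulas md S Qs Z by simp
  show "ev e E (ExS k (ExS (k + 1) (Conj (fel md (k + 2) s k) (Conj (fel md (k + 2) s (k + 1))
    (Conj (fpr md (k + 2) s k (k + 1) x) (F md (k + 2) s (k + 1) y)))))) \<longleftrightarrow>
      tl_rel R (par E) (e s) (E x) (E y)"
    using b by (simp add: tl_rel_def neq_add defines_rel_eval[OF R i])
qed (auto simp: subset_insert_atMost intro!: defines_rel_scoped[OF R])

lemma defines_cons:
  assumes R: "defines_rel F R" and G: "defines_rel G R'"
  shows "defines_rel (\<lambda>md k s x y. ExS k (ExS (k + 1) (Conj (fel md (k + 2) s k)
      (Conj (fel md (k + 2) s (k + 1))
    (Conj (F md (k + 2) s x k) (Conj (G md (k + 2) s x (k + 1)) (fpr md (k + 2) s k (k + 1) y)))))))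
        (cons_rel R R')"
proof (rule defines_relI)
  fix md k s x y S Qs Z e E
  assume i: "interpretation_of_formulas S" and b: "6 \<le> k" "s < k" "0 < x" "x < k" "0 < y" "y < (k :: nat)"
  then interpret interpretation_of_formulas md S Qs Z by simp
  show "ev e E (ExS k (ExS (k + 1) (Conj (fel md (k + 2) s k) (Conj (fel md (k + 2) s (k + 1))
    (Conj (F md (k + 2) s x k) (Conj (G md (k + 2) s x (k + 1)) (fpr md (k + 2) s k (k + 1) y))))))) \<longleftrightarrow>
      cons_rel R R' (par E) (e s) (E x) (E y)"
    using b by (simp add: cons_rel_def neq_add defines_rel_eval[OF R i] defines_rel_eval[OF G i])
qed (auto simp: subset_insert_atMost intro!: defines_rel_scoped[OF R] defines_rel_scoped[OF G])

lemma defines_comp: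
  assumes R: "defines_rel F R" and G: "defines_rel G R'"
  shows "defines_rel (\<lambda>md k s x y. ExS k (Conj (fel md (k + 1) s k)
    (Conj (G md (k + 1) s x k) (F md (k + 1) s k y)))) (comp_rel R R')"
proof (rule defines_relI)
  fix md k s x y S Qs Z e E
  assume i: "interpretation_of_formulas S" and b: "6 \<le> k" "s < k" "0 < x" "x < k" "0 < y" "y < (k :: nat)"
  then interpret interpretation_of_formulas md S Qs Z by simp
  show "ev e E (ExS k (Conj (fel md (k + 1) s k) (Conj (G md (k + 1) s x k) (F md (k + 1) s k y)))) \<longleftrightarrow>
      comp_rel R R' (par E) (e s) (E x) (E y)"
    using b by (simp add: comp_rel_def neq_add defines_rel_eval[OF R i] defines_rel_eval[OF G i])
qed (auto simp: subset_insert_atMost intro!: defines_rel_scoped[OF R] defines_rel_scoped[OF G])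

text \<open>One number may name an element variable and a set variable at once, as in
  \<open>fel md (k + 1) k k\<close>, since the sorts are separate. Set variable 5 holds the code of
  zero, \<open>part P 4\<close>.\<close>

definition frec_closed where
  "frec_closed F G md k t l w = Conj
     (AllN k (AllS k (Imp (Conj (Le t k) (Conj (fel md (k + 1) k k) (F md (k + 1) k l k)))
       (ExN (k + 1) (ExS (k + 1) (Conj (Le k (k + 1)) (Conj (fel md (k + 2) (k + 1) (k + 1))
         (Conj (fpr md (k + 2) (k + 1) 5 k (k + 1)) (fme (k + 2) (k + 1) (k + 1) w)))))))))
     (AllN k (AllS k (AllS (k + 1) (AllS (k + 2) (AllS (k + 3) (AllS (k + 4) (AllS (k + 5) (AllS (k + 6)
       (Imp (Conj (Le t k) (Conj (fel md (k + 7) k k) (Conj (fel md (k + 7) k (k + 1))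
           (Conj (fel md (k + 7) k (k + 2))
         (Conj (fel md (k + 7) k (k + 3)) (Conj (fel md (k + 7) k (k + 4))
             (Conj (fel md (k + 7) k (k + 5))
         (Conj (fel md (k + 7) k (k + 6)) (Conj (fpr md (k + 7) k k (k + 1) (k + 2))
             (Conj (fme (k + 7) k (k + 2) w)
         (Conj (fpr md (k + 7) k k 5 (k + 3)) (Conj (fpr md (k + 7) k (k + 1) l (k + 5))
         (Conj (fpr md (k + 7) k k (k + 5) (k + 6)) (G md (k + 7) k (k + 6) (k + 4)))))))))))))))
       (ExN (k + 1) (ExS (k + 7) (Conj (Le k (k + 1)) (Conj (fel md (k + 8) (k + 1) (k + 7))
         (Conj (fpr md (k + 8) (k + 1) (k + 3) (k + 4) (k + 7))
             (fme (k + 8) (k + 1) (k + 7) w)))))))))))))))"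

lemma eval_frec_closed:
  assumes R: "defines_rel F R" and G: "defines_rel G R'" and i: "interpretation_of_formulas S"
    and b: "6 \<le> k" "t < k" "0 < l" "l < k" "0 < w" "w < k"
  shows "eval S Qs Z e E (frec_closed F G md k t l w) \<longleftrightarrow> rec_closed R R' (pars md Qs Z E) (e t) (E l)
      (E w)"
proof -
  interpret interpretation_of_formulas md S Qs Z by (rule i)
  show ?thesis
    using b by (simp add: frec_closed_def rec_closed_def neq_add defines_rel_eval[OF R i]
        defines_rel_eval[OF G i]
        imp_conjL del: ex_simps all_simps)
qed

lemma scoped_frec_closed:
  assumes R: "defines_rel F R" and G: "defines_rel G R'"
    and "6 \<le> k" "t < k" "0 < l" "l < k" "0 < w" "w < k" "t \<in> A" "{..5} \<subseteq> B" "l \<in> B" "w \<in> B"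
  shows "scoped md A B (frec_closed F G md k t l w)"
  using assms(3-) by (simp add: frec_closed_def subset_insert_atMost defines_rel_scoped[OF R]
      defines_rel_scoped[OF G])

lemma defines_rec:
  assumes R: "defines_rel F R" and G: "defines_rel G R'"
  shows "defines_rel (\<lambda>md k s x y. ExS k (ExS (k + 1) (Conj (fel md (k + 2) s k)
      (Conj (fel md (k + 2) s (k + 1))
    (Conj (fpr md (k + 2) s k (k + 1) x)
      (AllN k (AllS (k + 2) (Imp (Le s k) (Imp (frec_closed F G md (k + 3) k (k + 1) (k + 2))
        (ExN (k + 1) (ExS (k + 3) (Conj (Le k (k + 1)) (Conj (fel md (k + 4) (k + 1) (k + 3))
          (Conj (fpr md (k + 4) (k + 1) k y (k + 3)) (fme (k + 4) (k + 1) (k + 3) (k +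
              2)))))))))))))))) (rec_rel R R')"
proof (rule defines_relI)
  fix md k s x y S Qs Z e E
  assume i: "interpretation_of_formulas S" and b: "6 \<le> k" "s < k" "0 < x" "x < k" "0 < y" "y < (k :: nat)"
  then interpret interpretation_of_formulas md S Qs Z by simp
  show "ev e E (ExS k (ExS (k + 1) (Conj (fel md (k + 2) s k) (Conj (fel md (k + 2) s (k + 1))
    (Conj (fpr md (k + 2) s k (k + 1) x)
      (AllN k (AllS (k + 2) (Imp (Le s k) (Imp (frec_closed F G md (k + 3) k (k + 1) (k + 2))
        (ExN (k + 1) (ExS (k + 3) (Conj (Le k (k + 1)) (Conj (fel md (k + 4) (k + 1) (k + 3))
          (Conj (fpr md (k + 4) (k + 1) k y (k + 3)) (fme (k + 4) (k + 1) (k + 3) (k + 2)))))))))))))))) \<longleftrightarrow>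
      rec_rel R R' (par E) (e s) (E x) (E y)"
    using b by (simp add: rec_rel_def neq_add eval_frec_closed[OF R G i])
qed (simp add: subset_insert_atMost scoped_frec_closed[OF R G])

definition fmin_closed where
  "fmin_closed F md k t x w = Conj (fme k t 5 w)
     (AllN k (AllS k (AllS (k + 1) (AllS (k + 2) (AllS (k + 3) (AllS (k + 4)
       (Imp (Conj (Le t k) (Conj (fel md (k + 5) k k) (Conj (fel md (k + 5) k (k + 1))
           (Conj (fel md (k + 5) k (k + 2))
         (Conj (fel md (k + 5) k (k + 3)) (Conj (fel md (k + 5) k (k + 4)) (Conj (fme (k + 5) k k w)
         (Conj (fpr md (k + 5) k k x (k + 1)) (Conj (F md (k + 5) k (k + 1) (k + 3))
         (Conj (fpr md (k + 5) k (k + 2) 5 (k + 3)) (fpr md (k + 5) k k 5 (k + 4))))))))))))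
       (ExN (k + 1) (Conj (Le k (k + 1)) (fme (k + 5) (k + 1) (k + 4) w))))))))))"

lemma eval_fmin_closed:
  assumes R: "defines_rel F R" and i: "interpretation_of_formulas S"
    and b: "6 \<le> k" "t < k" "0 < x" "x < k" "0 < w" "w < k"
  shows "eval S Qs Z e E (fmin_closed F md k t x w) \<longleftrightarrow> min_closed R (pars md Qs Z E) (e t) (E x) (E w)"
proof -
  interpret interpretation_of_formulas md S Qs Z by (rule i)
  show ?thesis
    using b by (simp add: fmin_closed_def min_closed_def neq_add defines_rel_eval[OF R i] imp_conjL
        del: ex_simps all_simps)
qed

lemma scoped_fmin_closed:
  assumes R: "defines_rel F R"
    and "6 \<le> k" "t < k" "0 < x" "x < k" "0 < w" "w < k" "t \<in> A" "{..5} \<subseteq> B" "x \<in> B" "w \<in> B"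
  shows "scoped md A B (fmin_closed F md k t x w)"
  using assms(2-) by (simp add: fmin_closed_def subset_insert_atMost defines_rel_scoped[OF R])

lemma defines_min:
  assumes R: "defines_rel F R"
  shows "defines_rel (\<lambda>md k s x y. Conj
    (ExS k (Conj (fel md (k + 1) s k) (Conj (fpr md (k + 1) s y x k) (F md (k + 1) s k 5))))
    (AllN k (AllS k (Imp (Le s k) (Imp (fmin_closed F md (k + 1) k x k)
      (ExN (k + 1) (Conj (Le k (k + 1)) (fme (k + 2) (k + 1) y k)))))))) (min_rel R)"
proof (rule defines_relI)
  fix md k s x y S Qs Z e E
  assume i: "interpretation_of_formulas S" and b: "6 \<le> k" "s < k" "0 < x" "x < k" "0 < y" "y < (k :: nat)"
  then interpret interpretation_of_formulas md S Qs Z by simp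
  show "ev e E (Conj
    (ExS k (Conj (fel md (k + 1) s k) (Conj (fpr md (k + 1) s y x k) (F md (k + 1) s k 5))))
    (AllN k (AllS k (Imp (Le s k) (Imp (fmin_closed F md (k + 1) k x k)
      (ExN (k + 1) (Conj (Le k (k + 1)) (fme (k + 2) (k + 1) y k)))))))) \<longleftrightarrow>
      min_rel R (par E) (e s) (E x) (E y)"
    using b by (simp add: min_rel_def neq_add eval_fmin_closed[OF R i] defines_rel_eval[OF R i])
qed (simp add: subset_insert_atMost scoped_fmin_closed[OF R] defines_rel_scoped[OF R])

lemma defines_nth: "\<exists>F. defines_rel F (nth_rel i)"
  by (induction i) (auto intro: defines_hd dest: defines_tl)

theorem recursive_definable:
  assumes "recursive n f"
  shows "\<exists>F R. defines_rel F R \<and> computes R n (\<lambda>xs. num_code (f xs))"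
  using assms
proof induction
  case (zero n)
  then show ?case using defines_zero computes_zero[of n] by auto
next
  case succ
  then show ?case using defines_succ computes_succ by blast
next
  case (proj i n)
  then show ?case using defines_nth computes_nth by blast
next
  case (comp gs f n)
  \<comment> \<open>The inner values are computed together as one list code: \<open>zero_rel\<close>
    gives the empty list and \<open>cons_rel\<close> adds an entry.\<close>
  have "\<exists>F R. defines_rel F R \<and> computes R n (\<lambda>xs. list_code (map (\<lambda>g. g xs) gs))"
    using comp(3)
  proof (induction gs)
    case Nil
    then show ?case using defines_zero computes_zero[of n] by auto
  next
    case (Cons g gs)
    then obtain F R F' R' where "defines_rel F R" "computes R n (\<lambda>xs. num_code (g xs))"
      "defines_rel F' R'" "computes R' n (\<lambda>xs. list_code (map (\<lambda>g. g xs) gs))"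
      by auto
    then show ?case using defines_cons[of F R F' R'] computes_cons[of R n _ R'] by fastforce
  qed
  then obtain F R where "defines_rel F R" "computes R n (\<lambda>xs. list_code (map (\<lambda>g. g xs) gs))" by blast
  moreover obtain F' R' where "defines_rel F' R'" "computes R' (length gs) (\<lambda>xs. num_code (f xs))"
    using comp(2) by blast
  ultimately show ?case
    using defines_comp[of F' R' F R] computes_comp[of R' "length gs" "\<lambda>xs. num_code (f xs)" R n "\<lambda>xs.
        map (\<lambda>g. g xs) gs"]
    by auto
next
  case (prec n f g)
  then obtain F R F' R' where "defines_rel F R" "computes R n (\<lambda>xs. num_code (f xs))"
    "defines_rel F' R'" "computes R' (Suc (Suc n)) (\<lambda>xs. num_code (g xs))"
    by blast
  then show ?case using defines_rec[of F R F' R'] computes_rec[of R n f R' g] by blast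
next
  case (minim n f)
  then obtain F R where "defines_rel F R" "computes R (Suc n) (\<lambda>xs. num_code (f xs))" by blast
  then show ?case using defines_min[of F R] computes_min[of R n f] minim.hyps(2) by blast
qed

section \<open>The sentences\<close>

text \<open>Set variables 6 and 7 are recycled: the predecessor found in 7 is copied to 6 before the
  next step. Each step thus wraps the formula in one fixed context, which makes the code of
  \<open>fnum md n\<close> computable from \<open>n\<close> by iteration.\<close>

primrec fnum :: "bool \<Rightarrow> nat \<Rightarrow> mfm" where
  "fnum md 0 = feq 8 6 5"
| "fnum md (Suc n) = ExS 7 (Conj (fel md 8 0 7) (Conj (fel md 8 0 6) (Conj (fpr md 8 0 7 5 6)
     (ExS 6 (Conj (feq 8 6 7) (fnum md n))))))"

text \<open>The language has no name for the root, so the condition on the zero code at the root is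
  replaced by the equivalent one at all nodes.\<close>

definition fax :: "bool \<Rightarrow> mfm" where
  "fax md = Conj (AllN 0 (fel md 6 0 5)) (AllN 0 (AllS 6 (AllS 7 (Imp (fel md 8 0 6) (Imp (fel md 8 0 7)
     (ExN 1 (ExS 8 (Conj (Le 0 1) (Conj (fel md 9 1 8) (fpr md 9 1 6 7 8))))))))))"

definition fzero :: "(bool \<Rightarrow> nat \<Rightarrow> nat \<Rightarrow> nat \<Rightarrow> nat \<Rightarrow> mfm) \<Rightarrow> bool \<Rightarrow> mfm" where
  "fzero F md = ExS 7 (Conj (fel md 8 0 7) (Conj (fpr md 8 0 6 5 7) (F md 8 0 7 5)))"

text \<open>Variable 0 is bound by plain \<open>ExSet\<close> and not by \<open>ExS\<close>, because
  a selector consists of infinite sequences.\<close>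

definition sent :: "bool \<Rightarrow> nat \<Rightarrow> mfm \<Rightarrow> mfm" where
  "sent md n f = Neg (ExSet 0 (ExS 1 (ExS 2 (ExS 3 (ExS 4 (ExS 5 (Conj (fax md)
     (Neg (ExN 0 (ExS 6 (Conj (fnum md n) f)))))))))))"

section \<open>Truth of the sentences, in general and in a standard structure\<close>

primrec repn :: "par \<Rightarrow> bool list \<Rightarrow> bool list set \<Rightarrow> nat \<Rightarrow> bool" where
  "repn P s X 0 \<longleftrightarrow> X = part P 4"
| "repn P s X (Suc n) \<longleftrightarrow> (\<exists>Y. element P s Y \<and> element P s X \<and> paired P s Y (part P 4) X \<and> repn P s Y n)"

definition zero_at :: "rel \<Rightarrow> nat \<Rightarrow> par \<Rightarrow> bool" where
  "zero_at R n P \<longleftrightarrow> (pairing_axioms P \<longrightarrow> (\<exists>t X. repn P t X n \<and>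
     (\<exists>L. element P t L \<and> paired P t X (part P 4) L \<and> R P t L (part P 4))))"

lemma repn_rep:
  assumes "pairing_axioms P"
  shows "repn P s X n \<longleftrightarrow> represents P s X (num_code n)"
proof (induction n arbitrary: X)
  case 0
  then show ?case using represents.zero[of P s] represents_zeroD[of P s X] by auto
next
  case (Suc n)
  show ?case
  proof
    assume "repn P s X (Suc n)"
    then show "represents P s X (num_code (Suc n))"
      using represents.pair[OF _ ax_el_zero[OF assms] _ _ _ represents.zero] Suc by auto
  next
    assume X: "represents P s X (num_code (Suc n))"
    obtain A B where "element P s A" "paired P s A B X" "represents P s A (num_code n)" "represents P
        s B 0"
      using X by (auto elim: represents_pairE)
    then show "repn P s X (Suc n)"
      using represents_el[OF assms X] represents_zeroD Suc by auto
  qed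
qed

lemma represents_exists:
  assumes "pairing_axioms P"
  shows "\<exists>t X. represents P t X (num_code n)"
proof (induction n)
  case 0
  then show ?case using represents.zero[of P] by auto
next
  case (Suc n)
  then obtain t X where "represents P t X (num_code n)" by blast
  then obtain t' X' where "represents P t' X' (pair_code (num_code n) 0)"
    using represents_pair_exists[OF assms _ represents.zero] by metis
  then show ?case by auto
qed

text \<open>Along the construction by pairing, the pairing clause of a standard structure fixes each
  value. The node \<open>t\<close> is general because decoding the components moves up.\<close>

lemma represents_std:
  assumes P: "standard_structure P d" and "represents P s X a" "prefix s t" "d t X x"
  shows "x = a"
  using assms(2-)
proof (induction arbitrary: t x rule: represents.induct)
  case zero
  then show ?case using standard_structure_unique[OF P _ standard_structure_zero[OF P]] by auto
next
  case (pair A B X a b)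
  have "element P t A" "element P t B" "paired P t A B X"
    using pair.hyps pair.prems(1) element_mono paired_mono by blast+
  then obtain u a' b' where u: "prefix t u" "d u A a'" "d u B b'"
    using standard_structure_decode[OF P, of "[A, B]" t] by auto
  have "prefix s u" using pair.prems(1) u(1) by (rule prefix_order.trans)
  then have "a' = a" "b' = b" using pair.IH u by blast+
  moreover have "x = pair_code a' b'"
    using standard_structure_pair[OF P paired_mono[OF \<open>paired P t A B X\<close> u(1)] u(2,3)
        standard_structure_mono[OF P pair.prems(2) u(1)]] .
  ultimately show ?case by simp
qed

lemma zero_at_if:
  assumes R: "computes R 1 (\<lambda>xs. num_code (h xs))" and "h [n] = 0"
  shows "zero_at R n P"
  unfolding zero_at_def
proof
  assume P: "pairing_axioms P"
  obtain s X where X: "represents P s X (num_code n)" using represents_exists[OF P] by blast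
  obtain t L where L: "prefix s t" "represents P t L (pair_code (num_code n) 0)" "paired P t X (part P
      4) L"
    using represents_pair_exists[OF P X represents.zero] .
  have "represents P t L (list_code [n])" using L(2) by simp
  from computes_rep[OF R P _ this] obtain u Y where u: "prefix t u" "represents P u Y (num_code (h
      [n]))" "R P u L Y"
    by auto
  have "Y = part P 4" using u(2) assms(2) represents_zeroD by simp
  moreover have "repn P u X n"
    using repn_rep[OF P] represents_mono[OF X prefix_order.trans[OF L(1) u(1)]] by blast
  ultimately show "\<exists>t X. repn P t X n \<and> (\<exists>L. element P t L \<and> paired P t X (part P 4) L \<and>
      R P t L (part P 4))"
    using represents_el[OF P represents_mono[OF L(2) u(1)]] paired_mono[OF L(3) u(1)] u(3) by blast
qed

text \<open>A single standard structure refutes the condition whenever \<open>h [n]\<close> is not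
  0.\<close>

lemma zero_atD:
  assumes R: "computes R 1 (\<lambda>xs. num_code (h xs))" and P: "standard_structure P d" and "zero_at R n P"
  shows "h [n] = 0"
proof -
  have pairing_axioms: "pairing_axioms P" using standard_structure_ax[OF P] .
  obtain t X L where X: "repn P t X n" "element P t L" "paired P t X (part P 4) L" "R P t L (part P 4)"
    using assms(3) pairing_axioms unfolding zero_at_def by blast
  have represents: "represents P t X (num_code n)" using repn_rep[OF pairing_axioms] X(1) by blast
  obtain u x l where u: "prefix t u" "d u X x" "d u L l"
    using standard_structure_decode[OF P, of "[X, L]" t] X(2) represents_el[OF pairing_axioms
        represents] by auto
  have "x = num_code n" using represents_std[OF P represents u(1,2)] .
  moreover have "l = pair_code x 0" using standard_structure_pair[OF P paired_mono[OF X(3) u(1)] u(2)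
      standard_structure_zero[OF P] u(3)] .
  ultimately have "d u L (list_code [n])" using u(3) by simp
  from computes_std[OF R P _ this standard_structure_zero[OF P] mono_relD[OF computes_mono[OF R] X(4)
      u(1)]]
  show ?thesis by (cases "h [n]") auto
qed

context interpretation_of_formulas
begin

lemma ev_fnum [simp]: "ev e E (fnum md n) \<longleftrightarrow> repn (par E) (e 0) (E 6) n"
  by (induction n arbitrary: E) simp_all

lemma ev_fax: "ev e E (fax md) \<longleftrightarrow> pairing_axioms (par E)"
proof -
  have "(\<forall>s. element (par E) s (E 5)) \<longleftrightarrow> element (par E) [] (E 5)"
    using element_mono[of "par E" "[]" "E 5"] by auto
  then show ?thesis by (simp add: fax_def pairing_axioms_def)
qed

end

lemma eval_fzero:
  assumes F: "defines_rel F R" and i: "interpretation_of_formulas S"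
  shows "eval S Qs Z e E (fzero F md) \<longleftrightarrow>
    (\<exists>L. element (pars md Qs Z E) (e 0) L \<and> paired (pars md Qs Z E) (e 0) (E 6) (E 5) L \<and>
      R (pars md Qs Z E) (e 0) L (E 5))"
proof -
  interpret interpretation_of_formulas md S Qs Z by (rule i)
  show ?thesis by (simp add: fzero_def defines_rel_eval[OF F i])
qed

lemma sat_cong:
  "(\<And>x. x \<in> elem_vars f \<Longrightarrow> e x = e' x) \<Longrightarrow> (\<And>X. X \<in> set_vars f \<Longrightarrow> E X = E' X) \<Longrightarrow>
   sat S M e E f \<longleftrightarrow> sat S M e' E' f"
proof (induction f arbitrary: e e' E E')
  case (Ex x f)
  have "sat S M (e(x := a)) E f \<longleftrightarrow> sat S M (e'(x := a)) E' f" for a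
    using Ex.prems by (intro Ex.IH) auto
  then show ?case by simp
next
  case (ExSet X f)
  have "sat S M e (E(X := A)) f \<longleftrightarrow> sat S M e' (E'(X := A)) f" for A
    using ExSet.prems by (intro ExSet.IH) auto
  then show ?case by simp
next
  case (Neg f)
  then show ?case by (metis elem_vars.simps(6) sat.simps(6) set_vars.simps(6))
next
  case (Conj f g)
  have "sat S M e E f \<longleftrightarrow> sat S M e' E' f" using Conj.prems by (intro Conj.IH(1)) auto
  moreover have "sat S M e E g \<longleftrightarrow> sat S M e' E' g" using Conj.prems by (intro Conj.IH(2)) auto
  ultimately show ?case by simp
qed auto

lemma scoped_fax: "{..5} \<subseteq> B \<Longrightarrow> scoped md {} B (fax md)"
  by (simp add: fax_def subset_insert_atMost)

lemma scoped_fnum: "0 \<in> A \<Longrightarrow> {..5} \<subseteq> B \<Longrightarrow> 6 \<in> B \<Longrightarrow> scoped md A B (fnum md n)"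
proof (induction n arbitrary: B)
  case (Suc n)
  then show ?case by (simp add: subset_insert_atMost insert_absorb)
qed (simp add: subset_insert_atMost)

lemma scoped_fzero:
  assumes "defines_rel F R"
  shows "scoped md {0} {..6} (fzero F md)"
proof -
  have "{..5} \<subseteq> insert 7 {..6 :: nat}" by auto
  then show ?thesis
    by (simp add: fzero_def defines_rel_scoped[OF assms])
qed

lemma scoped_sent:
  assumes "scoped md {0} {..6} f"
  shows "scoped md {} {} (sent md n f)"
proof -
  have B: "{6, 5, 4, 3, 2, 1, 0} = {..6 :: nat}" "{..5 :: nat} = {5, 4, 3, 2, 1, 0}"
    by (auto simp: numeral_eq_Suc atMost_Suc)
  have "scoped md {} {5, 4, 3, 2, 1, 0} (fax md)" "scoped md {0} {6, 5, 4, 3, 2, 1, 0} (fnum md n)"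
    by (rule scoped_fax scoped_fnum; force simp: B)+
  then show ?thesis using assms[folded B(1)] by (simp add: sent_def)
qed

lemma sentence_sent:
  assumes "scoped md {0} {..6} f" "md \<longrightarrow> 0 < m"
  shows "sentence m (sent md n f)"
  using scoped_sent[OF assms(1), of n] assms(2) by (auto simp: sentence_def scoped_def split: if_splits)

lemma sat_sent:
  assumes F: "defines_rel F R" and S: "fin_seqs \<subseteq> S" "S \<subseteq> seqs"
  shows "sat S (tree_structure Qs) e E (sent md n (fzero F md)) \<longleftrightarrow>
    (\<forall>Z\<subseteq>S. \<forall>A1 A2 A3 A4 A5.
      zero_at R n ({x. Some \<circ> x \<in> (if md then Qs ! 0 else Z)}, [A1, A2, A3, A4, A5]))"
proof -
  have i: "interpretation_of_formulas S" using S by unfold_locales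
  let ?g = "ExS 1 (ExS 2 (ExS 3 (ExS 4 (ExS 5 (Conj (fax md)
     (Neg (ExN 0 (ExS 6 (Conj (fnum md n) (fzero F md))))))))))"
  have "scoped md {} {0} ?g"
    using scoped_sent[OF scoped_fzero[OF F], of md n] by (simp add: sent_def)
  then have fv: "elem_vars ?g = {}" "set_vars ?g \<subseteq> {0}" by (auto simp: scoped_def)
  have "sat S (tree_structure Qs) e (E(0 := Z)) ?g \<longleftrightarrow>
      \<not> (\<forall>A1 A2 A3 A4 A5. zero_at R n ({x. Some \<circ> x \<in> (if md then Qs ! 0 else Z)}, [A1, A2, A3, A4,
          A5]))" for Z
  proof -
    interpret interpretation_of_formulas md S Qs Z by (rule i)
    have "sat S (tree_structure Qs) e (E(0 := Z)) ?g \<longleftrightarrow> ev (\<lambda>_. []) (\<lambda>_. {}) ?g"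
      unfolding ev_def using fv by (intro sat_cong) auto
    also have "\<dots> \<longleftrightarrow> \<not> (\<forall>A1 A2 A3 A4 A5. zero_at R n (branches, [A1, A2, A3, A4, A5]))"
      by (simp add: ev_fax eval_fzero[OF F i] zero_at_def par_def)
    finally show ?thesis by (simp add: branches_def)
  qed
  then show ?thesis by (simp add: sent_def)
qed

text \<open>If \<open>h [n] = 0\<close>, the condition holds for all parameters, hence in every
  structure of the class. Conversely the parameter of one standard structure suffices: its selector
  is reached by the quantifier over \<open>Z\<close> when sets range over \<open>seqs\<close>, and
  as a predicate of a member of the class when they range over \<open>fin_seqs\<close>.\<close>

theorem sent_in_theory:
  assumes H: "continuum_hypothesis \<or> small_category_unions_not_UNIV"
    and F: "defines_rel F R" and R: "computes R 1 (\<lambda>xs. num_code (h xs))"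
  shows "sent False n (fzero F False) \<in> monadic_theory 0 {tree_structure []} \<longleftrightarrow> h [n] = 0"
    and "sent False n (fzero F False) \<in> monadic_theory m (tree_class m) \<longleftrightarrow> h [n] = 0"
    and "0 < m \<Longrightarrow> sent True n (fzero F True) \<in> restricted_monadic_theory m fin_seqs (tree_class m) \<longleftrightarrow>
        h [n] = 0"
proof -
  obtain P d where P: "standard_structure P d" "length (snd P) = 5" using exists_std[OF H] .
  obtain Q A1 A2 A3 A4 A5 where PQ: "P = (Q, [A1, A2, A3, A4, A5])"
    using P(2) by (cases P) (auto simp: length_Suc_conv numeral_eq_Suc)
  define Z where "Z = (\<lambda>x. Some \<circ> x) ` Q"
  have "inj (\<lambda>x :: nat \<Rightarrow> bool. Some \<circ> x)" by (auto simp: inj_def fun_eq_iff)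
  then have Z: "{x. Some \<circ> x \<in> Z} = Q" unfolding Z_def by (auto dest: injD)
  have Zs: "Z \<subseteq> seqs" unfolding Z_def using branch_in_seqs by blast
  have standard_structure: "h [n] = 0" if "zero_at R n ({x. Some \<circ> x \<in> Z}, [A1, A2, A3, A4, A5])"
    using zero_atD[OF R P(1), of n] that unfolding Z PQ by blast
  have sent: "sentence k (sent False n (fzero F False))" for k
    by (rule sentence_sent) (simp_all add: scoped_fzero[OF F])
  have full: "sat seqs (tree_structure Qs) e E (sent False n (fzero F False)) \<longleftrightarrow> h [n] = 0" for Qs e E
    unfolding sat_sent[OF F fin_seqs_subset subset_refl] using zero_at_if[OF R,
        of n] standard_structure Zs by auto
  have univ: "universe (tree_structure Qs) = seqs" for Qs by (simp add: tree_structure_def)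
  show "sent False n (fzero F False) \<in> monadic_theory 0 {tree_structure []} \<longleftrightarrow> h [n] = 0"
    using sent full univ by (simp add: monadic_theory_def)
  \<comment> \<open>A member of the class whose first predicate, the one that the formulas read, is
    the selector; it also shows that the class is nonempty.\<close>
  have mem: "tree_structure (replicate m Z) \<in> tree_class m"
    unfolding tree_class_def using Zs by (auto intro!: exI[of _ "replicate m Z"])
  have "sat (universe M) M e E (sent False n (fzero F False)) \<longleftrightarrow> h [n] = 0" if "M \<in> tree_class m" for M e E
  proof -
    obtain Qs where "M = tree_structure Qs" using \<open>M \<in> tree_class m\<close> unfolding tree_class_def by blast
    then show ?thesis using full univ by simp
  qed
  then show "sent False n (fzero F False) \<in> monadic_theory m (tree_class m) \<longleftrightarrow> h [n] = 0"
    using sent mem unfolding monadic_theory_def by blast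
  assume m: "0 < m"
  have sentT: "sentence m (sent True n (fzero F True))"
    using m by (intro sentence_sent) (simp_all add: scoped_fzero[OF F])
  note sat = sat_sent[OF F subset_refl fin_seqs_subset, where md = True and n = n]
  show "sent True n (fzero F True) \<in> restricted_monadic_theory m fin_seqs (tree_class m) \<longleftrightarrow> h [n] = 0"
  proof
    assume "sent True n (fzero F True) \<in> restricted_monadic_theory m fin_seqs (tree_class m)"
    then have "sat fin_seqs (tree_structure (replicate m Z)) undefined undefined (sent True n (fzero F
        True))"
      unfolding restricted_monadic_theory_def using mem by blast
    then show "h [n] = 0" unfolding sat using standard_structure m by auto
  next
    assume "h [n] = 0"
    then show "sent True n (fzero F True) \<in> restricted_monadic_theory m fin_seqs (tree_class m)"
      unfolding restricted_monadic_theory_def tree_class_def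
      using sentT sat zero_at_if[OF R, of n] by auto
  qed
qed

section \<open>Computing the codes\<close>

text \<open>\<open>recursive\<close> fixes a function on lists of every length; agreement on lists
  of length \<open>n\<close> leaves room for convenient descriptions.\<close>

definition computable :: "nat \<Rightarrow> (nat list \<Rightarrow> nat) \<Rightarrow> bool" where
  "computable n g \<longleftrightarrow> (\<exists>f. recursive n f \<and> (\<forall>xs. length xs = n \<longrightarrow> f xs = g xs))"

lemma computable_comp1:
  assumes "computable 1 F" "computable n g"
  shows "computable n (\<lambda>xs. F [g xs])"
proof -
  obtain f g' where "recursive 1 f" "\<And>xs. length xs = 1 \<Longrightarrow> f xs = F xs"
    and "recursive n g'" "\<And>xs. length xs = n \<Longrightarrow> g' xs = g xs"
    using assms unfolding computable_def by blast
  then show ?thesis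
    unfolding computable_def using recursive.comp[of "[g']" f n]
        by (intro exI[of _ "\<lambda>xs. f [g' xs]"]) auto
qed

lemma computable_comp2:
  assumes "computable 2 F" "computable n g1" "computable n g2"
  shows "computable n (\<lambda>xs. F [g1 xs, g2 xs])"
proof -
  obtain f g1' g2' where "recursive 2 f" "\<And>xs. length xs = 2 \<Longrightarrow> f xs = F xs"
    and "recursive n g1'" "\<And>xs. length xs = n \<Longrightarrow> g1' xs = g1 xs"
    and "recursive n g2'" "\<And>xs. length xs = n \<Longrightarrow> g2' xs = g2 xs"
    using assms unfolding computable_def by blast
  then show ?thesis
    unfolding computable_def using recursive.comp[of "[g1', g2']" f n]
    by (intro exI[of _ "\<lambda>xs. f [g1' xs, g2' xs]"]) (auto simp: numeral_2_eq_2)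
qed

lemma computable_proj: "i < n \<Longrightarrow> computable n (\<lambda>xs. xs ! i)"
  unfolding computable_def using recursive.proj by blast

lemma computable_Suc: "computable n g \<Longrightarrow> computable n (\<lambda>xs. Suc (g xs))"
  using computable_comp1[of "\<lambda>xs. Suc (hd xs)" n g] recursive.succ unfolding computable_def by auto

lemma computable_const: "computable n (\<lambda>_. c)"
proof (induction c)
  case 0
  then show ?case unfolding computable_def using recursive.zero by blast
qed (rule computable_Suc)

lemma computable_rec:
  assumes "computable n f" "computable (Suc (Suc n)) g"
  shows "computable (Suc n) (\<lambda>xs. rec_nat (f (tl xs)) (\<lambda>y r. g (y # r # tl xs)) (hd xs))"
proof -
  obtain f' g' where *: "recursive n f'" "\<And>xs. length xs = n \<Longrightarrow> f' xs = f xs"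
    "recursive (Suc (Suc n)) g'" "\<And>xs. length xs = Suc (Suc n) \<Longrightarrow> g' xs = g xs"
    using assms unfolding computable_def by blast
  have "rec_nat (f' (tl xs)) (\<lambda>y r. g' (y # r # tl xs)) (hd xs) =
      rec_nat (f (tl xs)) (\<lambda>y r. g (y # r # tl xs)) (hd xs)" if "length xs = Suc n" for xs
    using that *(2)[of "tl xs"] *(4) by simp
  then show ?thesis
    unfolding computable_def using recursive.prec[OF *(1,3)] by blast
qed

lemma computable_cong:
  "computable n f \<Longrightarrow> (\<And>xs. length xs = n \<Longrightarrow> f xs = g xs) \<Longrightarrow> computable n g"
  unfolding computable_def by auto

lemma computable_add: "computable 2 (\<lambda>xs. xs ! 0 + xs ! 1)"
proof -
  have c: "computable (Suc 1) (\<lambda>xs. rec_nat (tl xs ! 0) (\<lambda>y r. Suc ((y # r # tl xs) ! 1)) (hd xs))"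
    by (rule computable_rec[where f = "\<lambda>xs. xs ! 0" and g = "\<lambda>xs. Suc (xs ! 1)"])
      (auto intro: computable_proj computable_Suc)
  have e: "rec_nat a (\<lambda>y r. Suc r) b = b + a" for a b by (induction b) auto
  show ?thesis
    unfolding numeral_2_eq_2
    by (rule computable_cong[OF c[unfolded One_nat_def]]) (auto simp: e length_Suc_conv)
qed

lemma computable_triangle: "computable 1 (\<lambda>xs. triangle (xs ! 0))"
proof -
  have g: "computable (Suc (Suc 0)) (\<lambda>xs. xs ! 1 + Suc (xs ! 0))"
    using computable_comp2[OF computable_add computable_proj[of 1] computable_Suc[OF
        computable_proj[of 0]],
      of "Suc (Suc 0)"] by simp
  have e: "rec_nat 0 (\<lambda>y r. Suc (r + y)) b = triangle b" for b by (induction b) auto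
  show ?thesis
    unfolding One_nat_def
    by (rule computable_cong[OF computable_rec[OF computable_const[of 0 0] g]])
        (auto simp: e length_Suc_conv)
qed

lemma computable_pair:
  assumes "computable n f" "computable n g"
  shows "computable n (\<lambda>xs. prod_encode (f xs, g xs))"
proof -
  have s: "computable n (\<lambda>xs. f xs + g xs)"
    using computable_comp2[OF computable_add assms] by simp
  have "computable n (\<lambda>xs. triangle (f xs + g xs) + f xs)"
    using computable_comp2[OF computable_add computable_comp1[OF computable_triangle s] assms(1)] by simp
  then show ?thesis by (simp add: prod_encode_def)
qed

text \<open>The code of a fixed context with a varying formula in last position arises from the code
  of that formula by pairing constants on from the left.\<close>

definition pair_with :: "nat list \<Rightarrow> nat \<Rightarrow> nat" where
  "pair_with as c = foldr (\<lambda>a c. prod_encode (a, c)) as c"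

lemma computable_pair_with: "computable n g \<Longrightarrow> computable n (\<lambda>xs. pair_with as (g xs))"
  unfolding pair_with_def
  by (induction as) (auto intro: computable_pair computable_const)

lemma computable_iterate: "computable 1 (\<lambda>xs. rec_nat c (\<lambda>_. pair_with as) (xs ! 0))"
proof -
  have "computable (Suc 0) (\<lambda>xs. rec_nat c (\<lambda>y r. pair_with as ((y # r # tl xs) ! 1)) (hd xs))"
    by (rule computable_rec[where f = "\<lambda>_. c" and g = "\<lambda>xs. pair_with as (xs ! 1)"])
      (auto intro: computable_const computable_proj computable_pair_with)
  then show ?thesis
    unfolding One_nat_def by (rule computable_cong) (auto simp: length_Suc_conv)
qed

lemma code_ExN: "code (ExN x f) = pair_with [7, x, 6, code (fin x)] (code f)"
  by (simp add: ExN_def pair_with_def)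

lemma code_ExS:
  "code (ExS X f) = pair_with [8, X, 6, code (Neg (Ex 0 (Conj (Mem 0 X) (Neg (fin 0)))))] (code f)"
  by (simp add: ExS_def pair_with_def)

lemma code_Conj: "code (Conj f g) = pair_with [6, code f] (code g)"
  by (simp add: pair_with_def)

lemma code_Conj': "code (Conj f g) = pair_with [6] (prod_encode (code f, code g))"
  by (simp add: pair_with_def)

lemma code_Neg: "code (Neg f) = pair_with [5] (code f)"
  by (simp add: pair_with_def)

lemma code_ExSet: "code (ExSet X f) = pair_with [8, X] (code f)"
  by (simp add: pair_with_def)

lemma pair_with_append: "pair_with as (pair_with bs c) = pair_with (as @ bs) c"
  by (simp add: pair_with_def)

lemma code_sent:
  obtains g where "computable 1 g" "\<And>f. code (sent md (code f) f) = g [code f]"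
proof -
  have "\<exists>as. \<forall>n. code (fnum md (Suc n)) = pair_with as (code (fnum md n))"
    unfolding fnum.simps code_ExS code_Conj[of "fel md 8 0 7"] code_Conj[of "fel md 8 0 6"]
      code_Conj[of "fpr md 8 0 7 5 6"] code_Conj[of "feq 8 6 7"] pair_with_append
    \<comment> \<open>Unification reads the list off the unfolded code; it succeeds because the
      context does not depend on \<open>n\<close>.\<close>
    by (intro exI allI) (rule refl)
  then obtain as where as: "\<And>n. code (fnum md (Suc n)) = pair_with as (code (fnum md n))" by blast
  have fnum: "code (fnum md n) = rec_nat (code (fnum md 0)) (\<lambda>_. pair_with as) n" for n
    by (induction n) (simp_all only: as nat.rec)
  have "\<exists>bs. \<forall>n f. code (sent md n f) = pair_with bs (prod_encode (code (fnum md n), code f))"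
    unfolding sent_def code_Neg code_ExSet code_ExS code_ExN code_Conj[of "fax md"]
      code_Conj'[of "fnum md n" for n] pair_with_append
    by (intro exI allI) (rule refl)
  then obtain bs where bs: "\<And>n f. code (sent md n f) = pair_with bs (prod_encode (code (fnum md n),
      code f))"
    by blast
  let ?g = "\<lambda>xs. pair_with bs (prod_encode (rec_nat (code (fnum md 0)) (\<lambda>_. pair_with as) (xs ! 0),
      xs ! 0))"
  show ?thesis
  proof (rule that[of ?g])
    show "computable 1 ?g"
      by (intro computable_pair_with computable_pair computable_iterate computable_proj) simp
    show "code (sent md (code f) f) = ?g [code f]" for f
      using bs[of "code f" f] fnum[of "code f"] by simp
  qed
qed

text \<open>Let \<open>f\<close> decide the theory and let \<open>g\<close> send the code of a
  formula to the code of the sentence applying that formula to its own code. The formula for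
  \<open>f\<close> after \<open>g\<close>, applied to its own code, asserts that the resulting
  sentence is not in the theory.\<close>

lemma diagonal:
  assumes T: "\<And>F R h n. defines_rel F R \<Longrightarrow> computes R 1 (\<lambda>xs. num_code (h xs)) \<Longrightarrow>
      sent md n (fzero F md) \<in> T \<longleftrightarrow> h [n] = 0"
  shows "\<not> decidable T"
proof
  assume "decidable T"
  then obtain f where f: "recursive 1 f" "\<And>k. f [k] = (if k \<in> code ` T then 1 else 0)"
    unfolding decidable_def recursive_set_def by blast
  obtain g where g: "computable 1 g" "\<And>f. code (sent md (code f) f) = g [code f]"
    using code_sent by blast
  have "computable 1 f" using f(1) by (auto simp: computable_def)
  then have "computable 1 (\<lambda>xs. f [g xs])" using g(1) by (rule computable_comp1)
  then obtain h where h: "recursive 1 h" "\<And>k. h [k] = f [g [k]]"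
    unfolding computable_def by auto
  obtain F R where FR: "defines_rel F R" "computes R 1 (\<lambda>xs. num_code (h xs))"
    using recursive_definable[OF h(1)] by blast
  let ?c = "code (fzero F md)"
  have "sent md ?c (fzero F md) \<in> T \<longleftrightarrow> f [code (sent md ?c (fzero F md))] = 0"
    using T[OF FR] h(2) g(2) by simp
  also have "\<dots> \<longleftrightarrow> sent md ?c (fzero F md) \<notin> T"
    unfolding f(2) using code_inject by auto
  finally show False by blast
qed

theorem theorem8p3:
  assumes "continuum_hypothesis \<or> small_category_unions_not_UNIV"
  shows "\<not> decidable (monadic_theory 0 {tree_structure []}) \<and>
    (\<forall>n\<ge>1. \<not> decidable (monadic_theory n (tree_class n)) \<and>
            \<not> decidable (restricted_monadic_theory n fin_seqs (tree_class n)))"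
proof (intro conjI allI impI)
  show "\<not> decidable (monadic_theory 0 {tree_structure []})"
    by (rule diagonal[where md = False]) (rule sent_in_theory(1)[OF assms])
  fix n :: nat assume n: "n \<ge> 1"
  show "\<not> decidable (monadic_theory n (tree_class n))"
    by (rule diagonal[where md = False]) (rule sent_in_theory(2)[OF assms])
  show "\<not> decidable (restricted_monadic_theory n fin_seqs (tree_class n))"
    by (rule diagonal[where md = True]) (rule sent_in_theory(3)[OF assms], use n in simp_all)
qed

end
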